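(* Let $p\neq 2$ be a prime and let $\mathbb L$ be a Galois extension of $\mathbb Q$ of degree $p$, with Galois group $C_p$. Let $s$ be the number of ramified primes in the extension $\mathbb Q\subset\mathbb L$. Then $$H_{tor}(\mathbb L)^{C_p}\cong(\mathbb Z/p)^{s-1}.$$
   Context: $H_{tor}(\mathbb L)=Cl(\mathbb L)$ is the ideal class group of $\mathbb L$ with the induced action of $C_p=Gal(\mathbb L/\mathbb Q)$, and $H_{tor}(\mathbb L)^{C_p}$ is its subgroup of invariants. (For $p\ne 2$ no infinite prime is ramified.) *)

theory Defs
  imports "HOL-Algebra.Algebra" "HOL-Algebra.Algebraic_Closure_Type"
begin

text \<open>
  A field extension \<open>L\<close> of the rationals is a type \<open>'a :: field_char_0\<close>; the embedding of the
  rationals is \<^const>\<open>of_rat\<close>, with image \<^const>\<open>Rats\<close>. The same field as a HOL-Algebra record is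
  \<^const>\<open>ring_of_type_algebra\<close>.
\<close>

subsection \<open>Degree, Galois group\<close>

lemma vector_space_of_rat: "vector_space (\<lambda>(r::rat) (x::'a::field_char_0). of_rat r * x)"
  by unfold_locales (simp_all add: algebra_simps of_rat_add of_rat_mult)

text \<open>As usual for \<open>dim\<close>, the value is 0 for an extension of infinite degree.\<close>

definition rat_degree :: "'a::field_char_0 itself \<Rightarrow> nat" where
  "rat_degree _ = vector_space.dim (\<lambda>(r::rat) (x::'a). of_rat r * x) UNIV"

definition galois_group :: "('a::field_char_0 \<Rightarrow> 'a) monoid" where
  "galois_group =
     \<lparr>carrier = {\<sigma> \<in> ring_iso ring_of_type_algebra ring_of_type_algebra. \<forall>r. \<sigma> (of_rat r) = of_rat r},
      monoid.mult = (\<circ>), one = id\<rparr>"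

definition galois_over_rat :: "'a::field_char_0 itself \<Rightarrow> bool" where
  "galois_over_rat _ \<longleftrightarrow>
     (\<forall>x::'a. algebraic x) \<and> {x::'a. \<forall>\<sigma>\<in>carrier galois_group. \<sigma> x = x} = \<rat>"

subsection \<open>Ring of integers and fractional ideals\<close>

definition ring_of_integers :: "'a::field_char_0 ring" where
  "ring_of_integers = ring_of_type_algebra\<lparr>carrier := {x. algebraic_int x}\<rparr>"

definition fractional_ideals :: "'a::field_char_0 set set" where
  "fractional_ideals =
     {I. I \<noteq> {0} \<and> (\<exists>d\<in>carrier ring_of_integers. d \<noteq> 0 \<and> ideal ((*) d ` I) ring_of_integers)}"

text \<open>\<^const>\<open>ideal_prod\<close>, taken in the field \<open>L\<close>, yields the set of finite sums of products.\<close>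

definition ideal_group :: "'a::field_char_0 set monoid" where
  "ideal_group =
     \<lparr>carrier = fractional_ideals, monoid.mult = ideal_prod ring_of_type_algebra,
      one = carrier ring_of_integers\<rparr>"

definition principal_ideal :: "'a::field_char_0 \<Rightarrow> 'a set" where
  "principal_ideal a = (*) a ` carrier ring_of_integers"

subsection \<open>Ramification\<close>

text \<open>
  \<open>q\<close> is ramified if some exponent in the factorization of \<open>q\<close> times the ring of integers into
  powers of distinct nonzero prime ideals is greater than 1. Only finite primes are considered.
\<close>

definition ramified_primes :: "'a::field_char_0 itself \<Rightarrow> nat set" where
  "ramified_primes _ =
     {q. Factorial_Ring.prime q \<and>
        (\<exists>(S :: 'a set set) (e :: 'a set \<Rightarrow> nat).
           finite S \<and>
           (\<forall>P\<in>S. primeideal P ring_of_integers \<and> P \<noteq> {0} \<and> e P \<ge> 1) \<and>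
           principal_ideal (of_nat q) = (\<Otimes>\<^bsub>ideal_group\<^esub>P\<in>S. P [^]\<^bsub>ideal_group\<^esub> e P) \<and>
           (\<exists>P\<in>S. e P > 1))}"

subsection \<open>Class group and its invariants\<close>

definition class_group :: "'a::field_char_0 set set monoid" where
  "class_group = ideal_group Mod (principal_ideal ` (UNIV - {0}))"

text \<open>
  An ideal class is a set of fractional ideals, so the induced action of \<open>\<sigma>\<close> on classes is
  the twofold image.
\<close>

definition class_action :: "('a::field_char_0 \<Rightarrow> 'a) \<Rightarrow> 'a set set \<Rightarrow> 'a set set" where
  "class_action \<sigma> C = (\<lambda>I. \<sigma> ` I) ` C"

definition class_group_invariants :: "'a::field_char_0 set set monoid" where
  "class_group_invariants =
     class_group\<lparr>carrier :=
       {C \<in> carrier class_group. \<forall>\<sigma>\<in>carrier galois_group. class_action \<sigma> C = C}\<rparr>"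

end

theory Submission
  imports Defs "Jordan_Normal_Form.Char_Poly"
begin

text \<open>
  Let \<open>\<sigma>\<close> generate the Galois group. If the class of \<open>I\<close> is invariant, then \<open>\<sigma> I = (a) I\<close> with
  \<open>N a = \<plusminus>1\<close>; since \<open>p\<close> is odd one may take \<open>N a = 1\<close>, and Hilbert's Theorem 90 turns \<open>I\<close> into an
  invariant ideal of the same class. Modulo rational principal ideals, the invariant ideals form
  \<open>(\<int>/p)\<^sup>s\<close>, generated by the primes \<open>P\<^sub>q\<close> with \<open>P\<^sub>q\<^sup>p = (q)\<close>. The map \<open>(x) \<mapsto> \<sigma> x / x\<close> identifies the
  principal ones among them with \<open>M / (\<sigma> - 1) M\<close>, where \<open>M\<close> is the group of units of norm one.

  This quotient has order \<open>p\<close>, and Dirichlet's unit theorem is not needed to see it. In the group ring,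
  \<open>(\<sigma> - 1)\<^bsup>p - 1\<^esup>\<close> and \<open>p\<close> have the same image in \<open>M\<close>, so \<open>|M / M\<^sup>p| = |M / (\<sigma> - 1) M|\<^bsup>p - 1\<^esup>\<close>.
  If \<open>v\<^sub>1, \<dots>, v\<^sub>N\<close> are incongruent modulo \<open>M\<^sup>p\<close>, then the \<open>N\<^sup>n\<close> products
  over \<open>i < n\<close> of \<open>p\<^sup>i\<close>-th powers of elements \<open>v\<^sub>j\<close> are distinct units with logarithms of size \<open>O(p\<^sup>n)\<close>;
  as the logarithms of \<open>M\<close> form a discrete subgroup of \<open>\<real>\<^bsup>p - 1\<^esup>\<close>, this gives \<open>N \<le> p\<^bsup>p - 1\<^esup>\<close>. Conversely
  \<open>M \<noteq> (\<sigma> - 1) M\<close>, because otherwise \<open>M = M\<^sup>p\<close> would be divisible, while the box principle yields a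
  nontrivial unit.
\<close>

section \<open>Algebraic integers\<close>

text \<open>Since the norm kills \<open>M\<close>, the units of norm one form a module over the ring
  of integers of the \<open>p\<close>-th cyclotomic field, \<open>\<sigma>\<close> acting as a root
  of unity; there \<open>p\<close> is a unit times \<open>(\<sigma> - 1)^(p - 1)\<close>, which is
  why the two operators have the same image. Counting is done on finite sets of incongruent units,
  because finiteness of the quotients is part of the conclusion; it multiplies along iterates
  because \<open>\<sigma> - 1\<close> and the \<open>p\<close>-th power are injective on
  \<open>M\<close>. This rests on a real embedding, which the odd degree provides: the only roots of
  unity are then 1 and -1, and the norm excludes -1.

  The ideal theory starts from invertibility: by Dedekind's Prague theorem the product of the
  conjugates of an integral ideal is generated by a rational integer. Divisibility and the
  factorization of invariant ideals follow by cancellation, without general unique factorization. At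
  the end, the relations between the primes \<open>P_q\<close> modulo \<open>p\<close> form a line,
  which removes one of the \<open>s\<close> factors.\<close>

interpretation zmod: Modules.module "\<lambda>(k::int) (x::'a::field_char_0). of_int k * x"
  by unfold_locales (simp_all add: algebra_simps)

lemma zspan_mult_closed:
  assumes "\<And>v. v \<in> V \<Longrightarrow> x * v \<in> zmod.span W" "s \<in> zmod.span V"
  shows "x * s \<in> zmod.span W"
  using assms(2)
proof (induction rule: zmod.span_induct_alt)
  case base
  show ?case by (simp add: zmod.span_zero)
next
  case (step c v y)
  have "of_int c * (x * v) + x * y \<in> zmod.span W"
    by (intro zmod.span_add zmod.span_scale assms(1) step)
  then show ?case by (simp add: algebra_simps)
qed

text \<open>Listed as a vector, the elements of \<open>V\<close> form an eigenvector, with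
  eigenvalue \<open>x\<close>, of the integer matrix that expresses multiplication by
  \<open>x\<close> on \<open>V\<close>. It is nonzero because \<open>1 \<in> V\<close>, so
  \<open>x\<close> is a root of a monic integral characteristic polynomial.\<close>

lemma algebraic_int_if_zspan:
  fixes x :: "'a::field_char_0"
  assumes "finite V" "1 \<in> V" "\<And>v. v \<in> V \<Longrightarrow> x * v \<in> zmod.span V"
  shows "algebraic_int x"
proof -
  define n where "n = card V"
  obtain e where e: "bij_betw e {..<n} V"
    using \<open>finite V\<close> unfolding n_def by (metis bij_betw_from_nat_into_finite)
  have "\<forall>i<n. \<exists>u. x * e i = (\<Sum>v\<in>V. of_int (u v) * v)"
  proof (intro allI impI)
    fix i assume "i < n"
    then have "e i \<in> V" using e by (auto simp: bij_betw_def)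
    from assms(3)[OF this] show "\<exists>u. x * e i = (\<Sum>v\<in>V. of_int (u v) * v)"
      unfolding zmod.span_finite[OF \<open>finite V\<close>] by auto
  qed
  then obtain u where u: "\<And>i. i < n \<Longrightarrow> x * e i = (\<Sum>v\<in>V. of_int (u i v) * v)"
    by metis
  define A where "A = mat n n (\<lambda>(i,j). u i (e j))"
  define B where "B = map_mat (of_int :: int \<Rightarrow> 'a) A"
  define w where "w = vec n e"
  have A: "A \<in> carrier_mat n n" and B: "B \<in> carrier_mat n n" by (simp_all add: A_def B_def)
  have rel: "x * e i = (\<Sum>j<n. of_int (u i (e j)) * e j)" if "i < n" for i
    using u[OF that] sum.reindex_bij_betw[OF e, of "\<lambda>v. of_int (u i v) * v"] by simp
  have "eigenvector B w x"
    unfolding eigenvector_def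
  proof (intro conjI)
    show "w \<in> carrier_vec (dim_row B)" by (simp add: w_def B_def A_def)
    from e \<open>1 \<in> V\<close> obtain i where "i < n" "e i = 1" by (auto simp: bij_betw_def)
    then have "vec_index w i \<noteq> 0" by (simp add: w_def)
    with \<open>i < n\<close> show "w \<noteq> 0\<^sub>v (dim_row B)" by (auto simp: B_def A_def)
    show "B *\<^sub>v w = x \<cdot>\<^sub>v w"
    proof (rule eq_vecI)
      fix i assume "i < dim_vec (x \<cdot>\<^sub>v w)"
      then have i: "i < n" by (simp add: w_def)
      have "vec_index (B *\<^sub>v w) i = (\<Sum>j<n. of_int (u i (e j)) * e j)"
        using i by (simp add: B_def A_def w_def scalar_prod_def atLeast0LessThan)
      then show "vec_index (B *\<^sub>v w) i = vec_index (x \<cdot>\<^sub>v w) i" using rel[OF i] i by (simp add: w_def)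
    qed (simp add: B_def A_def w_def)
  qed
  then have "poly (char_poly B) x = 0"
    using eigenvalue_root_char_poly[OF B] by (auto simp: eigenvalue_def)
  moreover have "char_poly B = map_poly of_int (char_poly A)"
    unfolding B_def by (rule of_int_hom.char_poly_hom[OF A])
  moreover have "lead_coeff (char_poly A) = 1"
    using degree_monic_char_poly[OF A] by simp
  ultimately show ?thesis
    unfolding algebraic_int_altdef_ipoly by metis
qed

text \<open>The products \<open>v * x ^ j\<close> with \<open>j < n\<close> span a module stable
  under \<open>x\<close>, the relation taking care of the overflow \<open>x ^ n\<close>. The
  coefficients only have to preserve the span of \<open>V\<close>, so they may be integers or
  algebraic integers already accounted for; \<open>C\<close> remembers the elements under which
  stability is to persist.\<close>

lemma zspan_extend:
  fixes x :: "'a::field_char_0"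
  assumes "finite V" "1 \<in> V" "n > 0"
    and C: "\<And>c v. c \<in> C \<Longrightarrow> v \<in> V \<Longrightarrow> c * v \<in> zmod.span V"
    and rel: "x ^ n = (\<Sum>j<n. a j * x ^ j)"
    and a: "\<And>j v. j < n \<Longrightarrow> v \<in> V \<Longrightarrow> a j * v \<in> zmod.span V"
  shows "\<exists>W. finite W \<and> 1 \<in> W \<and> (\<forall>c\<in>insert x C. \<forall>v\<in>W. c * v \<in> zmod.span W)"
proof -
  define W where "W = (\<lambda>(v,j). v * x ^ j) ` (V \<times> {..<n})"
  have mem: "v * x ^ j \<in> zmod.span W" if "v \<in> V" "j < n" for v j
    using that by (intro zmod.span_base) (auto simp: W_def)
  have lift: "s * x ^ j \<in> zmod.span W" if "s \<in> zmod.span V" "j < n" for s j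
    using zspan_mult_closed[of V "x ^ j" W s] mem that by (simp add: mult.commute)
  have "c * w \<in> zmod.span W" if c: "c \<in> insert x C" and w: "w \<in> W" for c w
  proof -
    obtain v j where v: "v \<in> V" "j < n" "w = v * x ^ j" using w by (auto simp: W_def)
    show ?thesis
    proof (cases "c \<in> C")
      case True
      from lift[OF C[OF True v(1)] v(2)] v(3) show ?thesis by (simp add: mult_ac)
    next
      case False
      then have c: "c = x" using c by auto
      show ?thesis
      proof (cases "Suc j < n")
        case True
        from mem[OF v(1) True] show ?thesis by (simp add: c v(3) mult_ac)
      next
        case False
        then have "Suc j = n" using v(2) by simp
        then have "c * w = v * x ^ n" by (auto simp: c v(3) mult_ac)
        also have "\<dots> = (\<Sum>j<n. a j * v * x ^ j)"
          by (simp add: rel sum_distrib_left mult_ac)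
        also have "\<dots> \<in> zmod.span W"
          by (intro zmod.span_sum lift a v(1)) auto
        finally show ?thesis .
      qed
    qed
  qed
  moreover have "1 \<in> W" using assms(2,3) by (auto simp: W_def intro!: image_eqI[of _ _ "(1,0)"])
  moreover have "finite W" using assms(1) by (simp add: W_def)
  ultimately show ?thesis by blast
qed

lemma algebraic_int_relation:
  fixes x :: "'a::field_char_0"
  assumes "algebraic_int x"
  obtains n a where "n > 0" "x ^ n = (\<Sum>j<n. of_int (a j) * x ^ j)"
proof -
  obtain p where p: "poly (map_poly of_int p) x = 0" "lead_coeff p = 1"
    using assms by (auto simp: algebraic_int_altdef_ipoly)
  define n where "n = degree p"
  have "n > 0"
  proof (rule ccontr)
    assume "\<not> n > 0"
    then have "p = 1" using p(2) by (auto simp: n_def elim!: degree_eq_zeroE)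
    then show False using p(1) by simp
  qed
  have "0 = (\<Sum>j\<le>n. of_int (coeff p j) * x ^ j)"
    using p(1) by (simp add: poly_altdef coeff_map_poly degree_map_poly n_def)
  also have "\<dots> = (\<Sum>j<n. of_int (coeff p j) * x ^ j) + x ^ n"
    using p(2) by (simp add: n_def lessThan_Suc_atMost[symmetric])
  finally have "x ^ n = (\<Sum>j<n. of_int (- coeff p j) * x ^ j)"
    by (simp add: sum_negf eq_neg_iff_add_eq_0 add.commute)
  then show ?thesis using that[OF \<open>n > 0\<close>, of "\<lambda>j. - coeff p j"] by blast
qed

lemma algebraic_ints_zspan:
  fixes C :: "'a::field_char_0 set"
  assumes "finite C" "\<forall>c\<in>C. algebraic_int c"
  shows "\<exists>V. finite V \<and> 1 \<in> V \<and> (\<forall>c\<in>C. \<forall>v\<in>V. c * v \<in> zmod.span V)"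
  using assms
proof (induction rule: finite_induct)
  case empty
  show ?case by (intro exI[of _ "{1}"]) auto
next
  case (insert x C)
  then obtain V where V: "finite V" "1 \<in> V" "\<And>c v. c \<in> C \<Longrightarrow> v \<in> V \<Longrightarrow> c * v \<in> zmod.span V"
    by auto
  obtain n a where n: "n > 0" "x ^ n = (\<Sum>j<n. of_int (a j) * x ^ j)"
    using insert.prems by (auto elim: algebraic_int_relation)
  show ?case
    by (rule zspan_extend[OF V(1,2) n(1) _ n(2)]) (auto intro: V(3) zmod.span_scale zmod.span_base)
qed

text \<open>Transitivity of integrality: a finitely generated module stable under the coefficients
  is enlarged to one stable under \<open>x\<close>.\<close>

lemma algebraic_int_monic_relation:
  fixes x :: "'a::field_char_0"
  assumes "x ^ n = (\<Sum>j<n. a j * x ^ j)" "\<And>j. j < n \<Longrightarrow> algebraic_int (a j)"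
  shows "algebraic_int x"
proof -
  have n: "n > 0" using assms(1) by (cases n) auto
  obtain V where V: "finite V" "1 \<in> V" "\<And>c v. c \<in> a ` {..<n} \<Longrightarrow> v \<in> V \<Longrightarrow> c * v \<in> zmod.span V"
    using algebraic_ints_zspan[of "a ` {..<n}"] assms(2) by auto
  obtain W where "finite W" "1 \<in> W" "\<forall>v\<in>W. x * v \<in> zmod.span W"
    using zspan_extend[OF V(1,2) n _ assms(1), of "{}"] V(3) by auto
  then show ?thesis by (intro algebraic_int_if_zspan) auto
qed

lemma algebraic_int_add_mult:
  fixes x y :: "'a::field_char_0"
  assumes "algebraic_int x" "algebraic_int y"
  shows algebraic_int_add: "algebraic_int (x + y)"
    and algebraic_int_mult: "algebraic_int (x * y)"
proof -
  obtain V where V: "finite V" "1 \<in> V" "\<And>c v. c \<in> {x,y} \<Longrightarrow> v \<in> V \<Longrightarrow> c * v \<in> zmod.span V"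
    using algebraic_ints_zspan[of "{x,y}"] assms by auto
  show "algebraic_int (x + y)"
  proof (rule algebraic_int_if_zspan[OF V(1,2)])
    fix v assume v: "v \<in> V"
    have "x * v + y * v \<in> zmod.span V"
      using V(3)[OF _ v, of x] V(3)[OF _ v, of y] by (simp add: zmod.span_add)
    then show "(x + y) * v \<in> zmod.span V" by (simp add: distrib_right)
  qed
  show "algebraic_int (x * y)"
  proof (rule algebraic_int_if_zspan[OF V(1,2)])
    fix v assume v: "v \<in> V"
    have "x * (y * v) \<in> zmod.span V"
    proof (rule zspan_mult_closed)
      show "y * v \<in> zmod.span V" using V(3)[OF _ v, of y] by simp
    qed (use V(3)[of x] in blast)
    then show "x * y * v \<in> zmod.span V" by (simp only: mult.assoc)
  qed
qed

lemma algebraic_int_diff: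
  "algebraic_int x \<Longrightarrow> algebraic_int y \<Longrightarrow> algebraic_int (x - y :: 'a::field_char_0)"
  using algebraic_int_add[of x "- y"] by simp

lemma algebraic_int_sum:
  "(\<And>i. i \<in> A \<Longrightarrow> algebraic_int (f i :: 'a::field_char_0)) \<Longrightarrow> algebraic_int (sum f A)"
  by (induction A rule: infinite_finite_induct) (auto intro: algebraic_int_add)

lemma algebraic_int_prod:
  "(\<And>i. i \<in> A \<Longrightarrow> algebraic_int (f i :: 'a::field_char_0)) \<Longrightarrow> algebraic_int (prod f A)"
  by (induction A rule: infinite_finite_induct) (auto intro: algebraic_int_mult)

lemma algebraic_int_power: "algebraic_int x \<Longrightarrow> algebraic_int (x ^ n :: 'a::field_char_0)"
  by (induction n) (auto intro: algebraic_int_mult)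

lemma algebraic_int_integral_domain_hom:
  fixes f :: "'a::field_char_0 \<Rightarrow> 'b::field_char_0"
  assumes add: "\<And>x y. f (x + y) = f x + f y" and mult: "\<And>x y. f (x * y) = f x * f y"
    and one: "f 1 = 1" and x: "algebraic_int x"
  shows "algebraic_int (f x)"
proof -
  have f0: "f 0 = 0" using add[of 0 0] by simp
  have nat: "f (of_nat n) = of_nat n" for n by (induction n) (simp_all add: add one f0)
  have neg: "f (- x) = - f x" for x using add[of x "- x"] f0 by (simp add: eq_neg_iff_add_eq_0 add.commute)
  have int: "f (of_int k) = of_int k" for k by (cases k rule: int_cases2) (simp_all add: nat neg)
  have power: "f (x ^ n) = f x ^ n" for x n by (induction n) (simp_all add: one mult)
  have sum: "f (sum g A) = (\<Sum>i\<in>A. f (g i))" for g and A :: "nat set"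
    by (induction A rule: infinite_finite_induct) (simp_all add: f0 add)
  obtain n a where "n > 0" "x ^ n = (\<Sum>j<n. of_int (a j) * x ^ j)"
    using x by (auto elim: algebraic_int_relation)
  from arg_cong[OF this(2), of f] show ?thesis
    by (intro algebraic_int_monic_relation[of "f x" n "\<lambda>j. of_int (a j)"])
       (simp_all add: power mult int sum)
qed

lemma algebraic_int_to_ac_iff: "algebraic_int (to_ac x) \<longleftrightarrow> algebraic_int (x :: 'a::field_char_0)"
proof
  assume "algebraic_int (to_ac x)"
  then obtain n a where "n > 0" "to_ac x ^ n = (\<Sum>j<n. of_int (a j) * to_ac x ^ j)"
    by (auto elim: algebraic_int_relation)
  then have "to_ac (x ^ n) = to_ac (\<Sum>j<n. of_int (a j) * x ^ j)" by (simp add: to_ac_sum)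
  then have "x ^ n = (\<Sum>j<n. of_int (a j) * x ^ j)" by (simp only: to_ac_eq_iff)
  then show "algebraic_int x" by (rule algebraic_int_monic_relation) auto
qed (auto intro: algebraic_int_integral_domain_hom)

subsection \<open>Polynomials with integral coefficients\<close>

definition integral_poly :: "'a::field_char_0 poly \<Rightarrow> bool" where
  "integral_poly f \<longleftrightarrow> (\<forall>i. algebraic_int (coeff f i))"

lemma integral_poly_add: "integral_poly f \<Longrightarrow> integral_poly g \<Longrightarrow> integral_poly (f + g)"
  and integral_poly_diff: "integral_poly f \<Longrightarrow> integral_poly g \<Longrightarrow> integral_poly (f - g)"
  by (auto simp: integral_poly_def intro: algebraic_int_add algebraic_int_diff)

lemma integral_poly_mult: "integral_poly f \<Longrightarrow> integral_poly g \<Longrightarrow> integral_poly (f * g)"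
  by (auto simp: integral_poly_def coeff_mult intro!: algebraic_int_sum algebraic_int_mult)

lemma integral_poly_prod: "(\<And>i. i \<in> A \<Longrightarrow> integral_poly (f i)) \<Longrightarrow> integral_poly (prod f A)"
  by (induction A rule: infinite_finite_induct)
     (auto intro: integral_poly_mult simp: integral_poly_def[of 1] coeff_1)

lemma integral_poly_pCons: "integral_poly (pCons a f) \<longleftrightarrow> algebraic_int a \<and> integral_poly f"
  by (auto simp: integral_poly_def coeff_pCons split: nat.splits)

text \<open>Multiplying \<open>h(r) = 0\<close> by \<open>l ^ (d - 1)\<close>, with \<open>l\<close>
  the leading coefficient and \<open>d\<close> the degree, turns it into a monic relation for
  \<open>l * r\<close>.\<close>

lemma algebraic_int_lead_coeff_mult_root:
  assumes h: "integral_poly h" "poly h r = 0"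
  shows "algebraic_int (lead_coeff h * r)"
proof (cases "degree h = 0")
  case True
  then obtain c where "h = [:c:]" by (auto elim!: degree_eq_zeroE)
  with h(2) show ?thesis by simp
next
  case False
  define d where "d = degree h"
  define l where "l = lead_coeff h"
  have d: "d > 0" using False by (simp add: d_def)
  have coeffs: "algebraic_int (coeff h j)" for j using h(1) by (simp add: integral_poly_def)
  let ?y = "l * r"
  have "0 = (\<Sum>j\<le>d. coeff h j * r ^ j)" using h(2) by (simp add: poly_altdef d_def)
  also have "\<dots> = (\<Sum>j<d. coeff h j * r ^ j) + l * r ^ d"
    by (simp add: l_def d_def lessThan_Suc_atMost[symmetric])
  finally have "l * r ^ d = - (\<Sum>j<d. coeff h j * r ^ j)"
    by (simp add: eq_neg_iff_add_eq_0 add.commute)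
  moreover have "?y ^ d = l ^ (d - 1) * (l * r ^ d)"
    using d by (cases d) (simp_all add: power_mult_distrib mult_ac)
  ultimately have "?y ^ d = (\<Sum>j<d. - (l ^ (d - 1) * coeff h j * r ^ j))"
    by (simp add: sum_distrib_left sum_negf mult.assoc)
  also have "\<dots> = (\<Sum>j<d. - coeff h j * l ^ (d - 1 - j) * ?y ^ j)"
  proof (rule sum.cong)
    fix j assume "j \<in> {..<d}"
    then have "l ^ (d - 1) = l ^ (d - 1 - j) * l ^ j" by (simp flip: power_add)
    then show "- (l ^ (d - 1) * coeff h j * r ^ j) = - coeff h j * l ^ (d - 1 - j) * ?y ^ j"
      by (simp add: power_mult_distrib mult_ac)
  qed simp
  finally show ?thesis
    unfolding l_def[symmetric]
    by (rule algebraic_int_monic_relation)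
       (intro algebraic_int_mult algebraic_int_power algebraic_int_minus coeffs,
        simp add: l_def coeffs)
qed

lemma algebraic_imp_multiple_algebraic_int:
  fixes x :: "'a::field_char_0"
  assumes "algebraic x"
  obtains n :: nat where "n > 0" "algebraic_int (of_nat n * x)"
proof -
  obtain p where p: "poly (map_poly of_int p) x = 0" "p \<noteq> 0"
    using assms by (auto elim: algebraicE')
  define l where "l = lead_coeff p"
  have "integral_poly (map_poly of_int p :: 'a poly)"
    by (simp add: integral_poly_def coeff_map_poly)
  from algebraic_int_lead_coeff_mult_root[OF this p(1)]
  have y: "algebraic_int (of_int l * x)" by (simp add: l_def)
  have "algebraic_int (of_nat (nat \<bar>l\<bar>) * x)"
  proof (cases "l > 0")
    case False
    then have "of_nat (nat \<bar>l\<bar>) * x = - (of_int l * x)" by simp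
    with y show ?thesis by simp
  qed (use y in simp)
  with that[of "nat \<bar>l\<bar>"] p(2) show ?thesis by (simp add: l_def)
qed

text \<open>Induction on the degree \<open>d\<close> of \<open>k\<close>: if \<open>a\<close> is the
  leading coefficient of \<open>k\<close>, then \<open>a * r\<close> is integral because
  \<open>r\<close> is a root of the product. So \<open>(X - r) * a X ^ d\<close> is integral and may
  be subtracted, which removes the leading term of \<open>k\<close>.\<close>

lemma integral_poly_linear_factor:
  "integral_poly ([:- r, 1:] * k) \<Longrightarrow> integral_poly k"
proof (induction "degree k" arbitrary: k rule: less_induct)
  case less
  show ?case
  proof (cases "k = 0")
    case True
    then show ?thesis by (simp add: integral_poly_def)
  next
    case False
    define a where "a = lead_coeff k"
    define m where "m = monom a (degree k)"
    have l: "lead_coeff ([:- r, 1:] * k) = a" by (simp only: lead_coeff_mult a_def) simp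
    have a: "algebraic_int a"
      using less.prems l unfolding integral_poly_def by metis
    have "algebraic_int (a * r)"
      using algebraic_int_lead_coeff_mult_root[OF less.prems, of r] l by simp
    then have "integral_poly ([:- r, 1:] * m)"
      using a by (auto simp: m_def integral_poly_def coeff_monom coeff_pCons mult.commute
          intro: algebraic_int_add algebraic_int_minus split: nat.splits)
    then have int: "integral_poly ([:- r, 1:] * (k - m))"
      using integral_poly_diff[OF less.prems] by (simp only: right_diff_distrib)
    have k: "integral_poly (k - m)"
    proof (cases "k - m = 0")
      case True
      then show ?thesis by (simp add: integral_poly_def)
    next
      case False
      have "coeff (k - m) (degree k) = 0" by (simp add: m_def a_def)
      moreover have "degree (k - m) \<le> degree k"
        by (intro degree_diff_le) (auto simp: m_def degree_monom_le)
      ultimately have "degree (k - m) < degree k"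
        using False by (metis le_neq_implies_less leading_coeff_0_iff)
      from less.hyps[OF this int] show ?thesis .
    qed
    have "integral_poly m" using a by (auto simp: m_def integral_poly_def coeff_monom)
    from integral_poly_add[OF k this] show ?thesis by simp
  qed
qed

text \<open>Dedekind's Prague theorem. If \<open>f = (X - r) f\<^sub>1\<close>, then \<open>f\<^sub>1 g\<close> is integral, and so is
  \<open>r f\<^sub>1 g = X f\<^sub>1 g - f g\<close>; the induction hypothesis applies to the pairs \<open>f\<^sub>1, g\<close>
  and \<open>r f\<^sub>1, g\<close>.\<close>

lemma integral_poly_mult_coeffs_alg_closed:
  fixes f g :: "'a::{alg_closed_field,field_char_0} poly"
  assumes "integral_poly (f * g)"
  shows "algebraic_int (coeff f i * coeff g j)"
  using assms
proof (induction "degree f" arbitrary: f i rule: less_induct)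
  case less
  show ?case
  proof (cases "degree f = 0")
    case True
    then obtain c where "f = [:c:]" by (auto elim!: degree_eq_zeroE)
    with less.prems show ?thesis
      by (cases i) (auto simp: integral_poly_def)
  next
    case False
    then obtain r where "poly f r = 0" using alg_closed_imp_poly_has_root[of f] by auto
    then obtain f1 where f: "f = [:- r, 1:] * f1" by (auto simp: poly_eq_0_iff_dvd elim: dvdE)
    have "f1 \<noteq> 0" using f False by auto
    then have deg: "degree f1 < degree f" "degree (smult r f1) < degree f"
    proof -
      have "degree f = Suc (degree f1)"
        unfolding f using \<open>f1 \<noteq> 0\<close> by (subst degree_mult_eq) simp_all
      then show "degree f1 < degree f" "degree (smult r f1) < degree f" by simp_all
    qed
    have int: "integral_poly (f1 * g)"
      using less.prems unfolding f mult.assoc by (rule integral_poly_linear_factor)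
    then have "integral_poly (pCons 0 (f1 * g) - f * g)"
      using less.prems by (intro integral_poly_diff) (auto simp: integral_poly_pCons)
    also have "pCons 0 (f1 * g) - f * g = smult r f1 * g"
      by (simp add: f algebra_simps)
    finally have int2: "integral_poly (smult r f1 * g)" .
    have "coeff f i = (case i of 0 \<Rightarrow> 0 | Suc k \<Rightarrow> coeff f1 k) - coeff (smult r f1) i"
      by (simp add: f coeff_pCons split: nat.splits)
    then show ?thesis
      using less.hyps[OF deg(1) int] less.hyps[OF deg(2) int2]
      by (auto simp: left_diff_distrib simp del: coeff_smult intro!: algebraic_int_diff split: nat.splits)
  qed
qed

text \<open>The Prague theorem splits off roots, so the polynomials are moved to the algebraic
  closure; integrality comes back because \<open>to_ac\<close> reflects it.\<close>

lemma integral_poly_mult_coeffs: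
  fixes f g :: "'a::field_char_0 poly"
  assumes "integral_poly (f * g)"
  shows "algebraic_int (coeff f i * coeff g j)"
proof -
  let ?F = "map_poly to_ac f" and ?G = "map_poly to_ac g"
  have "?F * ?G = map_poly to_ac (f * g)"
    by (rule poly_eqI) (simp add: coeff_mult coeff_map_poly to_ac_sum)
  then have "integral_poly (?F * ?G)"
    using assms by (simp add: integral_poly_def coeff_map_poly algebraic_int_to_ac_iff)
  from integral_poly_mult_coeffs_alg_closed[OF this, of i j] show ?thesis
    by (simp add: coeff_map_poly flip: to_ac_mult add: algebraic_int_to_ac_iff)
qed

text \<open>The scalar \<open>c\<close> collects the coefficients chosen so far; this is what lets
  the statement for two factors be iterated.\<close>

lemma integral_poly_prod_coeffs:
  fixes f :: "'b \<Rightarrow> 'a::field_char_0 poly"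
  assumes "finite A" "integral_poly (smult c (\<Prod>k\<in>A. f k))"
  shows "algebraic_int (c * (\<Prod>k\<in>A. coeff (f k) (i k)))"
  using assms
proof (induction A arbitrary: c rule: finite_induct)
  case empty
  then have "integral_poly [:c:]" by (simp add: one_pCons)
  then show ?case by (simp add: integral_poly_pCons)
next
  case (insert x A)
  from insert have "integral_poly (f x * smult c (prod f A))" by (simp add: mult_smult_right)
  from integral_poly_mult_coeffs[OF this, of "i x"]
  have "integral_poly (smult (c * coeff (f x) (i x)) (prod f A))"
    by (simp add: integral_poly_def mult_ac)
  from insert.IH[OF this] insert.hyps show ?case by (simp add: mult_ac)
qed

interpretation of_rat_hom: field_hom "of_rat :: rat \<Rightarrow> 'b::field_char_0"
  by unfold_locales (simp_all add: of_rat_add of_rat_mult)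

lemma map_poly_of_rat:
  fixes f g :: "rat poly"
  shows "map_poly (of_rat :: rat \<Rightarrow> 'b::field_char_0) (f + g) = map_poly of_rat f + map_poly of_rat g"
    and "map_poly (of_rat :: rat \<Rightarrow> 'b) (f - g) = map_poly of_rat f - map_poly of_rat g"
    and "map_poly (of_rat :: rat \<Rightarrow> 'b) (f * g) = map_poly of_rat f * map_poly of_rat g"
  by (rule poly_eqI;
      simp add: coeff_map_poly coeff_mult of_rat_add of_rat_diff of_rat_sum of_rat_mult)+

section \<open>Cyclic extensions of odd prime degree\<close>

text \<open>Only a generator of the Galois group is kept: \<open>\<sigma>_period\<close> and
  \<open>\<sigma>_nontrivial\<close> give it order \<open>p\<close>, and
  \<open>\<sigma>_fixed\<close> replaces Galois theory.\<close>

locale cyclic_field =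
  fixes \<sigma> :: "'L::field_char_0 \<Rightarrow> 'L" and p :: nat
  assumes prime_p: "Factorial_Ring.prime p" and odd_p: "odd p"
    and \<sigma>_add [simp]: "\<sigma> (x + y) = \<sigma> x + \<sigma> y"
    and \<sigma>_mult [simp]: "\<sigma> (x * y) = \<sigma> x * \<sigma> y"
    and \<sigma>_1 [simp]: "\<sigma> 1 = 1"
    and \<sigma>_period: "(\<sigma> ^^ p) x = x"
    and \<sigma>_fixed: "\<sigma> x = x \<Longrightarrow> x \<in> \<rat>"
    and \<sigma>_nontrivial: "\<exists>x. \<sigma> x \<noteq> x"
    and algebraic: "algebraic (x :: 'L)"
begin

abbreviation conj :: "nat \<Rightarrow> 'L \<Rightarrow> 'L" where "conj i \<equiv> \<sigma> ^^ i"

lemma p_gt_2: "p > 2"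
  using prime_p odd_p prime_ge_2_nat[of p] by (cases "p = 2") auto

lemma conj_add [simp]: "conj i (x + y) = conj i x + conj i y"
  and conj_mult [simp]: "conj i (x * y) = conj i x * conj i y"
  and conj_1 [simp]: "conj i 1 = 1"
  by (induction i) simp_all

lemma conj_0 [simp]: "conj i 0 = 0"
  using conj_add[of i 0 0] by simp

lemma conj_minus [simp]: "conj i (- x) = - conj i x"
  using conj_add[of i x "- x"] by (simp add: eq_neg_iff_add_eq_0 add.commute)

lemma conj_diff [simp]: "conj i (x - y) = conj i x - conj i y"
  using conj_add[of i x "- y"] by simp

lemma conj_sum: "conj i (sum f A) = (\<Sum>a\<in>A. conj i (f a))"
  by (induction A rule: infinite_finite_induct) simp_all

lemma conj_prod: "conj i (prod f A) = (\<Prod>a\<in>A. conj i (f a))"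
  by (induction A rule: infinite_finite_induct) simp_all

lemma \<sigma>_sum: "\<sigma> (sum f A) = (\<Sum>a\<in>A. \<sigma> (f a))"
  using conj_sum[of 1] by simp

lemma \<sigma>_prod: "\<sigma> (prod f A) = (\<Prod>a\<in>A. \<sigma> (f a))"
  using conj_prod[of 1] by simp

lemma conj_power [simp]: "conj i (x ^ n) = conj i x ^ n"
  by (induction n) simp_all

lemma conj_conj: "conj i (conj j x) = conj (i + j) x"
  by (simp add: funpow_add)

lemma conj_period_mult: "conj (p * k) x = x"
  by (induction k) (simp_all add: funpow_add \<sigma>_period)

lemma conj_mod: "conj (i mod p) x = conj i x"
proof -
  have "conj i x = conj (i mod p + p * (i div p)) x" by simp
  also have "\<dots> = conj (i mod p) x" by (simp only: funpow_add o_apply conj_period_mult)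
  finally show ?thesis by simp
qed

lemma conj_inverse_left: "i \<le> p \<Longrightarrow> conj (p - i) (conj i x) = x"
  and conj_inverse_right: "i \<le> p \<Longrightarrow> conj i (conj (p - i) x) = x"
  by (simp_all add: conj_conj \<sigma>_period)

lemma \<sigma>_inj: "inj \<sigma>"
proof (rule inj_on_inverseI)
  show "conj (p - 1) (\<sigma> x) = x" for x
    using conj_inverse_left[of 1 x] p_gt_2 by simp
qed

lemma conj_inj: "inj (conj i)"
  by (rule inj_fn[OF \<sigma>_inj])

lemma conj_eq_iff [simp]: "conj i x = conj i y \<longleftrightarrow> x = y"
  using conj_inj by (auto simp: inj_def)

lemma conj_eq_0_iff [simp]: "conj i x = 0 \<longleftrightarrow> x = 0"
  using conj_eq_iff[of i x 0] by simp

lemma conj_inverse [simp]: "conj i (inverse x) = inverse (conj i x)"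
proof (cases "x = 0")
  case False
  then have "conj i x * conj i (inverse x) = 1" by (simp flip: conj_mult)
  then show ?thesis by (metis inverse_unique)
qed simp

lemma conj_divide [simp]: "conj i (x / y) = conj i x / conj i y"
  by (simp add: divide_inverse)

lemmas \<sigma>_simps [simp] =
  conj_0[of 1, simplified] conj_minus[of 1, simplified] conj_diff[of 1, simplified]
  conj_power[of 1, simplified] conj_eq_iff[of 1, simplified] conj_eq_0_iff[of 1, simplified]
  conj_inverse[of 1, simplified] conj_divide[of 1, simplified]

lemma conj_of_nat [simp]: "conj i (of_nat n) = of_nat n"
  by (induction n) simp_all

lemma conj_of_int [simp]: "conj i (of_int n) = of_int n"
  by (cases n rule: int_cases2) simp_all

lemma conj_of_rat [simp]: "conj i (of_rat q) = of_rat q"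
  by (cases q) (simp add: of_rat_rat)

lemma conj_Rats: "x \<in> \<rat> \<Longrightarrow> conj i x = x"
  by (auto elim!: Rats_cases)

lemma conj_\<sigma>: "conj i (\<sigma> x) = \<sigma> (conj i x)"
  by (simp add: funpow_swap1)

lemma algebraic_int_conj [simp]: "algebraic_int (conj i x) \<longleftrightarrow> algebraic_int x"
proof
  assume "algebraic_int (conj i x)"
  then have "algebraic_int (conj (p - i mod p) (conj i x))"
    by (rule algebraic_int_integral_domain_hom[rotated 3]) simp_all
  moreover have "conj (p - i mod p) (conj i x) = x"
    using conj_inverse_left[of "i mod p" x] p_gt_2 by (simp add: conj_mod less_imp_le)
  ultimately show "algebraic_int x" by simp
qed (auto intro: algebraic_int_integral_domain_hom)

lemma algebraic_int_\<sigma> [simp]: "algebraic_int (\<sigma> x) \<longleftrightarrow> algebraic_int x"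
  using algebraic_int_conj[of 1 x] by simp

text \<open>Since \<open>p\<close> is prime, some power of \<open>\<sigma> ^^ i\<close> is
  \<open>\<sigma>\<close> itself, by Bezout.\<close>

lemma conj_fixed:
  assumes "0 < i" "i < p" "conj i x = x"
  shows "x \<in> \<rat>"
proof -
  have "Rings.coprime i p"
    using assms(1,2) prime_p by (metis coprime_commute nat_dvd_not_less prime_imp_coprime_nat)
  then obtain k l where k: "i * k = p * l + 1"
    using bezout_nat[of i p] assms(1) by auto
  have "conj (i * k) x = x" for k
    by (induction k) (simp_all add: funpow_add assms(3))
  from this[of k] have "\<sigma> (conj (p * l) x) = x" unfolding k by simp
  then show ?thesis by (intro \<sigma>_fixed) (simp only: conj_period_mult)
qed

lemma rotate_bij: "bij_betw (\<lambda>i. (i + j) mod p) {..<p} {..<p}"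
proof -
  have *: "i = k" if "i \<le> k" "k < p" "(i + j) mod p = (k + j) mod p" for i k
    using that mod_eq_dvd_iff_nat[of "i + j" "k + j" p] nat_dvd_not_less[of "k - i" p] by fastforce
  have "inj_on (\<lambda>i. (i + j) mod p) {..<p}"
    by (rule inj_onI) (metis * lessThan_iff nat_le_linear)
  then show ?thesis
    using p_gt_2 by (intro bij_betw_imageI endo_inj_surj) auto
qed

definition Tr :: "'L \<Rightarrow> 'L" where "Tr x = (\<Sum>i<p. conj i x)"
definition Nm :: "'L \<Rightarrow> 'L" where "Nm x = (\<Prod>i<p. conj i x)"

lemma rotate_sum: "(\<Sum>i<p. f (conj (i + j) x)) = (\<Sum>i<p. f (conj i x))"
  using sum.reindex_bij_betw[OF rotate_bij, of "\<lambda>i. f (conj i x)" j] by (simp add: conj_mod)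

lemma rotate_prod: "(\<Prod>i<p. f (conj (i + j) x)) = (\<Prod>i<p. f (conj i x))"
  using prod.reindex_bij_betw[OF rotate_bij, of "\<lambda>i. f (conj i x)" j] by (simp add: conj_mod)

lemma Tr_conj [simp]: "Tr (conj j x) = Tr x" and Nm_conj [simp]: "Nm (conj j x) = Nm x"
  using rotate_sum[of "\<lambda>x. x" j x] rotate_prod[of "\<lambda>x. x" j x]
  by (simp_all add: Tr_def Nm_def conj_conj)

lemma Nm_\<sigma> [simp]: "Nm (\<sigma> x) = Nm x"
  using Nm_conj[of 1 x] by simp

lemma Tr_Rats: "Tr x \<in> \<rat>"
proof (rule \<sigma>_fixed)
  have "\<sigma> (Tr x) = Tr (conj 1 x)"
    using conj_sum[of 1] by (simp add: Tr_def conj_\<sigma>)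
  then show "\<sigma> (Tr x) = Tr x" by (simp only: Tr_conj)
qed

lemma Nm_Rats: "Nm x \<in> \<rat>"
proof (rule \<sigma>_fixed)
  have "\<sigma> (Nm x) = Nm (conj 1 x)"
    using conj_prod[of 1] by (simp add: Nm_def conj_\<sigma>)
  then show "\<sigma> (Nm x) = Nm x" by (simp only: Nm_conj)
qed

lemma Tr_Ints: "algebraic_int x \<Longrightarrow> Tr x \<in> \<int>"
  by (intro rational_algebraic_int_is_int Tr_Rats) (auto simp: Tr_def intro!: algebraic_int_sum)

lemma Nm_Ints: "algebraic_int x \<Longrightarrow> Nm x \<in> \<int>"
  by (intro rational_algebraic_int_is_int Nm_Rats) (auto simp: Nm_def intro!: algebraic_int_prod)

lemma Nm_mult [simp]: "Nm (x * y) = Nm x * Nm y"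
  by (simp add: Nm_def prod.distrib)

lemma Nm_1 [simp]: "Nm 1 = 1" and Nm_inverse [simp]: "Nm (inverse x) = inverse (Nm x)"
  by (simp_all add: Nm_def prod_inversef[symmetric] o_def)

lemma Nm_divide [simp]: "Nm (x / y) = Nm x / Nm y"
  by (simp add: divide_inverse)

lemma Nm_eq_0_iff [simp]: "Nm x = 0 \<longleftrightarrow> x = 0"
  using p_gt_2 by (auto simp: Nm_def)

lemma Nm_0 [simp]: "Nm 0 = 0"
  by simp

lemma Nm_of_rational: "x \<in> \<rat> \<Longrightarrow> Nm x = x ^ p"
  by (simp add: Nm_def conj_Rats)

lemma Nm_minus [simp]: "Nm (- x) = - Nm x"
  using odd_p by (simp add: Nm_def prod_uminus)

lemma Nm_eq: "Nm x = x * (\<Prod>i\<in>{1..<p}. conj i x)"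
proof -
  have "{..<p} = insert 0 {1..<p}" using p_gt_2 by auto
  then show ?thesis by (simp add: Nm_def)
qed

text \<open>The cofactor is the product of the other conjugates. It turns division by an algebraic
  integer into division by a rational one.\<close>

lemma Nm_cofactor:
  assumes "algebraic_int x"
  obtains y where "algebraic_int y" "Nm x = x * y"
  using assms Nm_eq[of x] by (metis algebraic_int_conj algebraic_int_prod)

lemma multiple_algebraic_int:
  obtains n :: nat where "n > 0" "algebraic_int (of_nat n * (x :: 'L))"
  using algebraic_imp_multiple_algebraic_int[OF algebraic] by blast

subsection \<open>An integral primitive element\<close>

definition \<theta> :: 'L where "\<theta> = (SOME x. algebraic_int x \<and> \<sigma> x \<noteq> x)"

lemma \<theta>: "algebraic_int \<theta>" "\<sigma> \<theta> \<noteq> \<theta>"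
proof -
  obtain x where x: "\<sigma> x \<noteq> x" using \<sigma>_nontrivial by blast
  obtain n :: nat where n: "n > 0" "algebraic_int (of_nat n * x)" by (rule multiple_algebraic_int)
  have "\<sigma> (of_nat n * x) = of_nat n * \<sigma> x" using conj_of_nat[of 1 n] by simp
  then have "\<sigma> (of_nat n * x) \<noteq> of_nat n * x" using x n(1) by auto
  with n(2) have "algebraic_int \<theta> \<and> \<sigma> \<theta> \<noteq> \<theta>" unfolding \<theta>_def by (intro someI) auto
  then show "algebraic_int \<theta>" "\<sigma> \<theta> \<noteq> \<theta>" by auto
qed

lemma conj_\<theta>_inj:
  assumes "i < p" "j < p" "conj i \<theta> = conj j \<theta>"
  shows "i = j"
proof -
  have *: False if "i < j" "j < p" "conj i \<theta> = conj j \<theta>" for i j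
  proof -
    have "conj i \<theta> = conj i (conj (j - i) \<theta>)" using that by (simp add: conj_conj)
    then have "conj (j - i) \<theta> = \<theta>" by simp
    then have "\<theta> \<in> \<rat>" using that by (intro conj_fixed[of "j - i"]) auto
    then show False using \<theta>(2) conj_Rats[of \<theta> 1] by simp
  qed
  from *[of i j] *[of j i] assms show ?thesis by (metis nat_neq_iff)
qed

text \<open>If \<open>f\<close> is the minimal polynomial of \<open>\<theta>\<close>, then
  \<open>\<delta>\<close> is \<open>f'(\<theta>)\<close> and \<open>dual_poly\<close> is
  \<open>f / (X - \<theta>)\<close>. By Euler, the elements \<open>dual k / \<delta>\<close> form
  the basis dual to the powers of \<open>\<theta>\<close> under the trace.\<close>

definition \<delta> :: 'L where "\<delta> = (\<Prod>j\<in>{1..<p}. \<theta> - conj j \<theta>)"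
definition dual_poly :: "'L poly" where "dual_poly = (\<Prod>j\<in>{1..<p}. [:- conj j \<theta>, 1:])"
definition dual :: "nat \<Rightarrow> 'L" where "dual k = coeff dual_poly k"

lemma \<delta>_nonzero: "\<delta> \<noteq> 0"
  using conj_\<theta>_inj[of 0] p_gt_2 by (fastforce simp: \<delta>_def)

lemma algebraic_int_\<delta>: "algebraic_int \<delta>"
  unfolding \<delta>_def by (intro algebraic_int_prod algebraic_int_diff) (simp_all add: \<theta>)

lemma algebraic_int_dual: "algebraic_int (dual k)"
proof -
  have "integral_poly dual_poly"
    unfolding dual_poly_def
    by (intro integral_poly_prod) (simp add: integral_poly_pCons \<theta>, simp add: integral_poly_def)
  then show ?thesis by (simp add: dual_def integral_poly_def)
qed

lemma poly_dual_poly: "(\<Sum>k<p. dual k * z ^ k) = (\<Prod>j\<in>{1..<p}. z - conj j \<theta>)"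
proof -
  have "degree dual_poly = (\<Sum>j\<in>{1..<p}. degree [:- conj j \<theta>, 1:])"
    unfolding dual_poly_def by (rule degree_prod_eq_sum_degree) auto
  then have deg: "degree dual_poly = p - 1" by simp
  have "{..<p} = {..p - 1}" using p_gt_2 by auto
  then have "(\<Sum>k<p. dual k * z ^ k) = poly dual_poly z"
    by (simp add: poly_altdef deg dual_def)
  also have "\<dots> = (\<Prod>j\<in>{1..<p}. z - conj j \<theta>)"
    by (simp add: dual_poly_def poly_prod)
  finally show ?thesis .
qed

text \<open>Lagrange interpolation at the conjugates of \<open>\<theta>\<close>: the polynomial
  \<open>\<Prod>\<^sub>j (X - \<sigma>\<^sup>j \<theta>)\<close> over \<open>j \<noteq> i\<close>, evaluated at \<open>\<theta>\<close>, is \<open>\<delta>\<close> for \<open>i = 0\<close> and 0 otherwise.\<close>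

lemma dual_orthogonal:
  assumes i: "i < p"
  shows "(\<Sum>k<p. conj i (dual k) * \<theta> ^ k) = (if i = 0 then \<delta> else 0)"
proof -
  define z where "z = conj (p - i) \<theta>"
  have "conj i z = \<theta>" using i by (simp add: z_def conj_inverse_right)
  then have "(\<Sum>k<p. conj i (dual k) * \<theta> ^ k) = conj i (\<Sum>k<p. dual k * z ^ k)"
    by (simp add: conj_sum)
  also have "\<dots> = conj i (\<Prod>j\<in>{1..<p}. z - conj j \<theta>)" by (simp add: poly_dual_poly)
  also have "\<dots> = (if i = 0 then \<delta> else 0)"
  proof (cases "i = 0")
    case True
    then show ?thesis by (simp add: z_def \<sigma>_period \<delta>_def)
  next
    case False
    then have "p - i \<in> {1..<p}" using i by auto
    then have "(\<Prod>j\<in>{1..<p}. z - conj j \<theta>) = 0" by (intro prod_zero) (auto simp: z_def)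
    then show ?thesis using False by simp
  qed
  finally show ?thesis .
qed

text \<open>Exchanging the sums leaves only the identity automorphism, by
  \<open>dual_orthogonal\<close>. For integral \<open>y\<close> the traces are rational integers, so
  \<open>\<delta>\<close> is a common denominator for the coordinates in the powers of
  \<open>\<theta>\<close>; this does the work of an integral basis.\<close>

lemma trace_expansion: "y * \<delta> = (\<Sum>k<p. Tr (y * dual k) * \<theta> ^ k)"
proof -
  have "(\<Sum>k<p. Tr (y * dual k) * \<theta> ^ k) = (\<Sum>k<p. \<Sum>i<p. conj i y * (conj i (dual k) * \<theta> ^ k))"
    by (simp add: Tr_def sum_distrib_right mult.assoc)
  also have "\<dots> = (\<Sum>i<p. conj i y * (\<Sum>k<p. conj i (dual k) * \<theta> ^ k))"
    by (subst sum.swap) (simp add: sum_distrib_left)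
  also have "\<dots> = (\<Sum>i<p. if i = 0 then y * \<delta> else 0)"
    by (rule sum.cong) (simp_all add: dual_orthogonal del: funpow.simps)
  also have "\<dots> = y * \<delta>" using p_gt_2 by (simp add: sum.delta)
  finally show ?thesis by simp
qed

section \<open>Integer coordinates and finite residue systems\<close>

definition int_of :: "'L \<Rightarrow> int" where "int_of x = \<lfloor>THE q. of_rat q = x\<rfloor>"

lemma int_of_of_int [simp]: "int_of (of_int k) = k"
proof -
  have "(THE q. of_rat q = (of_int k :: 'L)) = of_int k"
    by (rule the_equality) (simp_all, metis of_rat_eq_iff of_rat_of_int_eq)
  then show ?thesis by (simp add: int_of_def)
qed

lemma of_int_int_of: "x \<in> \<int> \<Longrightarrow> of_int (int_of x) = x"
  by (auto elim!: Ints_cases)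

text \<open>Coordinates of \<open>y * \<delta>\<close>, not of \<open>y\<close>: the factor
  \<open>\<delta>\<close> is what makes them integers.\<close>

definition crd :: "'L \<Rightarrow> nat \<Rightarrow> int" where "crd y k = int_of (Tr (y * dual k))"

lemma of_int_crd: "algebraic_int y \<Longrightarrow> of_int (crd y k) = Tr (y * dual k)"
  unfolding crd_def by (intro of_int_int_of Tr_Ints algebraic_int_mult algebraic_int_dual)

lemma crd_expansion: "algebraic_int y \<Longrightarrow> y * \<delta> = (\<Sum>k<p. of_int (crd y k) * \<theta> ^ k)"
  by (simp add: of_int_crd trace_expansion)

lemma algebraic_int_combination: "algebraic_int (\<Sum>k<p. of_int (z k) * \<theta> ^ k)"
  by (intro algebraic_int_sum algebraic_int_mult algebraic_int_power) (simp_all add: \<theta>)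

text \<open>The function \<open>f\<close> refines reduction modulo \<open>m\<close>. It takes
  coordinates modulo \<open>m\<close> times the absolute value of \<open>Nm \<delta>\<close>, since
  the coordinates belong to \<open>x * \<delta>\<close>: if they agree,
  \<open>(x - y) * \<delta>\<close> is divisible by \<open>m * Nm \<delta>\<close>, and cancelling
  \<open>\<delta>\<close> leaves a factor \<open>m\<close>.\<close>

lemma finite_residues:
  assumes "m > 0"
  obtains f :: "'L \<Rightarrow> nat \<Rightarrow> int"
  where "finite (f ` {x. algebraic_int x})"
    and "\<And>x y. algebraic_int x \<Longrightarrow> algebraic_int y \<Longrightarrow> f x = f y
      \<Longrightarrow> \<exists>w. algebraic_int w \<and> x - y = of_int m * w"
proof -
  obtain \<delta>' where \<delta>': "algebraic_int \<delta>'" "Nm \<delta> = \<delta> * \<delta>'"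
    using Nm_cofactor[OF algebraic_int_\<delta>] by blast
  obtain d where d: "Nm \<delta> = of_int d"
    using Nm_Ints[OF algebraic_int_\<delta>] by (auto elim!: Ints_cases)
  then have d0: "d \<noteq> 0" using \<delta>_nonzero Nm_eq_0_iff[of \<delta>] by auto
  define e where "e = m * \<bar>d\<bar>"
  have e: "e > 0" using assms d0 by (simp add: e_def)
  define f where "f x = (\<lambda>k\<in>{..<p}. crd x k mod e)" for x
  have "f ` {x. algebraic_int x} \<subseteq> {..<p} \<rightarrow>\<^sub>E {0..<e}"
    using e by (auto simp: f_def)
  then have fin: "finite (f ` {x. algebraic_int x})"
    by (rule finite_subset) (auto intro!: finite_PiE)
  show thesis
  proof (rule that[OF fin])
    fix x y assume x: "algebraic_int x" and y: "algebraic_int y" and f: "f x = f y"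
    have "crd x k mod e = crd y k mod e" if "k < p" for k
      using fun_cong[OF f, of k] that by (simp add: f_def)
    then have "e dvd crd x k - crd y k" if "k < p" for k
      using that by (simp add: mod_eq_dvd_iff)
    then obtain z where z: "\<And>k. k < p \<Longrightarrow> crd x k - crd y k = e * z k"
      unfolding dvd_def by metis
    let ?w = "\<Sum>k<p. of_int (z k) * \<theta> ^ k"
    have "(x - y) * \<delta> = (\<Sum>k<p. of_int (crd x k - crd y k) * \<theta> ^ k)"
      by (simp add: left_diff_distrib crd_expansion x y sum_subtractf)
    also have "\<dots> = (\<Sum>k<p. of_int (e * z k) * \<theta> ^ k)"
      by (rule sum.cong) (simp_all only: z lessThan_iff)
    also have "\<dots> = of_int e * ?w"
      by (simp only: of_int_mult sum_distrib_left mult.assoc)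
    also have "(of_int e :: 'L) = of_int m * (of_int (sgn d) * (\<delta> * \<delta>'))"
      unfolding e_def \<delta>'(2)[symmetric] d by (metis abs_sgn mult.commute of_int_mult)
    finally have "(x - y) * \<delta> = of_int m * (of_int (sgn d) * \<delta>' * ?w) * \<delta>"
      by (simp only: mult_ac)
    then have "x - y = of_int m * (of_int (sgn d) * \<delta>' * ?w)"
      using \<delta>_nonzero by (metis mult_cancel_right)
    moreover have "algebraic_int (of_int (sgn d) * \<delta>' * ?w)"
      by (intro algebraic_int_mult algebraic_int_combination \<delta>') simp
    ultimately show "\<exists>w. algebraic_int w \<and> x - y = of_int m * w" by blast
  qed
qed

subsection \<open>A real embedding\<close>

lemma odd_degree_real_root:
  fixes f :: "real poly"
  assumes "odd (degree f)" "lead_coeff f = 1"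
  shows "\<exists>r. poly f r = 0"
proof -
  have pos: "\<exists>b. poly g b > 0" if "lead_coeff g = 1" for g :: "real poly"
  proof -
    from that obtain n where "\<forall>x\<ge>n. lead_coeff g \<le> poly g x"
      using poly_pinfty_gt_lc[of g] by auto
    then have "1 \<le> poly g n" using that by simp
    then show ?thesis by (intro exI[of _ n]) simp
  qed
  obtain b where b: "poly f b > 0" using pos assms(2) by blast
  \<comment> \<open>As the degree is odd, \<open>- f(-X)\<close> is monic too; a positive value of
    it is a negative value of \<open>f\<close>.\<close>
  have "lead_coeff (- pcompose f [:0, -1:]) = - lead_coeff (pcompose f [:0, -1:])"
    by (rule lead_coeff_minus)
  also have "\<dots> = 1" using assms by (subst lead_coeff_comp) simp_all
  finally obtain a where "poly (- pcompose f [:0, -1:]) a > 0" using pos by blast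
  then have a: "poly f (- a) < 0" by (simp add: poly_pcompose)
  show ?thesis
  proof (cases "- a" b rule: linorder_cases)
    case less
    with poly_IVT_pos[OF less a b] show ?thesis by blast
  next
    case equal
    with a b show ?thesis by simp
  next
    case greater
    with poly_IVT_neg[OF greater b a] show ?thesis by blast
  qed
qed

lemma map_poly_\<sigma>_mult: "map_poly \<sigma> (f * g) = map_poly \<sigma> f * map_poly \<sigma> g"
  by (intro poly_eqI) (simp add: coeff_map_poly coeff_mult \<sigma>_sum)

definition min_poly :: "'L poly" where "min_poly = (\<Prod>j<p. [:- conj j \<theta>, 1:])"

lemma min_poly_rational:
  obtains f :: "rat poly"
  where "map_poly of_rat f = min_poly" "degree f = p" "lead_coeff f = 1"
proof -
  have "coeff min_poly k \<in> \<rat>" for k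
  proof (rule \<sigma>_fixed)
    have "map_poly \<sigma> (\<Prod>j\<in>A. [:- conj j \<theta>, 1:]) = (\<Prod>j\<in>A. [:- conj (j + 1) \<theta>, 1:])" for A
      by (induction A rule: infinite_finite_induct)
         (simp_all add: map_poly_\<sigma>_mult map_poly_pCons map_poly_1' del: mult_pCons_left)
    then have "map_poly \<sigma> min_poly = min_poly"
      unfolding min_poly_def using rotate_prod[of "\<lambda>y. [:- y, 1:]" 1 \<theta>] by simp
    then show "\<sigma> (coeff min_poly k) = coeff min_poly k"
      by (metis coeff_map_poly \<sigma>_simps(1))
  qed
  then have "\<forall>k. \<exists>q. coeff min_poly k = of_rat q" by (auto elim!: Rats_cases)
  then obtain c where c: "\<And>k. coeff min_poly k = of_rat (c k)" by metis
  have deg: "degree min_poly = p"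
    unfolding min_poly_def by (subst degree_prod_eq_sum_degree) auto
  define f where "f = (\<Sum>k\<le>p. monom (c k) k)"
  have "coeff f k = c k" for k
  proof (cases "k \<le> p")
    case False
    then have "coeff min_poly k = 0" by (intro coeff_eq_0) (simp add: deg)
    then show ?thesis using False c[of k] by (simp add: f_def coeff_sum sum.delta)
  qed (simp add: f_def coeff_sum)
  then have f: "map_poly of_rat f = min_poly"
    by (intro poly_eqI) (simp add: coeff_map_poly c)
  then have degf: "degree f = p" using deg by (metis of_rat_hom.degree_map_poly_hom)
  have "lead_coeff min_poly = 1"
    by (simp add: min_poly_def lead_coeff_prod)
  then have "of_rat (lead_coeff f) = (1 :: 'L)" by (simp add: degf deg f[symmetric] coeff_map_poly)
  then have "lead_coeff f = 1" by simp
  with f degf show thesis by (rule that)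
qed

text \<open>The element \<open>\<theta>\<close> may be sent to a real root of its minimal polynomial
  \<open>f\<close>, which exists in odd degree. The map is defined through chosen polynomial
  representatives; it is well defined because a nonzero remainder modulo \<open>f\<close> that
  vanishes at \<open>\<theta>\<close> would vanish at all \<open>p\<close> conjugates, more than its
  degree allows.\<close>

lemma exists_real_embedding:
  "\<exists>h :: 'L \<Rightarrow> real. h 1 = 1 \<and> (\<forall>x y. h (x + y) = h x + h y) \<and> (\<forall>x y. h (x * y) = h x * h y)"
proof -
  obtain f where f: "map_poly of_rat f = min_poly" "degree f = p" "lead_coeff f = 1"
    by (rule min_poly_rational)
  have "degree (map_poly of_rat f :: real poly) = p" using f by simp
  moreover have "lead_coeff (map_poly of_rat f :: real poly) = 1" using f by simp
  ultimately obtain r :: real where r: "poly (map_poly of_rat f) r = 0"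
    using odd_degree_real_root odd_p by metis
  define L where "L g = poly (map_poly of_rat g) \<theta>" for g
  define R where "R g = poly (map_poly of_rat g) r" for g
  have L: "L (g + h) = L g + L h" "L (g * h) = L g * L h" "L (g - h) = L g - L h" for g h
    by (simp_all add: L_def map_poly_of_rat)
  have R: "R (g + h) = R g + R h" "R (g * h) = R g * R h" "R (g - h) = R g - R h" for g h
    by (simp_all add: R_def map_poly_of_rat)
  have zero: "R g = 0" if "L g = 0" for g
  proof -
    have "f \<noteq> 0" using f(3) by auto
    define m where "m = g mod f"
    have "g = g div f * f + m" by (simp add: m_def)
    then have g: "L g = L (g div f) * L f + L m" "R g = R (g div f) * R f + R m"
      by (metis L, metis R)
    have "L f = 0"
      using p_gt_2 by (auto simp: L_def f min_poly_def poly_prod intro!: bexI[of _ 0])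
    then have "L m = 0" using g(1) that by simp
    have "m = 0"
    proof (rule ccontr)
      assume "m \<noteq> 0"
      let ?m = "map_poly of_rat m :: 'L poly"
      have "poly ?m (conj i \<theta>) = conj i (poly ?m \<theta>)" for i
        by (simp add: poly_altdef conj_sum)
      then have "conj i \<theta> \<in> {x. poly ?m x = 0}" for i
        using \<open>L m = 0\<close> by (simp add: L_def)
      then have "(\<lambda>i. conj i \<theta>) ` {..<p} \<subseteq> {x. poly ?m x = 0}" by auto
      moreover have "?m \<noteq> 0" using \<open>m \<noteq> 0\<close> by simp
      moreover have "card ((\<lambda>i. conj i \<theta>) ` {..<p}) = p"
        by (subst card_image) (auto intro!: inj_onI conj_\<theta>_inj)
      ultimately have "p \<le> degree ?m"
        by (metis card_mono card_poly_roots_bound le_trans poly_roots_finite)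
      moreover have "degree m < degree f"
        using \<open>m \<noteq> 0\<close> \<open>f \<noteq> 0\<close> by (simp add: m_def degree_mod_less')
      ultimately show False by (simp add: f)
    qed
    then show ?thesis using g(2) r by (simp add: R_def)
  qed
  have "\<exists>g. L g = y" for y
  proof -
    have "\<forall>k. \<exists>q. Tr (y / \<delta> * dual k) = of_rat q"
      using Tr_Rats by (auto elim!: Rats_cases)
    then obtain q where q: "\<And>k. Tr (y / \<delta> * dual k) = of_rat (q k)" by metis
    have monom: "L (monom c k) = of_rat c * \<theta> ^ k" for c k
      by (simp add: L_def map_poly_monom poly_monom)
    have "L (\<Sum>k<n. monom (q k) k) = (\<Sum>k<n. of_rat (q k) * \<theta> ^ k)" for n
    proof (induction n)
      case 0
      show ?case by (simp add: L_def)
    next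
      case (Suc n)
      then show ?case by (simp only: sum.lessThan_Suc L(1) monom)
    qed
    moreover have "y = (\<Sum>k<p. of_rat (q k) * \<theta> ^ k)"
      using trace_expansion[of "y / \<delta>"] \<delta>_nonzero unfolding q by simp
    ultimately show ?thesis by metis
  qed
  then obtain G where G: "\<And>y. L (G y) = y" by metis
  have RG: "R (G y) = R g" if "L g = y" for y g
    using zero[of "G y - g"] G[of y] that by (simp add: L R)
  show ?thesis
  proof (intro exI[of _ "R \<circ> G"] conjI allI)
    have "L 1 = 1" "R 1 = 1" by (simp_all add: L_def R_def)
    then show "(R \<circ> G) 1 = 1" using RG[of 1 1] by simp
    show "(R \<circ> G) (x + y) = (R \<circ> G) x + (R \<circ> G) y" for x y
      using RG[of "G x + G y" "x + y"] by (simp add: L R G)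
    show "(R \<circ> G) (x * y) = (R \<circ> G) x * (R \<circ> G) y" for x y
      using RG[of "G x * G y" "x * y"] by (simp add: L R G)
  qed
qed

text \<open>One real embedding is enough: the others are \<open>emb \<circ> conj i\<close>, so all
  conjugate absolute values are read off from \<open>emb\<close>.\<close>

definition emb :: "'L \<Rightarrow> real" where
  "emb = (SOME h. h 1 = 1 \<and> (\<forall>x y. h (x + y) = h x + h y) \<and> (\<forall>x y. h (x * y) = h x * h y))"

lemma emb_1 [simp]: "emb 1 = 1"
  and emb_add [simp]: "emb (x + y) = emb x + emb y"
  and emb_mult [simp]: "emb (x * y) = emb x * emb y"
  using someI_ex[OF exists_real_embedding] unfolding emb_def[symmetric] by blast+

lemma emb_0 [simp]: "emb 0 = 0"
  using emb_add[of 0 0] by simp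

lemma emb_minus [simp]: "emb (- x) = - emb x"
  using emb_add[of x "- x"] by simp

lemma emb_diff [simp]: "emb (x - y) = emb x - emb y"
  using emb_add[of x "- y"] by simp

lemma emb_eq_0_iff [simp]: "emb x = 0 \<longleftrightarrow> x = 0"
proof
  assume "emb x = 0"
  show "x = 0"
  proof (rule ccontr)
    assume "x \<noteq> 0"
    then have "emb (x * inverse x) = 1" by simp
    then show False using \<open>emb x = 0\<close> by simp
  qed
qed simp

lemma emb_eq_iff [simp]: "emb x = emb y \<longleftrightarrow> x = y"
  using emb_eq_0_iff[of "x - y"] by (simp del: emb_eq_0_iff)

lemma emb_sum: "emb (sum f A) = (\<Sum>a\<in>A. emb (f a))"
  by (induction A rule: infinite_finite_induct) simp_all

lemma emb_prod: "emb (prod f A) = (\<Prod>a\<in>A. emb (f a))"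
  by (induction A rule: infinite_finite_induct) simp_all

lemma emb_power [simp]: "emb (x ^ n) = emb x ^ n"
  by (induction n) simp_all

lemma emb_inverse [simp]: "emb (inverse x) = inverse (emb x)"
proof (cases "x = 0")
  case False
  then have "emb x * emb (inverse x) = 1" by (simp flip: emb_mult)
  then show ?thesis by (metis inverse_unique)
qed simp

lemma emb_divide [simp]: "emb (x / y) = emb x / emb y"
  by (simp add: divide_inverse)

lemma emb_of_nat [simp]: "emb (of_nat n) = of_nat n"
  by (induction n) simp_all

lemma emb_of_int [simp]: "emb (of_int n) = of_int n"
  by (cases n rule: int_cases2) simp_all

text \<open>The coordinates \<open>crd x k\<close> are traces, hence bounded in terms of the
  conjugates of \<open>x\<close>; only finitely many integer vectors remain, and they determine
  \<open>x\<close>.\<close>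

lemma finite_bounded_conjugates:
  "finite {x. algebraic_int x \<and> (\<forall>i<p. \<bar>emb (conj i x)\<bar> \<le> B)}" (is "finite ?S")
proof -
  define C where "C = (\<Sum>k<p. \<Sum>i<p. \<bar>B\<bar> * \<bar>emb (conj i (dual k))\<bar>)"
  define N where "N = \<lceil>C\<rceil>"
  have bound: "crd x k \<in> {-N..N}" if x: "x \<in> ?S" and k: "k < p" for x k
  proof -
    have ai: "algebraic_int x" and B: "\<And>i. i < p \<Longrightarrow> \<bar>emb (conj i x)\<bar> \<le> \<bar>B\<bar>"
      using x by fastforce+
    have "real_of_int (crd x k) = emb (Tr (x * dual k))"
      unfolding of_int_crd[OF ai, symmetric] by simp
    then have "\<bar>real_of_int (crd x k)\<bar> \<le> (\<Sum>i<p. \<bar>emb (conj i x) * emb (conj i (dual k))\<bar>)"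
      by (simp add: Tr_def emb_sum sum_abs)
    also have "\<dots> \<le> (\<Sum>i<p. \<bar>B\<bar> * \<bar>emb (conj i (dual k))\<bar>)"
      unfolding abs_mult using B by (intro sum_mono mult_right_mono) simp_all
    also have "\<dots> \<le> C"
      unfolding C_def using k by (intro member_le_sum[of k]) (auto intro!: sum_nonneg)
    also have "C \<le> of_int N" by (simp add: N_def)
    finally show ?thesis by (simp add: abs_le_iff)
  qed
  let ?F = "\<lambda>x. \<lambda>k\<in>{..<p}. crd x k"
  have "?F ` ?S \<subseteq> {..<p} \<rightarrow>\<^sub>E {-N..N}"
    using bound by (auto simp: image_subset_iff PiE_iff simp del: atLeastAtMost_iff)
  then have "finite (?F ` ?S)" by (rule finite_subset) (auto intro!: finite_PiE)
  moreover have "inj_on ?F ?S"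
  proof (rule inj_onI)
    fix x y assume xy: "x \<in> ?S" "y \<in> ?S" "?F x = ?F y"
    have "crd x k = crd y k" if "k < p" for k
      using fun_cong[OF xy(3), of k] that by simp
    then have "x * \<delta> = y * \<delta>" using xy by (simp add: crd_expansion)
    then show "x = y" using \<delta>_nonzero by simp
  qed
  ultimately show ?thesis by (rule finite_imageD)
qed


section \<open>Units of norm one\<close>

text \<open>Since \<open>p\<close> is odd, -1 has norm -1, so exactly one of \<open>u\<close> and
  \<open>-u\<close> has norm 1 for every unit \<open>u\<close>. Working with norm one removes the
  torsion and loses no unit up to sign.\<close>

definition U1 :: "'L set" where "U1 = {u. algebraic_int u \<and> Nm u = 1}"

lemma U1_nonzero: "u \<in> U1 \<Longrightarrow> u \<noteq> 0"
  using Nm_eq_0_iff[of u] by (auto simp: U1_def simp del: Nm_eq_0_iff)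

lemma U1_1 [simp]: "1 \<in> U1"
  and U1_mult: "u \<in> U1 \<Longrightarrow> v \<in> U1 \<Longrightarrow> u * v \<in> U1"
  by (auto simp: U1_def intro: algebraic_int_mult)

lemma U1_inverse: "u \<in> U1 \<Longrightarrow> inverse u \<in> U1"
proof -
  assume u: "u \<in> U1"
  then obtain y where "algebraic_int y" "Nm u = u * y"
    using Nm_cofactor[of u] by (auto simp: U1_def)
  then have "algebraic_int (inverse u)" using u by (metis (mono_tags) U1_def inverse_unique mem_Collect_eq)
  then show ?thesis using u by (simp add: U1_def)
qed

lemma U1_divide: "u \<in> U1 \<Longrightarrow> v \<in> U1 \<Longrightarrow> u / v \<in> U1"
  unfolding divide_inverse by (intro U1_mult U1_inverse)

lemma U1_power: "u \<in> U1 \<Longrightarrow> u ^ n \<in> U1"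
  by (induction n) (auto intro: U1_mult)

lemma U1_powi: "u \<in> U1 \<Longrightarrow> u powi n \<in> U1"
  by (auto simp: power_int_def intro: U1_power U1_inverse)

lemma U1_\<sigma>: "u \<in> U1 \<Longrightarrow> \<sigma> u \<in> U1"
  by (simp add: U1_def)

lemma U1_unit:
  assumes "algebraic_int u" "algebraic_int (inverse u)" "u \<noteq> 0"
  shows "u \<in> U1 \<or> - u \<in> U1"
proof -
  obtain a b where ab: "Nm u = of_int a" "Nm (inverse u) = of_int b"
    using Nm_Ints[OF assms(1)] Nm_Ints[OF assms(2)] by (auto elim!: Ints_cases)
  have "Nm u * Nm (inverse u) = 1" using assms(3) by (simp flip: Nm_mult del: Nm_inverse)
  then have "(of_int (a * b) :: 'L) = of_int 1" using ab by simp
  then have "a * b = 1" by (simp only: of_int_eq_iff)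
  then have "a = 1 \<or> a = -1" by (metis zmult_eq_1_iff)
  then show ?thesis using ab(1) assms(1) by (auto simp: U1_def)
qed

lemma U1_rational: "u \<in> U1 \<Longrightarrow> u \<in> \<rat> \<Longrightarrow> u = 1"
proof -
  assume u: "u \<in> U1" "u \<in> \<rat>"
  then have "emb u ^ p = 1" using Nm_of_rational[of u] by (simp add: U1_def flip: emb_power)
  then have "root p (emb u ^ p) = root p 1" by simp
  then have "emb u = emb 1" using odd_p p_gt_2 by (simp add: odd_real_root_power_cancel)
  then show "u = 1" by (simp only: emb_eq_iff)
qed

subsection \<open>The logarithmic size\<close>

definition lg :: "nat \<Rightarrow> 'L \<Rightarrow> real" where "lg i u = ln \<bar>emb (conj i u)\<bar>"
definition size1 :: "'L \<Rightarrow> real" where "size1 u = (\<Sum>i<p. \<bar>lg i u\<bar>)"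

lemma lg_mult: "u \<noteq> 0 \<Longrightarrow> v \<noteq> 0 \<Longrightarrow> lg i (u * v) = lg i u + lg i v"
  and lg_inverse: "u \<noteq> 0 \<Longrightarrow> lg i (inverse u) = - lg i u"
  and lg_power: "u \<noteq> 0 \<Longrightarrow> lg i (u ^ n) = real n * lg i u"
  by (simp_all add: lg_def abs_mult ln_mult ln_inverse power_abs ln_realpow)

lemma lg_divide: "u \<noteq> 0 \<Longrightarrow> v \<noteq> 0 \<Longrightarrow> lg i (u / v) = lg i u - lg i v"
  by (simp add: divide_inverse lg_mult lg_inverse)

lemma size1_nonneg: "size1 u \<ge> 0"
  by (simp add: size1_def sum_nonneg)

lemma size1_mult: "u \<noteq> 0 \<Longrightarrow> v \<noteq> 0 \<Longrightarrow> size1 (u * v) \<le> size1 u + size1 v"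
  unfolding size1_def sum.distrib[symmetric] by (intro sum_mono) (simp add: lg_mult abs_triangle_ineq)

lemma size1_power: "u \<noteq> 0 \<Longrightarrow> size1 (u ^ n) = real n * size1 u"
  by (simp add: size1_def lg_power abs_mult sum_distrib_left)

lemma size1_1 [simp]: "size1 1 = 0"
  by (simp add: size1_def lg_def)

lemma lg_le_size1: "i < p \<Longrightarrow> \<bar>lg i u\<bar> \<le> size1 u"
  unfolding size1_def by (intro member_le_sum) auto

text \<open>For a real embedding, absolute value one leaves only 1 and -1, which takes the place of
  an argument on roots of unity.\<close>

lemma U1_size1_eq_0:
  assumes "u \<in> U1" "size1 u = 0"
  shows "u = 1"
proof -
  have "lg 0 u = 0" using lg_le_size1[of 0 u] assms(2) p_gt_2 by simp
  then have "\<bar>emb u\<bar> = 1" using U1_nonzero[OF assms(1)] by (simp add: lg_def)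
  then have "emb u = emb 1 \<or> emb u = emb (- 1)" by (auto simp: abs_if split: if_splits)
  then have "u = 1 \<or> u = - 1" by (simp only: emb_eq_iff)
  then show ?thesis using assms(1) by (auto intro: U1_rational)
qed

lemma U1_sum_lg:
  assumes "u \<in> U1"
  shows "(\<Sum>i<p. lg i u) = 0"
proof -
  have "(\<Prod>i<p. \<bar>emb (conj i u)\<bar>) = \<bar>emb (Nm u)\<bar>"
    by (simp add: Nm_def emb_prod abs_prod)
  also have "\<dots> = 1" using assms by (simp add: U1_def)
  finally have "ln (\<Prod>i<p. \<bar>emb (conj i u)\<bar>) = 0" by simp
  then show ?thesis
    using U1_nonzero[OF assms] by (simp add: lg_def ln_prod)
qed

lemma finite_U1_size1: "finite {u \<in> U1. size1 u \<le> B}"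
proof (rule finite_subset[OF _ finite_bounded_conjugates])
  show "{u \<in> U1. size1 u \<le> B} \<subseteq> {x. algebraic_int x \<and> (\<forall>i<p. \<bar>emb (conj i x)\<bar> \<le> exp B)}"
  proof (intro subsetI CollectI conjI allI impI)
    fix u i assume u: "u \<in> {u \<in> U1. size1 u \<le> B}"
    then show "algebraic_int u" by (simp add: U1_def)
    assume "i < p"
    have "\<bar>emb (conj i u)\<bar> > 0" using u U1_nonzero by simp
    moreover have "lg i u \<le> B" using lg_le_size1[OF \<open>i < p\<close>, of u] u by auto
    ultimately show "\<bar>emb (conj i u)\<bar> \<le> exp B"
      unfolding lg_def by (metis exp_ln exp_le_cancel_iff)
  qed
qed

lemma U1_gap:
  obtains e :: real where "e > 0" "\<And>u. u \<in> U1 \<Longrightarrow> size1 u < e \<Longrightarrow> u = 1"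
proof -
  define S where "S = {u \<in> U1. size1 u \<le> 1} - {1}"
  have fin: "finite S" unfolding S_def using finite_U1_size1[of 1] by simp
  define e where "e = Min (insert 1 (size1 ` S))"
  have "size1 u > 0" if "u \<in> S" for u
    using that U1_size1_eq_0[of u] size1_nonneg[of u] by (force simp: S_def)
  then have "e > 0" using fin by (simp add: e_def)
  moreover have "u = 1" if "u \<in> U1" "size1 u < e" for u
  proof (rule ccontr)
    assume "u \<noteq> 1"
    have "e \<le> 1" using fin by (simp add: e_def)
    then have "u \<in> S" using that \<open>u \<noteq> 1\<close> by (simp add: S_def)
    then have "e \<le> size1 u" using fin by (simp add: e_def)
    then show False using that(2) by simp
  qed
  ultimately show thesis by (rule that)
qed

text \<open>The logarithms of a unit of norm one add up to zero, so \<open>p - 1\<close> of them determine it: cells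
  in dimension \<open>p - 1\<close> suffice.\<close>

lemma U1_count:
  obtains K :: real where "K > 0"
    and "\<And>W R. W \<subseteq> U1 \<Longrightarrow> R \<ge> 1 \<Longrightarrow> (\<And>w. w \<in> W \<Longrightarrow> size1 w \<le> R) \<Longrightarrow> real (card W) \<le> (K * R) ^ (p - 1)"
proof -
  obtain e where e: "e > 0" "\<And>u. u \<in> U1 \<Longrightarrow> size1 u < e \<Longrightarrow> u = 1" by (rule U1_gap) blast
  \<comment> \<open>With the first \<open>p - 1\<close> logarithms below \<open>h\<close>, the last
    is below \<open>(p - 1) * h\<close>, so the total size stays below
    \<open>2 * (p - 1) * h < e\<close>.\<close>
  define h where "h = e / (2 * real p)"
  have h: "h > 0" using e(1) p_gt_2 by (simp add: h_def)
  \<comment> \<open>Each coordinate has \<open>2 * N + 1\<close> cells with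
    \<open>N \<le> R / h + 1\<close>; the assumption \<open>R \<ge> 1\<close> absorbs the resulting
    constant 3 into \<open>K * R\<close>.\<close>
  define K where "K = 2 / h + 3"
  have "K > 0" using h by (simp add: K_def add_pos_pos)
  moreover have "real (card W) \<le> (K * R) ^ (p - 1)"
    if W: "W \<subseteq> U1" and R: "R \<ge> 1" "\<And>w. w \<in> W \<Longrightarrow> size1 w \<le> R" for W R
  proof -
    define N where "N = \<lceil>R / h\<rceil>"
    define cell where "cell u = (\<lambda>i\<in>{..<p - 1}. \<lfloor>lg i u / h\<rfloor>)" for u
    have "0 \<le> R / h" using R(1) h by simp
    then have N0: "N \<ge> 0" unfolding N_def by linarith
    have "inj_on cell W"
    proof (rule inj_onI)
      fix u v assume uv: "u \<in> W" "v \<in> W" "cell u = cell v"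
      then have U: "u \<in> U1" "v \<in> U1" "u \<noteq> 0" "v \<noteq> 0" using W U1_nonzero by auto
      define w where "w = u / v"
      have w: "w \<in> U1" unfolding w_def by (intro U1_divide U)
      have small: "\<bar>lg i w\<bar> < h" if "i < p - 1" for i
      proof -
        have "\<lfloor>lg i u / h\<rfloor> = \<lfloor>lg i v / h\<rfloor>"
          using fun_cong[OF uv(3), of i] that by (simp add: cell_def)
        then have "\<bar>lg i u / h - lg i v / h\<bar> < 1" by linarith
        then have "\<bar>lg i w / h\<bar> < 1" by (simp add: w_def lg_divide U diff_divide_distrib)
        then show ?thesis using h by (simp add: abs_divide)
      qed
      have split: "{..<p} = insert (p - 1) {..<p - 1}" using p_gt_2 by auto
      have "lg (p - 1) w = - (\<Sum>i<p - 1. lg i w)"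
        using U1_sum_lg[OF w] by (simp add: split)
      then have "\<bar>lg (p - 1) w\<bar> \<le> (\<Sum>i<p - 1. \<bar>lg i w\<bar>)" by simp
      then have "size1 w \<le> 2 * (\<Sum>i<p - 1. \<bar>lg i w\<bar>)" by (simp add: size1_def split)
      also have "(\<Sum>i<p - 1. \<bar>lg i w\<bar>) < (\<Sum>i<p - 1. h)"
      proof (rule sum_strict_mono)
        show "{..<p - 1} \<noteq> {}" using p_gt_2 by (metis lessThan_iff empty_iff zero_less_diff less_trans one_less_numeral_iff semiring_norm(76))
      qed (use small in auto)
      also have "2 * (\<Sum>i<p - 1. h) \<le> e"
        using h p_gt_2 e(1) by (simp add: h_def field_simps)
      finally have "w = 1" using e(2)[OF w] by simp
      then show "u = v" using U by (simp add: w_def)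
    qed
    moreover have "cell ` W \<subseteq> {..<p - 1} \<rightarrow>\<^sub>E {-N..N}"
    proof -
      have "\<lfloor>lg i u / h\<rfloor> \<in> {-N..N}" if "u \<in> W" "i < p - 1" for u i
      proof -
        have "\<bar>lg i u\<bar> \<le> R" using order_trans[OF lg_le_size1 R(2)[OF that(1)], of i] that(2) by simp
        then have "\<bar>lg i u / h\<bar> \<le> R / h" using h by (simp add: abs_divide divide_right_mono)
        moreover have "R / h \<le> of_int N" by (simp add: N_def)
        ultimately have "- of_int N \<le> lg i u / h" "lg i u / h \<le> of_int N" by linarith+
        then show ?thesis by (simp add: le_floor_iff floor_le_iff)
      qed
      then show ?thesis by (auto simp: cell_def image_subset_iff PiE_iff simp del: atLeastAtMost_iff)
    qed
    ultimately have "card W \<le> card ({..<p - 1} \<rightarrow>\<^sub>E {-N..N})"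
      by (intro card_inj_on_le) (auto intro!: finite_PiE)
    also have "\<dots> = nat (2 * N + 1) ^ (p - 1)" by (simp add: card_PiE)
    finally have "real (card W) \<le> real (nat (2 * N + 1)) ^ (p - 1)"
      by (metis of_nat_le_iff of_nat_power)
    also have "\<dots> \<le> (K * R) ^ (p - 1)"
    proof (rule power_mono)
      have "real_of_int N \<le> R / h + 1" by (simp add: N_def)
      then have "real (nat (2 * N + 1)) \<le> 2 * R / h + 3" using N0 by simp
      also have "\<dots> \<le> K * R" using R(1) by (simp add: K_def field_simps)
      finally show "real (nat (2 * N + 1)) \<le> K * R" .
    qed simp
    finally show ?thesis .
  qed
  ultimately show thesis by (rule that)
qed

subsection \<open>The operator \<open>u \<mapsto> \<sigma> u / u\<close> and the action of integer polynomials in \<open>\<sigma>\<close>\<close>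

definition T :: "'L \<Rightarrow> 'L" where "T u = \<sigma> u / u"

lemma T_mult: "T (u * v) = T u * T v" and T_1 [simp]: "T 1 = 1"
  and T_divide: "T (u / v) = T u / T v" and T_power: "T (u ^ n) = T u ^ n"
  by (simp_all add: T_def power_divide)

lemma Tpow_mult: "(T ^^ n) (u * v) = (T ^^ n) u * (T ^^ n) v"
  and Tpow_divide: "(T ^^ n) (u / v) = (T ^^ n) u / (T ^^ n) v"
  and Tpow_1 [simp]: "(T ^^ n) 1 = 1"
  by (induction n) (simp_all add: T_mult T_divide)

lemma U1_T: "u \<in> U1 \<Longrightarrow> T u \<in> U1"
  unfolding T_def by (intro U1_divide U1_\<sigma>)

lemma U1_Tpow: "u \<in> U1 \<Longrightarrow> (T ^^ n) u \<in> U1"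
  by (induction n) (auto intro: U1_T)

lemma T_eq_1: "u \<noteq> 0 \<Longrightarrow> T u = 1 \<Longrightarrow> u \<in> \<rat>"
  by (auto simp: T_def divide_eq_1_iff intro: \<sigma>_fixed)

lemma T_inj_on_U1: "u \<in> U1 \<Longrightarrow> v \<in> U1 \<Longrightarrow> T u = T v \<Longrightarrow> u = v"
proof -
  assume uv: "u \<in> U1" "v \<in> U1" "T u = T v"
  then have "T (u / v) = 1" using U1_nonzero[OF U1_T[of v]] by (simp add: T_divide)
  then have "u / v \<in> \<rat>" using uv U1_nonzero by (intro T_eq_1) auto
  then have "u / v = 1" using uv by (intro U1_rational U1_divide)
  then show "u = v" using U1_nonzero[of v] uv by simp
qed

lemma power_inj_on_U1:
  assumes "u \<in> U1" "v \<in> U1" "u ^ p = v ^ p"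
  shows "u = v"
proof -
  have "emb u ^ p = emb v ^ p" using assms(3) by (simp flip: emb_power)
  then have "emb u = emb v"
    using odd_p by (metis odd_real_root_power_cancel)
  then show ?thesis by simp
qed

text \<open>This is \<open>u\<close> to the power \<open>f(\<sigma>)\<close>, the product of the
  \<open>conj k u powi coeff f k\<close>, in Horner form. Integer polynomials stand for the group
  ring, without reduction modulo \<open>X ^ p - 1\<close>.\<close>

definition act :: "int poly \<Rightarrow> 'L \<Rightarrow> 'L" where
  "act f u = fold_coeffs (\<lambda>a w. u powi a * \<sigma> w) f 1"

lemma act_0 [simp]: "act 0 u = 1"
  by (simp add: act_def)

lemma act_pCons [simp]: "act (pCons a f) u = u powi a * \<sigma> (act f u)"
  by (cases "a = 0 \<and> f = 0") (auto simp: act_def fold_coeffs_def cCons_def)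

lemma act_nonzero [simp]: "u \<noteq> 0 \<Longrightarrow> act f u \<noteq> 0"
  by (induction f) simp_all

lemma act_add: "u \<noteq> 0 \<Longrightarrow> act (f + g) u = act f u * act g u"
  by (induction f g rule: poly_induct2) (simp_all add: power_int_add mult_ac)

lemma \<sigma>_powi: "\<sigma> (x powi n) = \<sigma> x powi n"
  by (simp add: power_int_def)

lemma act_smult: "u \<noteq> 0 \<Longrightarrow> act (smult c f) u = act f u powi c"
  by (induction f) (simp_all add: power_int_mult_distrib \<sigma>_powi mult.commute[of c] power_int_mult)

lemma act_mult: "u \<noteq> 0 \<Longrightarrow> act (f * g) u = act f (act g u)"
  by (induction f) (simp_all add: mult_pCons_left act_add act_smult)

lemma act_minus_1: "act [:-1, 1:] u = T u"
  by (simp add: T_def power_int_minus divide_inverse)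

lemma act_minus_1_power: "u \<noteq> 0 \<Longrightarrow> act ([:-1, 1:] ^ n) u = (T ^^ n) u"
proof (induction n)
  case (Suc n)
  have "act ([:-1, 1:] ^ Suc n) u = act [:-1, 1:] (act ([:-1, 1:] ^ n) u)"
    unfolding power_Suc by (rule act_mult[OF Suc.prems])
  then show ?case unfolding act_minus_1 Suc.IH[OF Suc.prems] by simp
qed (simp add: one_pCons)

lemma act_monom: "act (monom 1 k) u = conj k u"
  by (induction k) (simp_all add: monom_0 monom_Suc)

lemma act_norm: "u \<noteq> 0 \<Longrightarrow> act (\<Sum>k<p. monom 1 k) u = Nm u"
proof -
  assume u: "u \<noteq> 0"
  have "act (\<Sum>k<n. monom 1 k) u = (\<Prod>k<n. conj k u)" for n
    by (induction n) (simp_all add: act_add[OF u] act_monom)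
  then show ?thesis by (simp add: Nm_def)
qed

lemma U1_act: "u \<in> U1 \<Longrightarrow> act f u \<in> U1"
  by (induction f) (auto intro: U1_mult U1_powi U1_\<sigma>)

text \<open>Modulo \<open>p\<close>, \<open>(X - 1) ^ (p - 1) = (X ^ p - 1) / (X - 1)\<close>; in
  coefficients, the binomial coefficient of \<open>p - 1\<close> over \<open>k\<close> is congruent
  to \<open>(-1) ^ k\<close>, by Pascal's rule. Evaluating at 1 gives
  \<open>0 = p + p * h(1)\<close>, hence \<open>h(1) = -1\<close> and the second equation. That
  \<open>h\<close> is -1 up to multiples of \<open>X - 1\<close> is what makes it behave like a unit
  on \<open>U1\<close>.\<close>

lemma minus_1_power_mod_p:
  obtains h k :: "int poly"
  where "[:-1, 1:] ^ (p - 1) = (\<Sum>k<p. monom 1 k) + smult (int p) h" "h = [:-1:] + [:-1, 1:] * k"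
proof -
  have binom: "int p dvd (-1) ^ k * int ((p - 1) choose k) - 1" if "k \<le> p - 1" for k
    using that
  proof (induction k)
    case (Suc k)
    have p: "p = Suc (p - 1)" using p_gt_2 by simp
    have "p choose Suc k = ((p - 1) choose k) + ((p - 1) choose Suc k)"
      by (subst p) (rule binomial_Suc_Suc)
    then have eq: "(-1) ^ Suc k * int ((p - 1) choose Suc k) - 1
      = (-1) ^ Suc k * int (p choose Suc k) + ((-1) ^ k * int ((p - 1) choose k) - 1)"
      by (simp add: algebra_simps)
    have "p dvd p choose Suc k"
      using Suc.prems prime_p by (intro dvd_choose_prime) auto
    then have "int p dvd (-1) ^ Suc k * int (p choose Suc k)" by (intro dvd_mult) simp
    then show ?case unfolding eq using Suc by (intro dvd_add) auto
  qed simp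
  define A where "A = [:-1, 1:] ^ (p - 1) - (\<Sum>k<p. monom (1::int) k)"
  have "int p dvd coeff A k" for k
  proof (cases "k < p")
    case True
    then have "coeff ([:-1, 1::int:] ^ (p - 1)) k = int ((p - 1) choose k) * (-1) ^ (p - 1 - k)"
      by (subst coeff_linear_poly_power) auto
    also have "(-1 :: int) ^ (p - 1 - k) = (-1) ^ k"
    proof -
      have "even (p - 1)" using odd_p by simp
      then show ?thesis using True by (simp add: uminus_power_if)
    qed
    finally have "coeff A k = (-1) ^ k * int ((p - 1) choose k) - 1"
      using True by (simp add: A_def coeff_sum mult.commute)
    then show ?thesis using binom[of k] True by simp
  next
    case False
    have "degree ([:-1, 1::int:] ^ (p - 1)) = p - 1" by (simp add: degree_linear_power)
    then have "coeff ([:-1, 1::int:] ^ (p - 1)) k = 0"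
      using False p_gt_2 by (intro coeff_eq_0) simp
    then have "coeff A k = 0" using False by (simp add: A_def coeff_sum)
    then show ?thesis by simp
  qed
  then have "[:int p:] dvd A" by (simp add: const_poly_dvd_iff)
  then obtain h where h: "A = smult (int p) h" by (auto elim: dvdE)
  then have eq: "[:-1, 1:] ^ (p - 1) = (\<Sum>k<p. monom 1 k) + smult (int p) h"
    by (simp add: A_def algebra_simps)
  have "poly ([:-1, 1::int:] ^ (p - 1)) 1 = 0" using p_gt_2 by simp
  then have "int p + int p * poly h 1 = 0"
    unfolding eq by (simp add: poly_sum poly_monom)
  then have "int p * (1 + poly h 1) = 0" by (simp add: algebra_simps)
  then have "poly (h + 1) 1 = 0" using p_gt_2 by simp
  then have "[:-1, 1:] dvd h + 1" by (simp only: poly_eq_0_iff_dvd)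
  then obtain k where "h + 1 = [:-1, 1:] * k" by (rule dvdE)
  moreover have "[:-1:] + (h + 1) = h" by (simp add: one_pCons)
  ultimately have "h = [:-1:] + [:-1, 1:] * k" by metis
  with eq show thesis by (rule that)
qed

text \<open>The norm polynomial acts trivially on \<open>U1\<close>, so \<open>T ^^ (p - 1)\<close>
  acts as \<open>p * h\<close>; and \<open>h + 1\<close> is a multiple of \<open>X - 1\<close>, so
  \<open>u * act h u\<close> lies in the image of \<open>T\<close>. The last equation prepares the
  converse: up to the \<open>p\<close>-th power of some \<open>T x\<close>, \<open>u ^ p\<close> is
  the inverse of \<open>(T ^^ (p - 1)) u\<close>.\<close>

lemma Tpow_eq_power:
  assumes "u \<in> U1"
  obtains w x where "w \<in> U1" "x \<in> U1" "(T ^^ (p - 1)) u = w ^ p" "u ^ p * (T ^^ (p - 1)) u = T x ^ p"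
proof -
  obtain h k where hk: "[:-1, 1:] ^ (p - 1) = (\<Sum>k<p. monom 1 k) + smult (int p) h"
    "h = [:-1:] + [:-1, 1:] * k"
    by (rule minus_1_power_mod_p)
  have u: "u \<noteq> 0" using assms by (rule U1_nonzero)
  have 1: "(T ^^ (p - 1)) u = act h u ^ p"
    using u assms unfolding act_minus_1_power[OF u, symmetric] hk(1)
    by (simp add: act_add act_norm act_smult U1_def)
  have "act h u = act [:-1:] u * act ([:-1, 1:] * k) u"
    unfolding hk(2) by (rule act_add[OF u])
  also have "act ([:-1, 1:] * k) u = T (act k u)"
    unfolding act_mult[OF u] by (rule act_minus_1)
  also have "act [:-1:] u = inverse u" by (simp add: power_int_minus)
  finally have "u * act h u = T (act k u)" using u by simp
  then have "u ^ p * (T ^^ (p - 1)) u = T (act k u) ^ p"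
    unfolding 1 by (metis power_mult_distrib)
  with 1 show thesis using that U1_act[OF assms] by blast
qed

text \<open>Successive approximation: \<open>u ^ p\<close> equals \<open>T (x ^ p)\<close> divided
  by an element of the image of \<open>T ^^ (p - 1)\<close>. If \<open>x ^ p\<close> is a value of
  \<open>T ^^ j\<close>, this makes \<open>u ^ p\<close> a value of \<open>T ^^ Suc j\<close>, as
  long as \<open>Suc j \<le> p - 1\<close>. Thus an inverse of \<open>h\<close> is never
  constructed.\<close>

lemma power_eq_Tpow:
  assumes "u \<in> U1" "j \<le> p - 1"
  shows "\<exists>w\<in>U1. u ^ p = (T ^^ j) w"
  using assms
proof (induction j arbitrary: u)
  case (Suc j)
  obtain x where x: "x \<in> U1" "u ^ p * (T ^^ (p - 1)) u = T x ^ p"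
    using Tpow_eq_power[OF Suc.prems(1)] by blast
  obtain w where w: "w \<in> U1" "x ^ p = (T ^^ j) w" using Suc x(1) by auto
  define y where "y = (T ^^ (p - 1 - Suc j)) u"
  have y: "y \<in> U1" unfolding y_def by (rule U1_Tpow[OF Suc.prems(1)])
  have "p - 1 = Suc j + (p - 1 - Suc j)" using Suc.prems(2) by simp
  then have "(T ^^ (p - 1)) u = (T ^^ (Suc j + (p - 1 - Suc j))) u" by (rule arg_cong)
  also have "\<dots> = (T ^^ Suc j) y" by (simp only: funpow_add o_apply y_def)
  finally have eq: "(T ^^ (p - 1)) u = (T ^^ Suc j) y" .
  have "T x ^ p = (T ^^ Suc j) w" using w(2) by (simp flip: T_power)
  then have "u ^ p = (T ^^ Suc j) w / (T ^^ Suc j) y"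
    using x(2) U1_nonzero[OF U1_Tpow[OF y]] unfolding eq by (metis nonzero_mult_div_cancel_right)
  then have "u ^ p = (T ^^ Suc j) (w / y)" by (simp only: Tpow_divide)
  then show ?case using U1_divide[OF w(1) y] by blast
qed (auto intro: U1_power)

subsection \<open>Counting units modulo the image of \<open>T\<close>\<close>

text \<open>Representatives of distinct cosets of the image of \<open>U1\<close> under
  \<open>F\<close>. Finite sets replace the index because finiteness of the quotient is not known
  beforehand.\<close>

definition incong :: "('L \<Rightarrow> 'L) \<Rightarrow> 'L set \<Rightarrow> bool" where
  "incong F A \<longleftrightarrow> A \<subseteq> U1 \<and> finite A \<and> (\<forall>u\<in>A. \<forall>v\<in>A. \<forall>m\<in>U1. u = v * F m \<longrightarrow> u = v)"

text \<open>In \<open>u * F w\<close> the factor \<open>u\<close> is determined modulo the image of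
  \<open>F\<close>; once it is cancelled, injectivity of \<open>F\<close> leaves \<open>w\<close>
  modulo the image of \<open>G\<close>.\<close>

lemma incong_product:
  assumes F: "\<And>u v. F (u * v) = F u * F v" "\<And>u. u \<in> U1 \<Longrightarrow> F u \<in> U1"
    "\<And>u v. u \<in> U1 \<Longrightarrow> v \<in> U1 \<Longrightarrow> F u = F v \<Longrightarrow> u = v"
    and G: "G 1 = 1" "\<And>u. u \<in> U1 \<Longrightarrow> G u \<in> U1"
    and A: "incong F A" and Y: "incong G Y"
  defines "Z \<equiv> (\<lambda>(u, w). u * F w) ` (A \<times> Y)"
  shows "incong (F \<circ> G) Z" "card Z = card A * card Y"
proof -
  have sub: "A \<subseteq> U1" "Y \<subseteq> U1" and fin: "finite A" "finite Y" using A Y by (auto simp: incong_def)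
  have key: "u = u' \<and> w = w'"
    if "u \<in> A" "u' \<in> A" "w \<in> Y" "w' \<in> Y" "m \<in> U1" "u * F w = u' * F w' * F (G m)" for u u' w w' m
  proof -
    have U: "u \<in> U1" "u' \<in> U1" "w \<in> U1" "w' \<in> U1" using that sub by auto
    define n where "n = w' * G m / w"
    have n: "n \<in> U1" unfolding n_def by (intro U1_divide U1_mult U G that)
    have "n * w = w' * G m" using U1_nonzero[OF U(3)] by (simp add: n_def)
    then have "F n * F w = F w' * F (G m)" by (metis F(1))
    then have "u * F w = u' * F n * F w" using that(6) by (simp add: mult_ac)
    then have "u = u' * F n" using U1_nonzero[OF F(2)[OF U(3)]] by simp
    then have "u = u'" using A that n unfolding incong_def by blast
    then have "F w = F w' * F (G m)" using that(6) U1_nonzero[OF U(2)] by (simp add: mult.assoc)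
    then have "F w = F (w' * G m)" by (simp add: F(1))
    then have "w = w' * G m" by (rule F(3)[OF U(3) U1_mult[OF U(4) G(2)[OF that(5)]]])
    then have "w = w'" using Y that unfolding incong_def by blast
    with \<open>u = u'\<close> show ?thesis by simp
  qed
  have "Z \<subseteq> U1" using sub F(2) by (auto simp: Z_def intro!: U1_mult)
  moreover have "finite Z" using fin by (simp add: Z_def)
  ultimately show "incong (F \<circ> G) Z" unfolding incong_def
  proof (intro conjI ballI impI)
    fix a b m assume "a \<in> Z" "b \<in> Z" "m \<in> U1" and eq: "a = b * (F \<circ> G) m"
    then obtain u w u' w' where "a = u * F w" "b = u' * F w'" "u \<in> A" "u' \<in> A" "w \<in> Y" "w' \<in> Y"
      by (auto simp: Z_def)
    with key[of u u' w w' m] \<open>m \<in> U1\<close> eq show "a = b" by simp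
  qed
  have "F 1 * F 1 = F 1" using F(1)[of 1 1] by simp
  then have "F 1 = 1" using U1_nonzero[OF F(2)[OF U1_1]] by simp
  then have "inj_on (\<lambda>(u, w). u * F w) (A \<times> Y)"
    using key[where m = 1] G(1) by (auto intro!: inj_onI)
  then show "card Z = card A * card Y"
    unfolding Z_def by (simp add: card_image card_cartesian_product)
qed

lemma incong_T_iterate:
  assumes "incong T A"
  shows "\<exists>Y. incong (T ^^ n) Y \<and> card Y = card A ^ n"
proof (induction n)
  case 0
  show ?case by (intro exI[of _ "{1}"]) (simp add: incong_def)
next
  case (Suc n)
  then obtain Y where Y: "incong (T ^^ n) Y" "card Y = card A ^ n" by blast
  from incong_product[OF T_mult U1_T T_inj_on_U1 Tpow_1 U1_Tpow assms Y(1)] Y(2) show ?case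
    by (metis funpow.simps(2) power_Suc)
qed

text \<open>The bound carries the term -1 so that the induction closes:
  \<open>C + p * C * (p ^ n - 1) \<le> C * (p ^ Suc n - 1)\<close>.\<close>

lemma incong_power_iterate:
  assumes "incong (\<lambda>x. x ^ p) A" "\<And>x. x \<in> A \<Longrightarrow> size1 x \<le> C" "C \<ge> 0"
  shows "\<exists>Y. incong (\<lambda>x. x ^ (p ^ n)) Y \<and> card Y = card A ^ n \<and> (\<forall>y\<in>Y. size1 y \<le> C * (real p ^ n - 1))"
proof (induction n)
  case 0
  show ?case by (intro exI[of _ "{1}"]) (simp add: incong_def)
next
  case (Suc n)
  then obtain Y where Y: "incong (\<lambda>x. x ^ (p ^ n)) Y" "card Y = card A ^ n"
    "\<And>y. y \<in> Y \<Longrightarrow> size1 y \<le> C * (real p ^ n - 1)" by blast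
  let ?Z = "(\<lambda>(u, w). u * w ^ p) ` (A \<times> Y)"
  have Z: "incong ((\<lambda>x. x ^ p) \<circ> (\<lambda>x. x ^ (p ^ n))) ?Z" "card ?Z = card A * card Y"
    using incong_product[OF power_mult_distrib U1_power power_inj_on_U1 power_one U1_power assms(1) Y(1)]
    by blast+
  have "incong (\<lambda>x. x ^ (p ^ Suc n)) ?Z"
    using Z(1) by (simp add: o_def mult.commute flip: power_mult)
  moreover have "size1 z \<le> C * (real p ^ Suc n - 1)" if "z \<in> ?Z" for z
  proof -
    obtain u w where z: "z = u * w ^ p" "u \<in> A" "w \<in> Y" using \<open>z \<in> ?Z\<close> by auto
    then have nz: "u \<noteq> 0" "w \<noteq> 0" using assms(1) Y(1) U1_nonzero by (auto simp: incong_def)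
    have "size1 z \<le> size1 u + real p * size1 w"
      using size1_mult[of u "w ^ p"] nz by (simp add: z(1) size1_power)
    also have "\<dots> \<le> C + real p * (C * (real p ^ n - 1))"
      by (intro add_mono mult_left_mono assms(2) Y(3) z) simp
    also have "\<dots> = C * (real p ^ Suc n - 1) - C * (real p - 2)" by (simp add: algebra_simps)
    also have "\<dots> \<le> C * (real p ^ Suc n - 1)" using assms(3) p_gt_2 by simp
    finally show ?thesis .
  qed
  ultimately show ?case using Z(2) Y(2) by (intro exI[of _ ?Z]) auto
qed

lemma exponential_bound:
  fixes a b c :: real
  assumes "\<And>n. a ^ n \<le> c * b ^ n" "b > 0" "a \<ge> 0"
  shows "a \<le> b"
proof (rule ccontr)
  assume "\<not> a \<le> b"
  then have "a / b > 1" using assms(2) by simp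
  then obtain n where "c < (a / b) ^ n" using real_arch_pow by blast
  then show False using assms(1)[of n] assms(2) by (simp add: power_divide field_simps)
qed

lemma card_incong_T:
  assumes "incong T A"
  shows "card A \<le> p"
proof -
  obtain V where V: "incong (T ^^ (p - 1)) V" "card V = card A ^ (p - 1)"
    using incong_T_iterate[OF assms] by blast
  \<comment> \<open>Every \<open>p\<close>-th power lies in the image of
    \<open>T ^^ (p - 1)\<close>, so incongruence modulo that image gives incongruence modulo
    \<open>p\<close>-th powers.\<close>
  have Vp: "incong (\<lambda>x. x ^ p) V"
    using V(1) power_eq_Tpow[of _ "p - 1"] unfolding incong_def by (metis le_refl)
  define C where "C = (\<Sum>v\<in>V. size1 v) + 1"
  have fin: "finite V" using V(1) by (simp add: incong_def)
  have C: "size1 v \<le> C" if "v \<in> V" for v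
    using member_le_sum[of v V size1] that fin size1_nonneg by (simp add: C_def)
  have C1: "C \<ge> 1" using size1_nonneg by (simp add: C_def sum_nonneg)
  obtain K where K: "K > 0"
    "\<And>W R. W \<subseteq> U1 \<Longrightarrow> R \<ge> 1 \<Longrightarrow> (\<And>w. w \<in> W \<Longrightarrow> size1 w \<le> R) \<Longrightarrow> real (card W) \<le> (K * R) ^ (p - 1)"
    by (rule U1_count) blast
  \<comment> \<open>The constant \<open>(K * C) ^ (p - 1)\<close> does not depend on
    \<open>n\<close> and disappears when growth rates are compared.\<close>
  have "real (card V) ^ n \<le> (K * C) ^ (p - 1) * (real p ^ (p - 1)) ^ n" for n
  proof -
    obtain Y where Y: "incong (\<lambda>x. x ^ (p ^ n)) Y" "card Y = card V ^ n"
      "\<And>y. y \<in> Y \<Longrightarrow> size1 y \<le> C * (real p ^ n - 1)"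
      using incong_power_iterate[OF Vp C, of n] C1 by auto
    have "1 * 1 \<le> C * real p ^ n" using C1 p_gt_2 by (intro mult_mono) auto
    moreover have "size1 y \<le> C * real p ^ n" if "y \<in> Y" for y
      using Y(3)[OF that] C1 by (simp add: right_diff_distrib)
    ultimately have "real (card Y) \<le> (K * (C * real p ^ n)) ^ (p - 1)"
      using Y(1) by (intro K(2)) (auto simp: incong_def)
    then show ?thesis
      by (simp add: Y(2) power_mult_distrib mult_ac flip: power_mult)
  qed
  then have "real (card V) \<le> real p ^ (p - 1)"
    by (rule exponential_bound) (use p_gt_2 in simp_all)
  then have "real (card A) ^ (p - 1) \<le> real p ^ (p - 1)" by (simp add: V(2))
  then show ?thesis using p_gt_2 by (simp add: power_mono_iff)
qed

subsection \<open>A nontrivial unit\<close>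

lemma \<theta>_independent:
  assumes "(\<Sum>k<p. of_int (z k) * \<theta> ^ k) = 0" "k < p"
  shows "z k = 0"
proof (rule ccontr)
  assume "z k \<noteq> 0"
  define f where "f = (\<Sum>k<p. monom (of_int (z k) :: 'L) k)"
  have coeff: "coeff f j = (if j < p then of_int (z j) else 0)" for j
    by (simp add: f_def coeff_sum)
  then have "f \<noteq> 0" using \<open>z k \<noteq> 0\<close> assms(2) by (metis coeff_0 of_int_eq_0_iff)
  have deg: "degree f \<le> p - 1" by (rule degree_le) (auto simp: coeff)
  have "poly f (conj i \<theta>) = conj i (\<Sum>k<p. of_int (z k) * \<theta> ^ k)" for i
    by (simp add: f_def poly_sum poly_monom conj_sum)
  then have "(\<lambda>i. conj i \<theta>) ` {..<p} \<subseteq> {x. poly f x = 0}" using assms(1) by auto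
  moreover have "card ((\<lambda>i. conj i \<theta>) ` {..<p}) = p"
    by (subst card_image) (auto intro!: inj_onI conj_\<theta>_inj)
  ultimately have "p \<le> degree f"
    using card_mono[OF poly_roots_finite[OF \<open>f \<noteq> 0\<close>]] card_poly_roots_bound[OF \<open>f \<noteq> 0\<close>]
    by (metis le_trans)
  then show False using deg p_gt_2 by simp
qed

text \<open>Dirichlet's box principle: all but one of the conjugates can be made as small as \<open>1/m\<close> at the
  cost of a conjugate of order \<open>m\<^bsup>p - 1\<^esup>\<close>.\<close>

lemma small_conjugates:
  obtains K :: real where "K > 0"
    and "\<And>m::nat. m \<ge> 2 \<Longrightarrow> \<exists>x. algebraic_int x \<and> x \<noteq> 0 \<and> \<bar>emb (\<sigma> x)\<bar> \<le> K / real m \<and> \<bar>emb (Nm x)\<bar> \<le> K"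
proof -
  define C where "C = 1 + (\<Sum>k<p. \<Sum>i<p. \<bar>emb (conj i \<theta>)\<bar> ^ k)"
  have C1: "C \<ge> 1" by (simp add: C_def sum_nonneg)
  \<comment> \<open>The two summands serve the two estimates: \<open>4 * C\<close> bounds the small
    conjugate times \<open>m\<close>, the other one bounds the norm.\<close>
  define K where "K = 4 * C + C * (4 * C) ^ (p - 1)"
  have K1: "4 * C \<le> K" and K2: "C * (4 * C) ^ (p - 1) \<le> K" and K0: "K > 0"
    using C1 by (simp_all add: K_def add_pos_nonneg)
  define \<alpha> :: "(nat \<Rightarrow> int) \<Rightarrow> 'L" where "\<alpha> z = (\<Sum>k<p. of_int (z k) * \<theta> ^ k)" for z
  have bound: "\<bar>emb (conj i (\<alpha> z))\<bar> \<le> C * n"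
    if "i < p" "\<And>k. k < p \<Longrightarrow> \<bar>real_of_int (z k)\<bar> \<le> n" "n \<ge> 0" for i z n
  proof -
    have "\<bar>emb (conj i (\<alpha> z))\<bar> = \<bar>\<Sum>k<p. real_of_int (z k) * emb (conj i \<theta>) ^ k\<bar>"
      by (simp add: \<alpha>_def conj_sum emb_sum)
    also have "\<dots> \<le> (\<Sum>k<p. n * \<bar>emb (conj i \<theta>)\<bar> ^ k)"
      by (rule order_trans[OF sum_abs])
         (intro sum_mono, simp add: abs_mult power_abs mult_right_mono that)
    also have "\<dots> = n * (\<Sum>k<p. \<bar>emb (conj i \<theta>)\<bar> ^ k)" by (simp add: sum_distrib_left)
    also have "\<dots> \<le> n * C"
    proof (rule mult_left_mono[OF _ that(3)])
      have "(\<Sum>k<p. \<bar>emb (conj i \<theta>)\<bar> ^ k) \<le> (\<Sum>k<p. \<Sum>i<p. \<bar>emb (conj i \<theta>)\<bar> ^ k)"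
        using that(1) by (intro sum_mono member_le_sum[of i]) auto
      then show "(\<Sum>k<p. \<bar>emb (conj i \<theta>)\<bar> ^ k) \<le> C" by (simp add: C_def)
    qed
    finally show ?thesis by (simp only: mult.commute)
  qed
  have "\<exists>x. algebraic_int x \<and> x \<noteq> 0 \<and> \<bar>emb (\<sigma> x)\<bar> \<le> K / real m \<and> \<bar>emb (Nm x)\<bar> \<le> K" if m: "m \<ge> 2" for m :: nat
  proof -
    \<comment> \<open>There are \<open>n ^ p = (m ^ p) ^ (p - 1)\<close> coefficient vectors. The
      cell width \<open>s\<close> is chosen so that the bound \<open>C * n\<close> on a conjugate
      amounts to \<open>m ^ p / 4\<close> cells; with both signs and rounding this is fewer than
      \<open>m ^ p\<close> cells in each of the \<open>p - 1\<close> directions, since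
      \<open>m ^ p \<ge> 8\<close>.\<close>
    define n where "n = m ^ (p - 1)"
    define N where "N = int (m ^ p div 4 + 1)"
    define s where "s = 4 * C / real m"
    have s: "s > 0" using C1 m by (simp add: s_def)
    have nm: "n * m = m ^ p" unfolding n_def using p_gt_2 by (intro power_minus_mult) simp
    define cell where "cell z = (\<lambda>i\<in>{1..<p}. \<lfloor>emb (conj i (\<alpha> z)) / s\<rfloor>)" for z
    let ?Z = "{..<p} \<rightarrow>\<^sub>E {0..<int n}" and ?B = "{1..<p} \<rightarrow>\<^sub>E {-N..N}"
    have "cell z \<in> ?B" if z: "z \<in> ?Z" for z
    proof -
      have "\<lfloor>emb (conj i (\<alpha> z)) / s\<rfloor> \<in> {-N..N}" if i: "i \<in> {1..<p}" for i
      proof -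
        have "\<bar>real_of_int (z k)\<bar> \<le> real n" if "k < p" for k
        proof -
          have "z k \<in> {0..<int n}" using PiE_mem[OF z] that by simp
          then show ?thesis by simp
        qed
        then have "\<bar>emb (conj i (\<alpha> z))\<bar> \<le> C * real n" using i by (intro bound) auto
        then have "\<bar>emb (conj i (\<alpha> z)) / s\<bar> \<le> C * real n / s" using s by (simp add: abs_divide divide_right_mono)
        also have "C * real n / s = real (m ^ p) / 4" using C1 m by (simp add: s_def nm[symmetric])
        also have "\<dots> \<le> of_int N" unfolding N_def by linarith
        finally have "- of_int N \<le> emb (conj i (\<alpha> z)) / s" "emb (conj i (\<alpha> z)) / s \<le> of_int N" by linarith+
        then show ?thesis by (simp add: le_floor_iff floor_le_iff)
      qed
      then show ?thesis by (auto simp: cell_def PiE_iff simp del: atLeastAtMost_iff atLeastLessThan_iff)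
    qed
    then have "cell ` ?Z \<subseteq> ?B" by auto
    then have "card (cell ` ?Z) \<le> card ?B" by (intro card_mono) (auto intro!: finite_PiE)
    also have "\<dots> = nat (2 * N + 1) ^ (p - 1)" by (simp add: card_PiE)
    also have "\<dots> < (m ^ p) ^ (p - 1)"
    proof (rule power_strict_mono)
      have "2 ^ 3 \<le> m ^ p"
        using p_gt_2 m by (intro order_trans[OF power_increasing[of 3 p 2] power_mono]) auto
      moreover have "2 * (q div 4 + 1) + 1 < q" if "8 \<le> q" for q :: nat using that by presburger
      ultimately have "2 * (m ^ p div 4 + 1) + 1 < m ^ p" by simp
      moreover have "nat (2 * int a + 1) = 2 * a + 1" for a by linarith
      ultimately show "nat (2 * N + 1) < m ^ p" unfolding N_def by simp
    qed (use p_gt_2 in auto)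
    also have "(m ^ p) ^ (p - 1) = n ^ p"
      unfolding n_def power_mult[symmetric] by (simp only: mult.commute)
    also have "\<dots> = card ?Z" by (simp add: card_PiE)
    finally obtain z z' where z: "z \<in> ?Z" "z' \<in> ?Z" "cell z = cell z'" "z \<noteq> z'"
      using pigeonhole[of cell ?Z] by (auto simp: inj_on_def)
    define x where "x = \<alpha> (\<lambda>k. z k - z' k)"
    have xeq: "x = \<alpha> z - \<alpha> z'" by (simp add: x_def \<alpha>_def left_diff_distrib sum_subtractf)
    have ai: "algebraic_int x" unfolding x_def \<alpha>_def by (rule algebraic_int_combination)
    have "x \<noteq> 0"
    proof
      assume "x = 0"
      then have "z k = z' k" if "k < p" for k
        using \<theta>_independent[of "\<lambda>k. z k - z' k" k] that by (simp add: x_def \<alpha>_def)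
      then have "z = z'" using PiE_ext[OF z(1,2)] by auto
      with z(4) show False by simp
    qed
    have small: "\<bar>emb (conj i x)\<bar> \<le> s" if "i \<in> {1..<p}" for i
    proof -
      have "\<lfloor>emb (conj i (\<alpha> z)) / s\<rfloor> = \<lfloor>emb (conj i (\<alpha> z')) / s\<rfloor>"
        using fun_cong[OF z(3), of i] that by (simp add: cell_def)
      then have "\<bar>emb (conj i (\<alpha> z)) / s - emb (conj i (\<alpha> z')) / s\<bar> < 1" by linarith
      then have "\<bar>emb (conj i x) / s\<bar> < 1" by (simp add: xeq diff_divide_distrib)
      then show ?thesis using s by (simp add: abs_divide)
    qed
    have "\<bar>real_of_int (z k - z' k)\<bar> \<le> real n" if "k < p" for k
    proof -
      have "z k \<in> {0..<int n}" "z' k \<in> {0..<int n}"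
        using PiE_mem[OF z(1)] PiE_mem[OF z(2)] that by simp_all
      then have "\<bar>z k - z' k\<bar> \<le> int n" unfolding atLeastLessThan_iff by linarith
      then show ?thesis by linarith
    qed
    then have large: "\<bar>emb (conj 0 x)\<bar> \<le> C * real n"
      unfolding x_def using p_gt_2 by (intro bound) auto
    have "\<bar>emb (Nm x)\<bar> = \<bar>emb x\<bar> * (\<Prod>i\<in>{1..<p}. \<bar>emb (conj i x)\<bar>)"
      by (simp add: Nm_eq emb_prod abs_mult abs_prod)
    also have "\<dots> \<le> (C * real n) * (\<Prod>i\<in>{1..<p}. s)"
      using large small C1 by (intro mult_mono prod_mono prod_nonneg) auto
    also have "\<dots> = C * (4 * C) ^ (p - 1)"
      using m by (simp add: s_def n_def power_divide)
    finally have "\<bar>emb (Nm x)\<bar> \<le> K" using K2 by simp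
    moreover have "\<bar>emb (\<sigma> x)\<bar> \<le> K / real m"
    proof -
      have "\<bar>emb (\<sigma> x)\<bar> \<le> s" using small[of 1] p_gt_2 by simp
      also have "\<dots> \<le> K / real m" unfolding s_def using K1 by (intro divide_right_mono) auto
      finally show ?thesis .
    qed
    ultimately show ?thesis using ai \<open>x \<noteq> 0\<close> by blast
  qed
  with K0 show thesis by (rule that)
qed

lemma quotient_algebraic_int:
  assumes "algebraic_int x" "algebraic_int y" "y \<noteq> 0" "Nm x = Nm y" "algebraic_int w" "x - y = Nm y * w"
  shows "algebraic_int (x / y)"
proof -
  obtain c where c: "algebraic_int c" "Nm y = y * c" using Nm_cofactor[OF assms(2)] by blast
  have "x = y * (1 + c * w)" using assms(6) c(2) by (simp add: algebra_simps)
  then have "x / y = 1 + c * w" using assms(3) by simp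
  then show ?thesis by (simp add: algebraic_int_add algebraic_int_mult c assms(5))
qed

text \<open>If 1 were the only unit of norm one, algebraic integers of the same nonzero norm that
  agree modulo that norm would be equal, their quotient being such a unit; so each nonzero norm
  would occur finitely often. Nonzero elements of bounded norm would then form a finite set, on
  which a fixed conjugate cannot become arbitrarily small.\<close>

lemma exists_nontrivial_unit: "\<exists>u\<in>U1. u \<noteq> 1"
proof (rule ccontr)
  assume "\<not> ?thesis"
  then have trivial: "u = 1" if "u \<in> U1" for u using that by blast
  obtain K where K: "K > 0"
    "\<And>m::nat. m \<ge> 2 \<Longrightarrow> \<exists>x. algebraic_int x \<and> x \<noteq> 0 \<and> \<bar>emb (\<sigma> x)\<bar> \<le> K / real m \<and> \<bar>emb (Nm x)\<bar> \<le> K"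
    by (rule small_conjugates) blast
  define A where "A = {x. algebraic_int x \<and> x \<noteq> 0 \<and> \<bar>emb (Nm x)\<bar> \<le> K}"
  have fin: "finite {x. algebraic_int x \<and> Nm x = of_int n}" (is "finite ?S") if n0: "n \<noteq> 0" for n
  proof -
    obtain f :: "'L \<Rightarrow> nat \<Rightarrow> int" where f: "finite (f ` {x. algebraic_int x})"
      "\<And>x y. algebraic_int x \<Longrightarrow> algebraic_int y \<Longrightarrow> f x = f y
        \<Longrightarrow> \<exists>w. algebraic_int w \<and> x - y = of_int \<bar>n\<bar> * w"
      by (rule finite_residues[of "\<bar>n\<bar>"]) (use n0 in simp, blast)
    have "inj_on f ?S"
    proof (rule inj_onI)
      fix x y assume xy: "x \<in> ?S" "y \<in> ?S" "f x = f y"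
      then have nz: "x \<noteq> 0" "y \<noteq> 0" using n0 by auto
      obtain w where w: "algebraic_int w" "x - y = of_int \<bar>n\<bar> * w" using f(2)[of x y] xy by auto
      define v where "v = of_int (sgn n) * w"
      have v: "algebraic_int v" unfolding v_def by (intro algebraic_int_mult w) simp
      have "of_int n * v = of_int (n * sgn n) * w" by (simp add: v_def)
      also have "n * sgn n = \<bar>n\<bar>" by (simp add: abs_sgn)
      finally have eq: "x - y = of_int n * v" using w(2) by simp
      have "algebraic_int (x / y)"
        using xy nz v eq by (intro quotient_algebraic_int[of _ _ v]) auto
      then have "x / y \<in> U1" using xy n0 by (simp add: U1_def)
      then show "x = y" using trivial nz by fastforce
    qed
    moreover have "finite (f ` ?S)" using f(1) by (rule finite_subset[rotated]) auto
    ultimately show ?thesis by (rule finite_imageD[rotated])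
  qed
  have "A \<subseteq> (\<Union>n\<in>{-\<lceil>K\<rceil>..\<lceil>K\<rceil>} - {0}. {x. algebraic_int x \<and> Nm x = of_int n})"
  proof
    fix x assume x: "x \<in> A"
    then obtain n where n: "Nm x = of_int n" using Nm_Ints by (auto simp: A_def elim!: Ints_cases)
    have "n \<noteq> 0" using n x Nm_eq_0_iff[of x] by (auto simp: A_def)
    moreover have "\<bar>real_of_int n\<bar> \<le> K" using x n by (simp add: A_def)
    then have "n \<in> {-\<lceil>K\<rceil>..\<lceil>K\<rceil>}" by (simp, linarith)
    ultimately show "x \<in> (\<Union>n\<in>{-\<lceil>K\<rceil>..\<lceil>K\<rceil>} - {0}. {x. algebraic_int x \<and> Nm x = of_int n})"
      using x n by (auto simp: A_def)
  qed
  then have "finite A" by (rule finite_subset) (auto intro: fin)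
  define e where "e = Min (insert 1 ((\<lambda>x. \<bar>emb (\<sigma> x)\<bar>) ` A))"
  have "e > 0" using \<open>finite A\<close> by (auto simp: e_def A_def)
  obtain m :: nat where m: "K / e < real m" using reals_Archimedean2 by blast
  define m' where "m' = m + 2"
  have "K / e < real m'" using m by (simp add: m'_def)
  then have "K / real m' < e" using \<open>e > 0\<close> by (simp add: m'_def field_simps)
  moreover obtain x where x: "x \<in> A" "\<bar>emb (\<sigma> x)\<bar> \<le> K / real m'"
    using K(2)[of m'] by (auto simp: A_def m'_def)
  moreover have "e \<le> \<bar>emb (\<sigma> x)\<bar>" using \<open>finite A\<close> x(1) by (simp add: e_def)
  ultimately show False by linarith
qed

lemma T_not_surj: "\<exists>u\<in>U1. \<forall>v\<in>U1. u \<noteq> T v"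
proof (rule ccontr)
  assume "\<not> ?thesis"
  then have surj: "\<exists>v\<in>U1. u = T v" if "u \<in> U1" for u using that by blast
  have surjn: "\<exists>v\<in>U1. u = (T ^^ n) v" if "u \<in> U1" for u n
  proof (induction n)
    case (Suc n)
    then obtain v where v: "v \<in> U1" "u = (T ^^ n) v" by blast
    then obtain w where "w \<in> U1" "v = T w" using surj by blast
    then show ?case using v(2) by (metis funpow_Suc_right o_apply)
  qed (use that in auto)
  have root: "\<exists>w\<in>U1. u = w ^ p" if u: "u \<in> U1" for u
  proof -
    obtain v where "v \<in> U1" "u = (T ^^ (p - 1)) v" using surjn[OF u] by blast
    then show ?thesis using Tpow_eq_power[of v] by metis
  qed
  obtain u0 where u0: "u0 \<in> U1" "u0 \<noteq> 1" using exists_nontrivial_unit by blast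
  define S where "S = {u \<in> U1. size1 u \<le> size1 u0} - {1}"
  have fin: "finite S" unfolding S_def using finite_U1_size1 by simp
  have "S \<noteq> {}" using u0 by (auto simp: S_def)
  \<comment> \<open>A unit of least size other than 1; its \<open>p\<close>-th root is again
    different from 1 and smaller in size by the factor \<open>p\<close>.\<close>
  define u where "u = arg_min_on size1 S"
  have u: "u \<in> S" "\<And>v. v \<in> S \<Longrightarrow> size1 u \<le> size1 v"
    using arg_min_if_finite[OF fin \<open>S \<noteq> {}\<close>, of size1] by (auto simp: u_def not_less)
  then obtain w where w: "w \<in> U1" "u = w ^ p" using root[of u] by (auto simp: S_def)
  have "size1 u > 0" using u(1) U1_size1_eq_0[of u] size1_nonneg[of u] by (force simp: S_def)
  moreover have eq: "size1 u = real p * size1 w" using w U1_nonzero by (simp add: size1_power)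
  ultimately have pos: "size1 w > 0" using p_gt_2 by (simp add: zero_less_mult_iff)
  then have less: "size1 w < size1 u" using p_gt_2 by (simp add: eq)
  then have "w \<in> S" using w u(1) pos by (auto simp: S_def)
  then show False using u(2) less by fastforce
qed

end

section \<open>The group of fractional ideals\<close>

abbreviation \<O> :: "'a::field_char_0 set" where "\<O> \<equiv> carrier ring_of_integers"

lemma mem_\<O> [simp]: "x \<in> \<O> \<longleftrightarrow> algebraic_int x"
  by (simp add: ring_of_integers_def)

lemma ring_of_integers_simps [simp]:
  "monoid.mult (ring_of_integers :: 'a::field_char_0 ring) = (*)"
  "monoid.one (ring_of_integers :: 'a ring) = 1"
  "\<zero>\<^bsub>(ring_of_integers :: 'a ring)\<^esub> = 0"
  "ring.add (ring_of_integers :: 'a ring) = (+)"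
  by (simp_all add: ring_of_integers_def ring_of_type_algebra_def)

lemma ring_of_type_algebra_simps [simp]:
  "monoid.mult (ring_of_type_algebra :: 'a::field_char_0 ring) = (*)"
  "ring.add (ring_of_type_algebra :: 'a ring) = (+)"
  by (simp_all add: ring_of_type_algebra_def)

lemma cring_ring_of_integers: "cring (ring_of_integers :: 'a::field_char_0 ring)"
proof (rule cringI)
  show "abelian_group (ring_of_integers :: 'a ring)"
  proof (rule abelian_groupI)
    fix x :: 'a assume "x \<in> \<O>"
    then show "\<exists>y\<in>\<O>. y \<oplus>\<^bsub>ring_of_integers\<^esub> x = \<zero>\<^bsub>ring_of_integers\<^esub>"
      by (intro bexI[of _ "- x"]) auto
  qed (auto intro: algebraic_int_add)
  show "comm_monoid (ring_of_integers :: 'a ring)"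
    by (rule comm_monoidI) (auto intro: algebraic_int_mult)
qed (auto simp: algebra_simps)

text \<open>Modules over the ring of integers as bare sets of field elements. Ideals and fractional
  ideals are reduced to this, which removes the records from most later arguments.\<close>

definition submodule\<^sub>O :: "'a::field_char_0 set \<Rightarrow> bool" where
  "submodule\<^sub>O I \<longleftrightarrow> 0 \<in> I \<and> (\<forall>x\<in>I. \<forall>y\<in>I. x + y \<in> I) \<and> (\<forall>a x. algebraic_int a \<longrightarrow> x \<in> I \<longrightarrow> a * x \<in> I)"

lemma submodule\<^sub>O_simps:
  assumes "submodule\<^sub>O I"
  shows submodule\<^sub>O_0: "0 \<in> I"
    and submodule\<^sub>O_add: "x \<in> I \<Longrightarrow> y \<in> I \<Longrightarrow> x + y \<in> I"
    and submodule\<^sub>O_mult: "algebraic_int a \<Longrightarrow> x \<in> I \<Longrightarrow> a * x \<in> I"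
  using assms by (auto simp: submodule\<^sub>O_def)

lemma submodule\<^sub>O_uminus: "submodule\<^sub>O I \<Longrightarrow> x \<in> I \<Longrightarrow> - x \<in> I"
  using submodule\<^sub>O_mult[of I "-1" x] by simp

lemma submodule\<^sub>O_diff: "submodule\<^sub>O I \<Longrightarrow> x \<in> I \<Longrightarrow> y \<in> I \<Longrightarrow> x - y \<in> I"
  using submodule\<^sub>O_add[of I x "- y"] submodule\<^sub>O_uminus[of I y] by simp

lemma submodule\<^sub>O_sum: "submodule\<^sub>O I \<Longrightarrow> (\<And>a. a \<in> A \<Longrightarrow> f a \<in> I) \<Longrightarrow> sum f A \<in> I"
  by (induction A rule: infinite_finite_induct) (auto intro: submodule\<^sub>O_0 submodule\<^sub>O_add)

lemma submodule\<^sub>O_image_mult: "submodule\<^sub>O I \<Longrightarrow> submodule\<^sub>O ((*) d ` I)"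
  unfolding submodule\<^sub>O_def
  by (auto simp: image_iff Bex_def simp flip: distrib_left) (metis mult.left_commute)+

lemma ideal_ring_of_integers_iff:
  "ideal J (ring_of_integers :: 'a::field_char_0 ring) \<longleftrightarrow> submodule\<^sub>O J \<and> J \<subseteq> \<O>"
proof
  assume "ideal J (ring_of_integers :: 'a ring)"
  then interpret ideal J "ring_of_integers :: 'a ring" .
  show "submodule\<^sub>O J \<and> J \<subseteq> \<O>"
    unfolding submodule\<^sub>O_def
    using additive_subgroup.zero_closed[OF additive_subgroup_axioms]
      additive_subgroup.a_closed[OF additive_subgroup_axioms] I_l_closed Icarr by auto
next
  assume J: "submodule\<^sub>O J \<and> J \<subseteq> \<O>"
  interpret cring "ring_of_integers :: 'a ring" by (rule cring_ring_of_integers)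
  show "ideal J (ring_of_integers :: 'a ring)"
  proof (rule idealI[OF ring_axioms])
    show "subgroup J (add_monoid (ring_of_integers :: 'a ring))"
    proof (rule add.subgroupI)
      fix x assume x: "x \<in> J"
      then have "\<ominus>\<^bsub>ring_of_integers\<^esub> x = - x"
        using J by (intro minus_equality) auto
      then show "\<ominus>\<^bsub>ring_of_integers\<^esub> x \<in> J"
        using J x submodule\<^sub>O_uminus[of J x] by simp
    qed (use J in \<open>auto simp: submodule\<^sub>O_def\<close>)
  next
    fix a x assume "a \<in> J" "x \<in> carrier (ring_of_integers :: 'a ring)"
    then have "x * a \<in> J" using J submodule\<^sub>O_mult[of J x a] by simp
    then show "x \<otimes>\<^bsub>ring_of_integers\<^esub> a \<in> J" "a \<otimes>\<^bsub>ring_of_integers\<^esub> x \<in> J"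
      by (simp_all add: mult.commute)
  qed
qed

lemma fractional_ideals_iff:
  "I \<in> fractional_ideals \<longleftrightarrow>
     submodule\<^sub>O I \<and> I \<noteq> {0} \<and> (\<exists>d. algebraic_int d \<and> d \<noteq> 0 \<and> (*) d ` I \<subseteq> \<O>)"
proof -
  have "submodule\<^sub>O I" if "submodule\<^sub>O ((*) d ` I)" "d \<noteq> 0" for d
  proof -
    have "(*) (inverse d) ` (*) d ` I = I"
      using that(2) by (simp add: image_image mult.assoc[symmetric])
    then show ?thesis using submodule\<^sub>O_image_mult[OF that(1), of "inverse d"] by simp
  qed
  then show ?thesis
    unfolding fractional_ideals_def ideal_ring_of_integers_iff
    by (auto intro: submodule\<^sub>O_image_mult)
qed

lemma fractional_ideal_submodule: "I \<in> fractional_ideals \<Longrightarrow> submodule\<^sub>O I"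
  by (simp add: fractional_ideals_iff)

lemma fractional_ideal_nonzero: "I \<in> fractional_ideals \<Longrightarrow> \<exists>x\<in>I. x \<noteq> 0"
  using submodule\<^sub>O_0[of I] by (auto simp: fractional_ideals_iff)

lemma fractional_ideals_integral:
  "I \<subseteq> \<O> \<Longrightarrow> submodule\<^sub>O I \<Longrightarrow> x \<in> I \<Longrightarrow> x \<noteq> 0 \<Longrightarrow> I \<in> fractional_ideals"
  unfolding fractional_ideals_iff by (auto intro!: exI[of _ 1])

lemma submodule\<^sub>O_\<O>: "submodule\<^sub>O \<O>"
  by (auto simp: submodule\<^sub>O_def intro: algebraic_int_add algebraic_int_mult)

lemma fractional_ideals_\<O>: "\<O> \<in> fractional_ideals"
  by (rule fractional_ideals_integral[of _ 1]) (auto simp: submodule\<^sub>O_\<O>)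

section \<open>Products of fractional ideals\<close>

abbreviation iprod :: "'a::field_char_0 set \<Rightarrow> 'a set \<Rightarrow> 'a set" where
  "iprod I J \<equiv> ideal_prod ring_of_type_algebra I J"

lemma iprod_mult: "i \<in> I \<Longrightarrow> j \<in> J \<Longrightarrow> i * j \<in> iprod I J"
  using ideal_prod.prod[of i I j J ring_of_type_algebra] by simp

lemma iprod_add: "x \<in> iprod I J \<Longrightarrow> y \<in> iprod I J \<Longrightarrow> x + y \<in> iprod I J"
  using ideal_prod.sum[of x ring_of_type_algebra I J y] by simp

lemma iprod_induct [consumes 1, case_names mult add]:
  assumes "x \<in> iprod I J" "\<And>i j. i \<in> I \<Longrightarrow> j \<in> J \<Longrightarrow> Q (i * j)"
    "\<And>x y. x \<in> iprod I J \<Longrightarrow> y \<in> iprod I J \<Longrightarrow> Q x \<Longrightarrow> Q y \<Longrightarrow> Q (x + y)"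
  shows "Q x"
  using assms by (induction rule: ideal_prod.induct) auto

lemma iprod_mono: "I \<subseteq> I' \<Longrightarrow> J \<subseteq> J' \<Longrightarrow> iprod I J \<subseteq> iprod I' J'"
proof
  fix x assume IJ: "I \<subseteq> I'" "J \<subseteq> J'" and "x \<in> iprod I J"
  from this(3) show "x \<in> iprod I' J'"
    by (induction rule: iprod_induct) (use IJ in \<open>auto intro: iprod_mult iprod_add\<close>)
qed

lemma submodule\<^sub>O_iprod:
  fixes I J :: "'a::field_char_0 set"
  assumes "submodule\<^sub>O I" "submodule\<^sub>O J"
  shows "submodule\<^sub>O (iprod I J)"
  unfolding submodule\<^sub>O_def
proof (intro conjI ballI allI impI)
  show "0 \<in> iprod I J" using iprod_mult[of 0 I 0 J] assms by (simp add: submodule\<^sub>O_0)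
next
  fix a x :: 'a assume a: "algebraic_int a" and "x \<in> iprod I J"
  from this(2) show "a * x \<in> iprod I J"
  proof (induction rule: iprod_induct)
    case (mult i j)
    then show ?case
      using iprod_mult[OF submodule\<^sub>O_mult[OF assms(1) a, of i], of j J] by (simp add: mult.assoc)
  qed (simp add: distrib_left iprod_add)
qed (rule iprod_add)

lemma iprod_fractional:
  assumes "I \<in> fractional_ideals" "J \<in> fractional_ideals"
  shows "iprod I J \<in> fractional_ideals"
proof -
  note sub = fractional_ideal_submodule[OF assms(1)] fractional_ideal_submodule[OF assms(2)]
  obtain d e where d: "algebraic_int d" "d \<noteq> 0" "(*) d ` I \<subseteq> \<O>"
    and e: "algebraic_int e" "e \<noteq> 0" "(*) e ` J \<subseteq> \<O>"
    using assms by (auto simp: fractional_ideals_iff)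
  obtain x y where "x \<in> I" "x \<noteq> 0" "y \<in> J" "y \<noteq> 0"
    using fractional_ideal_nonzero assms by meson
  then have "x * y \<in> iprod I J" "x * y \<noteq> 0" by (simp_all add: iprod_mult)
  then have "iprod I J \<noteq> {0}" by (metis singletonD)
  moreover have "d * e * x \<in> \<O>" if "x \<in> iprod I J" for x
    using that
  proof (induction rule: iprod_induct)
    case (mult i j)
    then have "d * i \<in> \<O>" "e * j \<in> \<O>" using d(3) e(3) by auto
    then have "(d * i) * (e * j) \<in> \<O>" by (simp add: algebraic_int_mult)
    then show ?case by (simp only: mult_ac)
  qed (simp add: distrib_left algebraic_int_add)
  then have "(*) (d * e) ` iprod I J \<subseteq> \<O>" by blast
  ultimately show ?thesis
    unfolding fractional_ideals_iff using d e submodule\<^sub>O_iprod[OF sub]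
    by (intro conjI exI[of _ "d * e"]) (auto intro: algebraic_int_mult)
qed

lemma iprod_commute: "iprod I J = iprod J I"
proof -
  have "iprod I J \<subseteq> iprod J I" for I J :: "'a set"
  proof
    fix x assume "x \<in> iprod I J"
    then show "x \<in> iprod J I"
    proof (induction rule: iprod_induct)
      case (mult i j)
      then show ?case using iprod_mult[of j J i I] by (simp add: mult.commute)
    qed (rule iprod_add)
  qed
  then show ?thesis by blast
qed

lemma iprod_assoc_subset: "iprod (iprod I J) K \<subseteq> iprod I (iprod J K)"
proof
  fix x assume "x \<in> iprod (iprod I J) K"
  then show "x \<in> iprod I (iprod J K)"
  proof (induction rule: iprod_induct)
    case (mult y k)
    from mult(1) show ?case
      by (induction rule: iprod_induct)
         (use mult(2) in \<open>auto simp: mult.assoc distrib_right intro: iprod_mult iprod_add\<close>)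
  qed (rule iprod_add)
qed

lemma iprod_assoc: "iprod (iprod I J) K = iprod I (iprod J K)"
proof
  have "iprod I (iprod J K) = iprod (iprod K J) I" by (simp only: iprod_commute)
  also have "\<dots> \<subseteq> iprod K (iprod J I)" by (rule iprod_assoc_subset)
  also have "\<dots> = iprod (iprod I J) K" by (simp only: iprod_commute)
  finally show "iprod I (iprod J K) \<subseteq> iprod (iprod I J) K" .
qed (rule iprod_assoc_subset)

lemma iprod_principal: "submodule\<^sub>O I \<Longrightarrow> iprod (principal_ideal a) I = (*) a ` I"
proof (intro equalityI subsetI)
  assume I: "submodule\<^sub>O I"
  {
    fix x assume "x \<in> iprod (principal_ideal a) I"
    then show "x \<in> (*) a ` I"
    proof (induction rule: iprod_induct)
      case (mult i j)
      then obtain b where "b \<in> \<O>" "i = a * b" unfolding principal_ideal_def by blast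
      moreover from this have "b * j \<in> I" using submodule\<^sub>O_mult[OF I, of b j] mult by simp
      ultimately show ?case by (simp only: mult.assoc imageI)
    next
      case (add x y)
      then show ?case using submodule\<^sub>O_add[OF submodule\<^sub>O_image_mult[OF I]] by blast
    qed
  }
  fix x assume "x \<in> (*) a ` I"
  moreover have "a \<in> principal_ideal a" unfolding principal_ideal_def by (rule image_eqI[of _ _ 1]) auto
  ultimately show "x \<in> iprod (principal_ideal a) I" by (auto intro: iprod_mult)
qed

lemma principal_ideal_1: "principal_ideal 1 = \<O>"
  by (simp add: principal_ideal_def)

lemma iprod_\<O>: "submodule\<^sub>O I \<Longrightarrow> iprod \<O> I = I"
  using iprod_principal[of I 1] by (simp add: principal_ideal_1)

lemma mem_principal_ideal: "a \<noteq> 0 \<Longrightarrow> x \<in> principal_ideal a \<longleftrightarrow> algebraic_int (x / a)"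
  by (auto simp: principal_ideal_def image_iff intro!: bexI[of _ "x / a"])

lemma submodule\<^sub>O_principal: "submodule\<^sub>O (principal_ideal a)"
  unfolding principal_ideal_def by (intro submodule\<^sub>O_image_mult submodule\<^sub>O_\<O>)

lemma self_mem_principal [simp]: "a \<in> principal_ideal a"
  unfolding principal_ideal_def by (rule image_eqI[of _ _ 1]) auto

lemma principal_subset: "submodule\<^sub>O I \<Longrightarrow> a \<in> I \<Longrightarrow> principal_ideal a \<subseteq> I"
  by (auto simp: principal_ideal_def mult.commute[of a] submodule\<^sub>O_mult)

lemma ideal_group_simps [simp]:
  "carrier ideal_group = fractional_ideals"
  "monoid.mult ideal_group = iprod"
  "monoid.one ideal_group = \<O>"
  by (simp_all add: ideal_group_def)

lemma comm_monoid_ideal_group: "comm_monoid (ideal_group :: 'a::field_char_0 set monoid)"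
proof (rule comm_monoidI)
  fix I :: "'a set" assume "I \<in> carrier ideal_group"
  then show "\<one>\<^bsub>ideal_group\<^esub> \<otimes>\<^bsub>ideal_group\<^esub> I = I"
    by (simp add: iprod_\<O> fractional_ideal_submodule)
next
  show "I \<otimes>\<^bsub>ideal_group\<^esub> J = J \<otimes>\<^bsub>ideal_group\<^esub> I" for I J :: "'a set"
    by (simp only: ideal_group_simps iprod_commute)
qed (simp_all add: iprod_fractional fractional_ideals_\<O> iprod_assoc)

interpretation IG: comm_monoid "ideal_group :: 'a::field_char_0 set monoid"
  by (rule comm_monoid_ideal_group)

context cyclic_field
begin

lemma conj_surj: "\<exists>b. a = conj i b"
proof -
  have "i mod p \<le> p" using p_gt_2 by (simp add: less_imp_le)
  then have "conj (i mod p) (conj (p - i mod p) a) = a" by (rule conj_inverse_right)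
  then show ?thesis by (metis conj_mod)
qed

lemma conj_image_submodule: "submodule\<^sub>O I \<Longrightarrow> submodule\<^sub>O (conj i ` I)"
  unfolding submodule\<^sub>O_def
proof (intro conjI ballI allI impI)
  assume I: "0 \<in> I \<and> (\<forall>x\<in>I. \<forall>y\<in>I. x + y \<in> I) \<and> (\<forall>a x. algebraic_int a \<longrightarrow> x \<in> I \<longrightarrow> a * x \<in> I)"
  then show "0 \<in> conj i ` I" by (intro image_eqI[of _ _ 0]) auto
  show "x + y \<in> conj i ` I" if "x \<in> conj i ` I" "y \<in> conj i ` I" for x y
    using that I by (auto simp flip: conj_add)
  fix a x :: 'L assume a: "algebraic_int a" and x: "x \<in> conj i ` I"
  obtain b where b: "a = conj i b"
    using conj_surj by blast
  with a x I show "a * x \<in> conj i ` I" by (auto simp flip: conj_mult)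
qed

lemma conj_image_\<O>: "conj i ` I \<subseteq> \<O> \<longleftrightarrow> I \<subseteq> \<O>"
  by (auto simp: subset_iff)

lemma conj_image_mult: "conj i ` ((*) a ` I) = (*) (conj i a) ` (conj i ` I)"
  by (simp add: image_image)

lemma conj_image_principal: "conj i ` principal_ideal a = principal_ideal (conj i a)"
proof -
  have "conj i ` (\<O> :: 'L set) = \<O>"
  proof
    show "\<O> \<subseteq> conj i ` (\<O> :: 'L set)"
    proof
      fix a :: 'L assume "a \<in> \<O>"
      moreover obtain b where "a = conj i b"
        using conj_surj by blast
      ultimately show "a \<in> conj i ` \<O>" by simp
    qed
  qed auto
  then show ?thesis by (simp only: principal_ideal_def conj_image_mult)
qed

lemma conj_image_fractional: "I \<in> fractional_ideals \<Longrightarrow> conj i ` I \<in> fractional_ideals"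
proof -
  assume I: "I \<in> fractional_ideals"
  obtain d where d: "algebraic_int d" "d \<noteq> 0" "(*) d ` I \<subseteq> \<O>"
    using I by (auto simp: fractional_ideals_iff)
  obtain x where "x \<in> I" "x \<noteq> 0" using fractional_ideal_nonzero[OF I] by blast
  then have "conj i x \<in> conj i ` I" "conj i x \<noteq> 0" by simp_all
  then have "conj i ` I \<noteq> {0}" by (metis singletonD)
  moreover have "(*) (conj i d) ` (conj i ` I) \<subseteq> \<O>"
    using d(3) by (simp only: conj_image_mult[symmetric] conj_image_\<O>)
  ultimately show ?thesis
    unfolding fractional_ideals_iff
    using conj_image_submodule[OF fractional_ideal_submodule[OF I]] d
    by (auto intro!: exI[of _ "conj i d"])
qed

lemma conj_image_iprod: "conj i ` iprod I J = iprod (conj i ` I) (conj i ` J)"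
proof (intro equalityI subsetI)
  fix x assume "x \<in> conj i ` iprod I J"
  then obtain y where "x = conj i y" "y \<in> iprod I J" by blast
  from this(2) show "x \<in> iprod (conj i ` I) (conj i ` J)"
    unfolding \<open>x = conj i y\<close> by (induction rule: iprod_induct) (auto intro: iprod_mult iprod_add)
next
  fix x assume "x \<in> iprod (conj i ` I) (conj i ` J)"
  then show "x \<in> conj i ` iprod I J"
    by (induction rule: iprod_induct) (auto simp flip: conj_mult conj_add intro: iprod_mult iprod_add)
qed

lemma principal_fractional:
  assumes "a \<noteq> (0 :: 'L)"
  shows "principal_ideal a \<in> fractional_ideals"
proof -
  obtain n :: nat where n: "n > 0" "algebraic_int (of_nat n * a)" by (rule multiple_algebraic_int)
  have "(*) (of_nat n) ` principal_ideal a \<subseteq> \<O>"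
    using n(2) by (auto simp: principal_ideal_def mult.assoc[symmetric] intro: algebraic_int_mult)
  moreover have "principal_ideal a \<noteq> {0}" using self_mem_principal[of a] assms by (metis singletonD)
  ultimately show ?thesis
    using n(1) by (auto simp: fractional_ideals_iff submodule\<^sub>O_principal intro!: exI[of _ "of_nat n"])
qed

lemma mult_image_fractional: "I \<in> fractional_ideals \<Longrightarrow> a \<noteq> 0 \<Longrightarrow> (*) a ` I \<in> fractional_ideals" for a :: 'L
  using iprod_fractional[OF principal_fractional[of a], of I]
  by (simp add: iprod_principal fractional_ideal_submodule)

subsection \<open>The norm of an ideal\<close>

lemma finprod_fractional:
  "(\<And>i. i \<in> A \<Longrightarrow> I i \<in> fractional_ideals) \<Longrightarrow> finprod ideal_group I A \<in> fractional_ideals"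
  using IG.finprod_closed[of I A] by (simp add: Pi_def)

lemma finprod_coeff_mem:
  assumes "finite A" "\<And>i. i \<in> A \<Longrightarrow> I i \<in> fractional_ideals" "\<And>i k. i \<in> A \<Longrightarrow> coeff (f i) k \<in> I i"
  shows "coeff (prod f A) k \<in> finprod ideal_group I A"
  using assms
proof (induction A arbitrary: k rule: finite_induct)
  case empty
  show ?case by (simp add: coeff_1)
next
  case (insert a A)
  have "submodule\<^sub>O (finprod ideal_group I (insert a A))"
    using insert by (intro fractional_ideal_submodule finprod_fractional) auto
  moreover have "finprod ideal_group I (insert a A) = iprod (I a) (finprod ideal_group I A)"
    using insert by (simp add: IG.finprod_insert Pi_def)
  ultimately show ?case
    using insert by (auto simp: coeff_mult intro!: submodule\<^sub>O_sum iprod_mult)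
qed

text \<open>\<open>K\<close> is additive, so membership may be tested on products of one element
  from each factor; \<open>c\<close> holds the elements already chosen in the induction.\<close>

lemma finprod_subset:
  assumes "finite A" "\<And>i. i \<in> A \<Longrightarrow> I i \<in> fractional_ideals" "submodule\<^sub>O K"
    "\<And>x. (\<And>i. i \<in> A \<Longrightarrow> x i \<in> I i) \<Longrightarrow> c * prod x A \<in> K" "b \<in> finprod ideal_group I A"
  shows "c * b \<in> K"
  using assms
proof (induction A arbitrary: b c rule: finite_induct)
  case empty
  then show ?case using submodule\<^sub>O_mult[OF empty(2), of b c] by (simp add: mult.commute)
next
  case (insert a A)
  have "b \<in> iprod (I a) (finprod ideal_group I A)"
    using insert by (simp add: IG.finprod_insert Pi_def)
  then show ?case
  proof (induction rule: iprod_induct)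
    case (mult i j)
    have "(c * i) * j \<in> K"
    proof (rule insert.IH)
      fix x assume x: "\<And>k. k \<in> A \<Longrightarrow> x k \<in> I k"
      have "c * prod (x(a := i)) (insert a A) \<in> K"
        using x mult(1) insert.hyps by (intro insert.prems(3)) auto
      moreover have "prod (x(a := i)) A = prod x A" using insert.hyps by (intro prod.cong) auto
      ultimately show "c * i * prod x A \<in> K" using insert.hyps by (simp add: mult.assoc)
    qed (use insert mult in auto)
    then show ?case by (simp add: mult.assoc)
  qed (simp add: distrib_left submodule\<^sub>O_add[OF insert.prems(2)])
qed

lemma integral_ideal_has_positive_integer:
  assumes "submodule\<^sub>O I" "I \<subseteq> (\<O> :: 'L set)" "x \<in> I" "x \<noteq> 0"
  shows "\<exists>n>0. (of_nat n :: 'L) \<in> I"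
proof -
  have x: "algebraic_int x" using assms(2,3) by auto
  obtain y where y: "algebraic_int y" "Nm x = x * y" using Nm_cofactor[OF x] by blast
  obtain k where k: "Nm x = of_int k" using Nm_Ints[OF x] by (auto elim!: Ints_cases)
  have "of_int k \<in> I" using submodule\<^sub>O_mult[OF assms(1) y(1) assms(3)] k y(2) by (simp add: mult.commute)
  then have "of_int \<bar>k\<bar> \<in> I" using submodule\<^sub>O_uminus[OF assms(1), of "of_int k"] by (simp add: abs_if)
  moreover have "k \<noteq> 0" using k assms(4) by (metis Nm_eq_0_iff of_int_0)
  moreover have "(of_nat (nat \<bar>k\<bar>) :: 'L) = of_int \<bar>k\<bar>" by simp
  ultimately show ?thesis by (metis zero_less_abs_iff zero_less_nat_eq)
qed

text \<open>If \<open>n\<close> is the least positive integer in \<open>B = \<Prod>\<^sub>i \<sigma>\<^sup>i I\<close>, then \<open>B \<inter> \<int> = n\<int>\<close>. For \<open>y\<^sub>k \<in> I\<close> the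
  polynomial \<open>\<Prod>\<^sub>i \<sigma>\<^sup>i(\<Sum>\<^sub>k y\<^sub>k X\<^sup>k)\<close> has coefficients in \<open>B \<inter> \<int>\<close>, and the Prague theorem shows that
  \<open>n\<close> divides \<open>\<Prod>\<^sub>i \<sigma>\<^sup>i y\<^sub>i\<close>.\<close>

lemma ideal_norm:
  fixes I :: "'L set"
  assumes I: "I \<in> fractional_ideals" "I \<subseteq> \<O>"
  obtains n :: nat where "n > 0"
    "finprod ideal_group (\<lambda>i. conj i ` I) {..<p} = principal_ideal (of_nat n)"
proof -
  define B where "B = finprod ideal_group (\<lambda>i. conj i ` I) {..<p}"
  have frac: "conj i ` I \<in> fractional_ideals" for i by (rule conj_image_fractional[OF I(1)])
  have B: "B \<in> fractional_ideals" unfolding B_def by (rule finprod_fractional[OF frac])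
  note subB = fractional_ideal_submodule[OF B]
  have "1 * b \<in> (\<O> :: 'L set)" if b: "b \<in> B" for b
  proof (rule finprod_subset[where A = "{..<p}" and I = "\<lambda>i. conj i ` I"])
    show "b \<in> finprod ideal_group (\<lambda>i. conj i ` I) {..<p}" using b by (simp only: B_def)
    fix x :: "nat \<Rightarrow> 'L" assume x: "\<And>i. i \<in> {..<p} \<Longrightarrow> x i \<in> conj i ` I"
    have "algebraic_int (x i)" if "i < p" for i
      using x[of i] that I(2) by auto
    then have "algebraic_int (prod x {..<p})" by (intro algebraic_int_prod) simp
    then show "1 * prod x {..<p} \<in> \<O>" by simp
  qed (simp_all add: frac submodule\<^sub>O_\<O>)
  then have BO: "B \<subseteq> \<O>" by auto
  obtain x where "x \<in> B" "x \<noteq> 0" using fractional_ideal_nonzero[OF B] by blast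
  then have ex: "\<exists>n>0. (of_nat n :: 'L) \<in> B" by (rule integral_ideal_has_positive_integer[OF subB BO])
  define n where "n = (LEAST n. n > 0 \<and> (of_nat n :: 'L) \<in> B)"
  have n: "n > 0" "of_nat n \<in> B" using LeastI_ex[OF ex] by (auto simp: n_def)
  have least: "n \<le> m" if "m > 0" "of_nat m \<in> B" for m
    unfolding n_def using that by (intro Least_le) simp
  have dvd: "int n dvd k" if "(of_int k :: 'L) \<in> B" for k
  proof (rule ccontr)
    assume "\<not> int n dvd k"
    then have "k mod int n \<noteq> 0" by (simp add: dvd_eq_mod_eq_0)
    then have pos: "k mod int n > 0" using n(1) pos_mod_sign[of "int n" k] by linarith
    have "of_int k - of_int (k div int n) * of_nat n \<in> B"
      by (intro submodule\<^sub>O_diff[OF subB] submodule\<^sub>O_mult[OF subB] that n) simp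
    also have "of_int k - of_int (k div int n) * of_nat n = (of_int (k - k div int n * int n) :: 'L)" by simp
    also have "k - k div int n * int n = k mod int n" by (simp add: minus_div_mult_eq_mod)
    also have "(of_int (k mod int n) :: 'L) = of_nat (nat (k mod int n))" using pos by simp
    finally have "n \<le> nat (k mod int n)" using pos by (intro least) simp_all
    then show False using pos n(1) pos_mod_bound[of "int n" k] by linarith
  qed
  have "1 * b \<in> principal_ideal (of_nat n)" if "b \<in> B" for b :: 'L
  proof (rule finprod_subset[where A = "{..<p}" and I = "\<lambda>i. conj i ` I"])
    show "b \<in> finprod ideal_group (\<lambda>i. conj i ` I) {..<p}" using that by (simp only: B_def)
    fix x :: "nat \<Rightarrow> 'L" assume x: "\<And>i. i \<in> {..<p} \<Longrightarrow> x i \<in> conj i ` I"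
    then have "\<forall>i\<in>{..<p}. \<exists>y\<in>I. x i = conj i y" by blast
    then obtain y where y: "\<And>i. i < p \<Longrightarrow> y i \<in> I \<and> x i = conj i (y i)" by (metis lessThan_iff)
    define f where "f i = (\<Sum>k<p. monom (conj i (y k)) k)" for i
    have coeff: "coeff (f i) k = (if k < p then conj i (y k) else 0)" for i k
      by (simp add: f_def coeff_sum)
    define F where "F = (\<Prod>i<p. f i)"
    have FB: "coeff F k \<in> B" for k
      unfolding F_def B_def
      using y submodule\<^sub>O_0[OF fractional_ideal_submodule[OF frac]]
      by (intro finprod_coeff_mem frac) (auto simp: coeff)
    have map: "map_poly \<sigma> (f i) = f (i + 1)" for i
      by (intro poly_eqI) (simp add: coeff_map_poly coeff)
    have "map_poly \<sigma> (prod f A) = (\<Prod>i\<in>A. f (i + 1))" for A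
      by (induction A rule: infinite_finite_induct) (simp_all add: map_poly_\<sigma>_mult map map_poly_1')
    then have "map_poly \<sigma> F = (\<Prod>i<p. f (i + 1))" by (simp add: F_def)
    also have "\<dots> = F"
    proof -
      \<comment> \<open>Reducing the index modulo \<open>p\<close> does not change
        \<open>f i\<close>, so \<open>\<sigma>\<close> only permutes the factors of \<open>F\<close>
        and its coefficients are rational.\<close>
      have "f (i mod p) = f i" for i by (intro poly_eqI) (simp add: coeff conj_mod)
      then show ?thesis
        using prod.reindex_bij_betw[OF rotate_bij, of f 1] by (simp add: F_def)
    qed
    finally have "\<sigma> (coeff F k) = coeff F k" for k by (metis coeff_map_poly \<sigma>_simps(1))
    then have "coeff F k \<in> \<int>" for k
      using FB[of k] BO by (intro rational_algebraic_int_is_int \<sigma>_fixed) auto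
    then have "\<exists>z. coeff F k = of_int z" for k by (auto elim!: Ints_cases)
    then have "\<exists>z. coeff F k = of_nat n * of_int z" for k
      using dvd FB by (metis dvdE of_int_mult of_int_of_nat_eq)
    then obtain z where z: "\<And>k. coeff F k = of_nat n * of_int (z k)" by metis
    have "algebraic_int (inverse (of_nat n) * coeff F k)" for k
      unfolding z using n(1) by (simp add: mult.assoc[symmetric])
    then have "integral_poly (smult (inverse (of_nat n)) (\<Prod>i<p. f i))"
      by (simp add: integral_poly_def F_def)
    from integral_poly_prod_coeffs[OF _ this, of "\<lambda>i. i"]
    have "algebraic_int (inverse (of_nat n) * (\<Prod>i<p. coeff (f i) i))" by simp
    also have "(\<Prod>i<p. coeff (f i) i) = prod x {..<p}"
      using y by (intro prod.cong) (auto simp: coeff)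
    finally show "1 * prod x {..<p} \<in> principal_ideal (of_nat n)"
      using n(1) by (simp add: mem_principal_ideal divide_inverse mult.commute)
  qed (simp_all add: frac submodule\<^sub>O_principal)
  moreover have "principal_ideal (of_nat n) \<subseteq> B" by (rule principal_subset[OF subB n(2)])
  ultimately have "B = principal_ideal (of_nat n)" by auto
  with n(1) show thesis using that by (simp add: B_def)
qed

text \<open>Clear the denominator to get \<open>I' = d I\<close>. The product \<open>C\<close> of
  the other conjugates of \<open>I'\<close> satisfies \<open>I' C = (n)\<close>, so
  \<open>(d / n) C\<close> is the inverse.\<close>

lemma fractional_ideal_inverse:
  assumes "I \<in> fractional_ideals"
  shows "\<exists>J\<in>fractional_ideals. iprod J I = (\<O> :: 'L set)"
proof -
  obtain d where d: "algebraic_int d" "d \<noteq> 0" "(*) d ` I \<subseteq> \<O>"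
    using assms by (auto simp: fractional_ideals_iff)
  define I' where "I' = (*) d ` I"
  have I': "I' \<in> fractional_ideals" unfolding I'_def by (rule mult_image_fractional[OF assms d(2)])
  obtain n :: nat where n: "n > 0"
    "finprod ideal_group (\<lambda>i. conj i ` I') {..<p} = principal_ideal (of_nat n)"
    using ideal_norm[OF I'] d(3) by (auto simp: I'_def)
  define C where "C = finprod ideal_group (\<lambda>i. conj i ` I') {1..<p}"
  have frac: "conj i ` I' \<in> fractional_ideals" for i by (rule conj_image_fractional[OF I'])
  have C: "C \<in> fractional_ideals" unfolding C_def by (rule finprod_fractional[OF frac])
  have "{..<p} = insert 0 {1..<p}" using p_gt_2 by auto
  then have "finprod ideal_group (\<lambda>i. conj i ` I') {..<p} = iprod I' C"
    unfolding C_def using frac by (simp add: IG.finprod_insert Pi_def I')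
  with n(2) have IC: "iprod I' C = principal_ideal (of_nat n)" by simp
  define c where "c = d / of_nat n"
  have c: "c \<noteq> 0" using d(2) n(1) by (simp add: c_def)
  define J where "J = (*) c ` C"
  have J: "J \<in> fractional_ideals" unfolding J_def by (rule mult_image_fractional[OF C c])
  note sub = fractional_ideal_submodule
  have "iprod J I = iprod (iprod (principal_ideal c) C) I"
    by (simp add: J_def iprod_principal sub[OF C])
  also have "\<dots> = iprod (principal_ideal c) (iprod I C)"
    by (simp only: iprod_assoc iprod_commute[of C I])
  also have "\<dots> = (*) c ` iprod I C"
    by (intro iprod_principal submodule\<^sub>O_iprod sub assms C)
  also have "\<dots> = (*) (inverse (of_nat n)) ` (*) d ` iprod I C"
    by (simp add: image_image c_def divide_inverse mult_ac)
  also have "(*) d ` iprod I C = iprod (principal_ideal d) (iprod I C)"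
    by (intro iprod_principal[symmetric] submodule\<^sub>O_iprod sub assms C)
  also have "\<dots> = iprod I' C"
    by (simp add: iprod_assoc[symmetric] iprod_principal sub[OF assms] I'_def)
  also have "(*) (inverse (of_nat n)) ` iprod I' C = (\<O> :: 'L set)"
    unfolding IC principal_ideal_def image_image using n(1) by (simp add: mult.assoc[symmetric])
  finally show ?thesis using J by blast
qed

lemma comm_group_ideal_group: "comm_group (ideal_group :: 'L set monoid)"
proof (rule comm_groupI)
  show "I \<otimes>\<^bsub>ideal_group\<^esub> J = J \<otimes>\<^bsub>ideal_group\<^esub> I" for I J :: "'L set"
    by (simp only: ideal_group_simps iprod_commute)
qed (simp_all add: iprod_fractional fractional_ideals_\<O> iprod_assoc iprod_\<O>
       fractional_ideal_submodule fractional_ideal_inverse)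

sublocale G: comm_group "ideal_group :: 'L set monoid"
  by (rule comm_group_ideal_group)


section \<open>Prime ideals\<close>

abbreviation \<F> :: "'L set set" where "\<F> \<equiv> fractional_ideals"
abbreviation ipow :: "'L set \<Rightarrow> nat \<Rightarrow> 'L set" where "ipow I n \<equiv> I [^]\<^bsub>ideal_group\<^esub> n"
abbreviation izpow :: "'L set \<Rightarrow> int \<Rightarrow> 'L set" where "izpow I n \<equiv> I [^]\<^bsub>ideal_group\<^esub> n"
abbreviation iinv :: "'L set \<Rightarrow> 'L set" where "iinv I \<equiv> inv\<^bsub>ideal_group\<^esub> I"
abbreviation ifinprod :: "('i \<Rightarrow> 'L set) \<Rightarrow> 'i set \<Rightarrow> 'L set" where
  "ifinprod \<equiv> finprod ideal_group"

lemma iinv_fractional: "I \<in> \<F> \<Longrightarrow> iinv I \<in> \<F>"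
  and iprod_iinv: "I \<in> \<F> \<Longrightarrow> iprod (iinv I) I = \<O>"
  using G.inv_closed[of I] G.l_inv[of I] by simp_all

lemma ipow_fractional: "I \<in> \<F> \<Longrightarrow> ipow I n \<in> \<F>"
  and izpow_fractional: "I \<in> \<F> \<Longrightarrow> izpow I k \<in> \<F>"
  using IG.nat_pow_closed[of I n] G.int_pow_closed[of I k] by simp_all

lemma iprod_\<O>_right: "I \<in> \<F> \<Longrightarrow> iprod I \<O> = I"
  and iprod_\<O>_left: "I \<in> \<F> \<Longrightarrow> iprod \<O> I = I"
  using iprod_\<O>[OF fractional_ideal_submodule, of I] by (simp_all add: iprod_commute[of I])

lemma iprod_cancel:
  assumes "I \<in> \<F>" "J \<in> \<F>" "K \<in> \<F>" "iprod I J \<subseteq> iprod I K"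
  shows "J \<subseteq> K"
proof -
  have "iprod (iinv I) (iprod I J) \<subseteq> iprod (iinv I) (iprod I K)"
    by (intro iprod_mono assms(4)) simp
  then show ?thesis
    by (simp add: iprod_assoc[symmetric] iprod_iinv iprod_\<O>_left assms)
qed

text \<open>Cancel \<open>K\<close>. In this way splitting off a proper factor is seen to enlarge an
  ideal strictly, which drives the inductions.\<close>

lemma iprod_absorb: "K \<in> \<F> \<Longrightarrow> I \<in> \<F> \<Longrightarrow> K \<subseteq> iprod I K \<Longrightarrow> \<O> \<subseteq> I"
  using iprod_cancel[OF _ fractional_ideals_\<O>, of K I] by (simp add: iprod_\<O>_right iprod_commute[of K I])

text \<open>To contain is to divide: the quotient is the inverse of \<open>J\<close> times
  \<open>I\<close>.\<close>

lemma ideal_dvd: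
  assumes "I \<in> \<F>" "J \<in> \<F>" "I \<subseteq> J"
  obtains K where "K \<in> \<F>" "K \<subseteq> \<O>" "I = iprod J K"
proof (rule that)
  show "iprod (iinv J) I \<in> \<F>" by (intro iprod_fractional iinv_fractional assms)
  have "iprod (iinv J) I \<subseteq> iprod (iinv J) J" by (intro iprod_mono assms) simp
  then show "iprod (iinv J) I \<subseteq> \<O>" by (simp add: iprod_iinv assms)
  show "I = iprod J (iprod (iinv J) I)"
    by (simp add: iprod_assoc[symmetric] iprod_commute[of J] iprod_iinv iprod_\<O>_left assms)
qed

lemma integral_1_mem: "I \<in> \<F> \<Longrightarrow> I \<subseteq> \<O> \<Longrightarrow> 1 \<in> I \<Longrightarrow> I = \<O>"
  using submodule\<^sub>O_mult[OF fractional_ideal_submodule, of I _ 1] by auto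

lemma iprod_subset_left: "I \<in> \<F> \<Longrightarrow> J \<subseteq> \<O> \<Longrightarrow> iprod I J \<subseteq> I"
  using iprod_mono[of I I J \<O>] by (simp add: iprod_\<O>_right)

lemma iprod_integral: "I \<in> \<F> \<Longrightarrow> I \<subseteq> \<O> \<Longrightarrow> J \<subseteq> \<O> \<Longrightarrow> iprod I J \<subseteq> \<O>"
  using iprod_subset_left[of I J] by blast

lemma principal_mult:
  "iprod (principal_ideal a) (principal_ideal b) = principal_ideal (a * b :: 'L)"
  by (simp add: iprod_principal submodule\<^sub>O_principal)
     (simp add: principal_ideal_def image_image mult.assoc)

lemma principal_pow: "a \<noteq> 0 \<Longrightarrow> ipow (principal_ideal a) n = principal_ideal (a ^ n)"
  by (induction n) (simp_all add: principal_ideal_1 principal_mult mult.commute)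

lemma principal_izpow:
  assumes a: "a \<noteq> 0"
  shows "izpow (principal_ideal a) k = principal_ideal (a powi k)"
proof (cases k rule: int_cases2)
  case (nonneg n)
  then show ?thesis using principal_pow[OF a] by (simp add: int_pow_int)
next
  case (nonpos n)
  have "iprod (principal_ideal (inverse (a ^ n))) (principal_ideal (a ^ n)) = \<O>"
    unfolding principal_mult using a by (simp add: principal_ideal_1)
  then have "iinv (principal_ideal (a ^ n)) = principal_ideal (inverse (a ^ n))"
    using a by (intro G.inv_equality) (simp_all add: principal_fractional)
  then show ?thesis
    using nonpos a principal_pow[OF a]
    by (simp add: G.int_pow_neg_int principal_fractional power_int_minus)
qed

lemma principal_integral: "algebraic_int a \<Longrightarrow> principal_ideal a \<subseteq> \<O>" for a :: 'L
  by (auto simp: principal_ideal_def intro: algebraic_int_mult)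

lemma principal_finprod:
  assumes "finite A" "\<And>i. i \<in> A \<Longrightarrow> a i \<noteq> 0"
  shows "ifinprod (\<lambda>i. principal_ideal (a i)) A = principal_ideal (prod a A)"
  using assms
  by (induction A rule: finite_induct)
     (simp_all add: principal_ideal_1 IG.finprod_insert Pi_def principal_fractional principal_mult)

lemma conj_image_ipow:
  assumes "I \<in> \<F>"
  shows "conj i ` ipow I n = ipow (conj i ` I) n"
proof (induction n)
  case 0
  show ?case using conj_image_principal[of i 1] by (simp add: principal_ideal_1)
qed (simp add: conj_image_iprod)

lemma conj_image_eq_iff: "conj i ` I = conj i ` J \<longleftrightarrow> I = J"
  by (rule inj_image_eq_iff[OF conj_inj])

lemma principal_nat_invariant: "\<sigma> ` principal_ideal (of_nat m) = principal_ideal (of_nat m)"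
  using conj_image_principal[of 1 "of_nat m"] conj_of_nat[of 1 m] by simp

lemma conj_image_invariant: "\<sigma> ` I = I \<Longrightarrow> conj i ` I = I"
  by (induction i) (simp_all only: funpow.simps image_comp[symmetric] image_id id_apply)

section \<open>Nonzero prime ideals\<close>

definition prime_id :: "'L set \<Rightarrow> bool" where
  "prime_id P \<longleftrightarrow> P \<in> \<F> \<and> P \<subseteq> \<O> \<and> 1 \<notin> P \<and>
     (\<forall>x y. algebraic_int x \<longrightarrow> algebraic_int y \<longrightarrow> x * y \<in> P \<longrightarrow> x \<in> P \<or> y \<in> P)"

lemma prime_idD:
  assumes "prime_id P"
  shows "P \<in> \<F>" "P \<subseteq> \<O>" "1 \<notin> P" "submodule\<^sub>O P"
    "algebraic_int x \<Longrightarrow> algebraic_int y \<Longrightarrow> x * y \<in> P \<Longrightarrow> x \<in> P \<or> y \<in> P"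
  using assms fractional_ideal_submodule[of P] by (auto simp: prime_id_def)

lemma primeideal_iff: "primeideal P ring_of_integers \<and> P \<noteq> {0} \<longleftrightarrow> prime_id P"
proof
  assume P: "primeideal P ring_of_integers \<and> P \<noteq> {0}"
  then interpret primeideal P "ring_of_integers :: 'L ring" by simp
  have sub: "submodule\<^sub>O P" "P \<subseteq> \<O>"
    using is_ideal by (simp_all add: ideal_ring_of_integers_iff)
  obtain x where "x \<in> P" "x \<noteq> 0" using P submodule\<^sub>O_0[OF sub(1)] by blast
  then have frac: "P \<in> \<F>" by (intro fractional_ideals_integral[OF sub(2,1)])
  then have "1 \<notin> P" using integral_1_mem[OF frac sub(2)] I_notcarr by blast
  then show "prime_id P" using frac sub I_prime by (auto simp: prime_id_def)
next
  assume P: "prime_id P"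
  note P = prime_idD[OF P]
  have "primeideal P ring_of_integers"
  proof (rule primeidealI)
    show "\<O> \<noteq> P" using P(3) by auto
  qed (use P in \<open>auto simp: ideal_ring_of_integers_iff cring_ring_of_integers\<close>)
  then show "primeideal P ring_of_integers \<and> P \<noteq> {0}"
    using fractional_ideal_nonzero[OF P(1)] by blast
qed

lemma prime_not_above: "prime_id P \<Longrightarrow> \<not> \<O> \<subseteq> P"
  using prime_idD(3)[of P] mem_\<O>[of "1 :: 'L"] by blast

lemma prime_iprod:
  assumes P: "prime_id P" and "I \<subseteq> \<O>" "J \<subseteq> \<O>" "iprod I J \<subseteq> P"
  shows "I \<subseteq> P \<or> J \<subseteq> P"
proof (rule ccontr)
  assume "\<not> ?thesis"
  then obtain x y where xy: "x \<in> I" "x \<notin> P" "y \<in> J" "y \<notin> P" by blast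
  then have "x * y \<in> P" using iprod_mult[of x I y J] assms(4) by blast
  moreover have "x \<in> \<O>" "y \<in> \<O>" using xy assms(2,3) by blast+
  ultimately show False using prime_idD(5)[OF P, of x y] xy by simp
qed

text \<open>Invertibility gives dimension one: write \<open>P = Q K\<close>; then
  \<open>Q \<subseteq> P\<close> or \<open>K \<subseteq> P\<close>, and the latter would mean
  \<open>K \<subseteq> Q K\<close>, hence \<open>\<O> \<subseteq> Q\<close>.\<close>

lemma prime_maximal:
  assumes P: "prime_id P" and Q: "prime_id Q" and "P \<subseteq> Q"
  shows "P = Q"
proof -
  note PD = prime_idD[OF P] and QD = prime_idD[OF Q]
  obtain K where K: "K \<in> \<F>" "K \<subseteq> \<O>" "P = iprod Q K"
    using ideal_dvd[OF PD(1) QD(1) assms(3)] by blast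
  have "Q \<subseteq> P \<or> K \<subseteq> P" using prime_iprod[OF P QD(2) K(2)] K(3) by simp
  moreover have "\<not> K \<subseteq> P"
  proof
    assume "K \<subseteq> P"
    then have "\<O> \<subseteq> Q" using iprod_absorb[OF K(1) QD(1)] K(3) by simp
    then show False using prime_not_above[OF Q] by simp
  qed
  ultimately show ?thesis using assms(3) by blast
qed

text \<open>\<open>I\<close> contains a positive integer \<open>n\<close>, so an integral ideal
  above \<open>I\<close> is a union of classes modulo \<open>n\<close> and is determined by its set
  of residues. This finiteness serves as the Noetherian property.\<close>

lemma finite_ideals_above:
  assumes "I \<in> \<F>" "I \<subseteq> \<O>"
  shows "finite {K. submodule\<^sub>O K \<and> I \<subseteq> K \<and> K \<subseteq> \<O>}" (is "finite ?S")
proof -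
  obtain x where x: "x \<in> I" "x \<noteq> 0" using fractional_ideal_nonzero[OF assms(1)] by blast
  then obtain n :: nat where n: "n > 0" "of_nat n \<in> I"
    using integral_ideal_has_positive_integer[OF fractional_ideal_submodule[OF assms(1)] assms(2)] by blast
  obtain f :: "'L \<Rightarrow> nat \<Rightarrow> int" where f: "finite (f ` {x. algebraic_int x})"
    "\<And>x y. algebraic_int x \<Longrightarrow> algebraic_int y \<Longrightarrow> f x = f y
      \<Longrightarrow> \<exists>w. algebraic_int w \<and> x - y = of_int (int n) * w"
    by (rule finite_residues[of "int n"]) (use n(1) in simp, blast)
  have sub: "K \<subseteq> K'" if K: "K \<in> ?S" "K' \<in> ?S" "f ` K = f ` K'" for K K'
  proof
    fix x assume x: "x \<in> K"
    then obtain y where y: "y \<in> K'" "f x = f y" using K(3) by (metis imageE imageI)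
    have "algebraic_int x" "algebraic_int y" using x y(1) K(1,2) by auto
    then obtain w where w: "algebraic_int w" "x - y = of_int (int n) * w" using f(2) y(2) by blast
    have "w * of_nat n \<in> K'" using K(2) n(2) by (intro submodule\<^sub>O_mult w) auto
    then have "y + (x - y) \<in> K'" using K(2) y(1) w(2) by (intro submodule\<^sub>O_add) (auto simp: mult.commute)
    then show "x \<in> K'" by simp
  qed
  have "inj_on ((`) f) ?S"
  proof (rule inj_onI)
    fix K K' assume K: "K \<in> ?S" "K' \<in> ?S" "f ` K = f ` K'"
    show "K = K'" by (rule subset_antisym[OF sub[OF K] sub[OF K(2,1) K(3)[symmetric]]])
  qed
  moreover have "(`) f ` ?S \<subseteq> Pow (f ` {x. algebraic_int x})" by auto
  then have "finite ((`) f ` ?S)" using f(1) by (rule finite_subset[OF _ finite_Pow_iff[THEN iffD2]])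
  ultimately show ?thesis by (rule finite_imageD[rotated])
qed

lemma ideal_induct [consumes 2, case_names step]:
  assumes "J \<in> \<F>" "J \<subseteq> \<O>"
    and "\<And>J. J \<in> \<F> \<Longrightarrow> J \<subseteq> \<O> \<Longrightarrow> (\<And>K. K \<in> \<F> \<Longrightarrow> K \<subseteq> \<O> \<Longrightarrow> J \<subset> K \<Longrightarrow> Q K) \<Longrightarrow> Q J"
  shows "Q J"
  using assms(1,2)
proof (induction "card {K. submodule\<^sub>O K \<and> J \<subseteq> K \<and> K \<subseteq> \<O>}" arbitrary: J rule: less_induct)
  case less
  show ?case
  proof (rule assms(3)[OF less.prems])
    fix K assume K: "K \<in> \<F>" "K \<subseteq> \<O>" "J \<subset> K"
    have "{K'. submodule\<^sub>O K' \<and> K \<subseteq> K' \<and> K' \<subseteq> \<O>} \<subset> {K. submodule\<^sub>O K \<and> J \<subseteq> K \<and> K \<subseteq> \<O>}"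
      using K(3) fractional_ideal_submodule[OF less.prems(1)] less.prems(2) by blast
    then show "Q K"
      by (intro less.hyps[OF _ K(1,2)] psubset_card_mono finite_ideals_above less.prems)
  qed
qed

lemma exists_prime_above:
  assumes "J \<in> \<F>" "J \<subseteq> \<O>" "1 \<notin> J"
  obtains P where "prime_id P" "J \<subseteq> P"
proof -
  define S where "S = {K. submodule\<^sub>O K \<and> J \<subseteq> K \<and> K \<subseteq> \<O> \<and> 1 \<notin> K}"
  have "finite S"
    by (rule finite_subset[OF _ finite_ideals_above[OF assms(1,2)]]) (auto simp: S_def)
  moreover have "J \<in> S" using assms fractional_ideal_submodule by (auto simp: S_def)
  ultimately obtain P where P: "P \<in> S" "J \<subseteq> P" and max: "\<And>K. K \<in> S \<Longrightarrow> P \<subseteq> K \<Longrightarrow> K = P"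
    using finite_has_maximal2[of S J] by metis
  have sub: "submodule\<^sub>O P" "P \<subseteq> \<O>" "1 \<notin> P" using P(1) by (auto simp: S_def)
  obtain z where "z \<in> J" "z \<noteq> 0" using fractional_ideal_nonzero[OF assms(1)] by blast
  then have frac: "P \<in> \<F>" using P(2) by (intro fractional_ideals_integral[OF sub(2,1)]) auto
  have "x \<in> P \<or> y \<in> P" if xy: "algebraic_int x" "algebraic_int y" "x * y \<in> P" for x y
  proof (rule disjCI)
    assume "y \<notin> P"
    show "x \<in> P"
    proof (rule ccontr)
      assume "x \<notin> P"
      \<comment> \<open>\<open>K\<close> is the ideal generated by \<open>P\<close> and
        \<open>x\<close>; by maximality it contains 1, and multiplying that equation by
        \<open>y\<close> puts \<open>y\<close> into \<open>P\<close>.\<close>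
      define K where "K = {a + b * x | a b. a \<in> P \<and> algebraic_int b}"
      have PK: "P \<subseteq> K" by (force simp: K_def)
      have "submodule\<^sub>O K" unfolding submodule\<^sub>O_def
      proof (intro conjI ballI allI impI)
        show "0 \<in> K" using PK submodule\<^sub>O_0[OF sub(1)] by blast
      next
        fix u v assume "u \<in> K" "v \<in> K"
        then obtain a b c d where "u = a + b * x" "v = c + d * x" "a \<in> P" "c \<in> P"
          "algebraic_int b" "algebraic_int d" by (auto simp: K_def)
        moreover have "a + b * x + (c + d * x) = (a + c) + (b + d) * x" by (simp add: algebra_simps)
        ultimately show "u + v \<in> K"
          unfolding K_def using submodule\<^sub>O_add[OF sub(1)] algebraic_int_add by blast
      next
        fix e u :: 'L assume e: "algebraic_int e" and "u \<in> K"
        then obtain a b where "u = a + b * x" "a \<in> P" "algebraic_int b" by (auto simp: K_def)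
        moreover have "e * (a + b * x) = e * a + (e * b) * x" by (simp add: algebra_simps)
        ultimately show "e * u \<in> K"
          unfolding K_def using submodule\<^sub>O_mult[OF sub(1) e] algebraic_int_mult[OF e] by blast
      qed
      moreover have "K \<subseteq> \<O>"
        using sub(2) xy(1) by (auto simp: K_def intro!: algebraic_int_add algebraic_int_mult)
      moreover have "x \<in> K" unfolding K_def
        using submodule\<^sub>O_0[OF sub(1)] by (intro CollectI exI[of _ 0] exI[of _ 1]) simp
      then have "K \<noteq> P" using \<open>x \<notin> P\<close> by blast
      ultimately have "1 \<in> K" using max[of K] PK P(2) unfolding S_def by blast
      then obtain a b where ab: "1 = a + b * x" "a \<in> P" "algebraic_int b" by (auto simp: K_def)
      have "y = y * (a + b * x)" unfolding ab(1)[symmetric] by simp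
      also have "\<dots> = y * a + b * (x * y)" by (simp add: algebra_simps)
      also have "\<dots> \<in> P" by (intro submodule\<^sub>O_add[OF sub(1)] submodule\<^sub>O_mult[OF sub(1)] xy ab)
      finally show False using \<open>y \<notin> P\<close> by simp
    qed
  qed
  then have "prime_id P" using frac sub by (simp add: prime_id_def)
  then show thesis using P(2) by (rule that)
qed

lemma prime_conj:
  assumes "prime_id P"
  shows "prime_id (conj i ` P)"
  unfolding prime_id_def
proof (intro conjI allI impI)
  note P = prime_idD[OF assms]
  show "conj i ` P \<in> \<F>" by (rule conj_image_fractional[OF P(1)])
  show "conj i ` P \<subseteq> \<O>" using P(2) by (simp only: conj_image_\<O>)
  show "1 \<notin> conj i ` P" using P(3) by (metis conj_1 conj_eq_iff imageE)
  fix x y assume xy: "algebraic_int x" "algebraic_int y" "x * y \<in> conj i ` P"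
  obtain x' y' where x': "x = conj i x'" "y = conj i y'" using conj_surj by metis
  then have "x' * y' \<in> P" using xy(3) by (metis conj_eq_iff conj_mult imageE)
  then show "x \<in> conj i ` P \<or> y \<in> conj i ` P"
    using P(5)[of x' y'] xy x' by auto
qed

lemma prime_contains_prime:
  assumes "prime_id P"
  obtains q :: nat where "Factorial_Ring.prime q" "of_nat q \<in> P"
proof -
  note P = prime_idD[OF assms]
  obtain x where "x \<in> P" "x \<noteq> 0" using fractional_ideal_nonzero[OF P(1)] by blast
  then have ex: "\<exists>n>0. (of_nat n :: 'L) \<in> P"
    by (rule integral_ideal_has_positive_integer[OF P(4,2)])
  define n where "n = (LEAST n. n > 0 \<and> (of_nat n :: 'L) \<in> P)"
  have n: "n > 0" "of_nat n \<in> P" using LeastI_ex[OF ex] by (auto simp: n_def)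
  have least: "n \<le> m" if "m > 0" "of_nat m \<in> P" for m
    unfolding n_def using that by (intro Least_le) simp
  have "n \<noteq> 1" using n(2) P(3) by (metis of_nat_1)
  then obtain q where q: "Factorial_Ring.prime q" "q dvd n" using prime_factor_nat by blast
  then obtain m where m: "n = q * m" by (auto elim: dvdE)
  have "m < n" "m > 0" using m n(1) prime_gt_1_nat[OF q(1)] by auto
  then have "of_nat m \<notin> P" using least[of m] by auto
  moreover have "of_nat q * of_nat m \<in> P" using n(2) m by simp
  ultimately have "of_nat q \<in> P" using P(5)[of "of_nat q" "of_nat m"] by auto
  with q(1) show thesis by (rule that)
qed

lemma prime_int_mem:
  assumes "prime_id P" "Factorial_Ring.prime q" "of_nat q \<in> P" "(of_int z :: 'L) \<in> P"
  shows "int q dvd z"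
proof (rule ccontr)
  note P = prime_idD[OF assms(1)]
  assume "\<not> int q dvd z"
  then have "Rings.coprime (int q) z" using assms(2) by (simp add: prime_imp_coprime)
  then obtain a b where "a * int q + b * z = 1" using bezout_int[of "int q" z] by auto
  then have "(1 :: 'L) = of_int a * of_nat q + of_int b * of_int z"
    by (metis of_int_1 of_int_add of_int_mult of_int_of_nat_eq)
  also have "\<dots> \<in> P" by (intro submodule\<^sub>O_add[OF P(4)] submodule\<^sub>O_mult[OF P(4)] assms) auto
  finally show False using P(3) by simp
qed

lemma prime_ipow:
  assumes "prime_id Q" "I \<in> \<F>" "I \<subseteq> \<O>" "ipow I k \<subseteq> Q"
  shows "I \<subseteq> Q"
  using assms(4)
proof (induction k)
  case 0
  then show ?case using prime_not_above[OF assms(1)] by simp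
next
  case (Suc k)
  have "ipow I k \<subseteq> \<O>" using assms(2,3) by (induction k) (auto dest: iprod_integral[OF ipow_fractional])
  then show ?case using prime_iprod[OF assms(1) _ assms(3), of "ipow I k"] Suc by auto
qed

subsection \<open>Primes above a rational prime\<close>

abbreviation Nid :: "'L set \<Rightarrow> 'L set" where "Nid I \<equiv> ifinprod (\<lambda>i. conj i ` I) {..<p}"

lemma Nid_iprod: "I \<in> \<F> \<Longrightarrow> J \<in> \<F> \<Longrightarrow> Nid (iprod I J) = iprod (Nid I) (Nid J)"
  using IG.finprod_multf[of "\<lambda>i. conj i ` I" "{..<p}" "\<lambda>i. conj i ` J"]
  by (simp add: conj_image_iprod conj_image_fractional Pi_def)

lemma Nid_invariant: "I \<in> \<F> \<Longrightarrow> \<sigma> ` I = I \<Longrightarrow> Nid I = ipow I p"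
proof -
  assume I: "I \<in> \<F>" "\<sigma> ` I = I"
  have "conj i ` I = I" for i by (rule conj_image_invariant[OF I(2)])
  then show ?thesis using IG.finprod_const[of I "{..<p}"] I(1) by simp
qed

lemma principal_nat_dvd:
  assumes "(of_nat a :: 'L) \<in> principal_ideal (of_nat b)" "b > 0"
  shows "b dvd a"
proof -
  have "algebraic_int (of_nat a / of_nat b :: 'L)" using assms by (simp add: mem_principal_ideal)
  then have "(of_nat a / of_nat b :: 'L) \<in> \<int>" by (intro rational_algebraic_int_is_int) auto
  then obtain z where "(of_nat a / of_nat b :: 'L) = of_int z" by (auto elim: Ints_cases)
  then have "(of_int (int a) :: 'L) = of_int (int b * z)" using assms(2) by (simp add: field_simps)
  then have "int a = int b * z" by (simp only: of_int_eq_iff)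
  then show ?thesis by (metis dvd_triv_left int_dvd_int_iff)
qed

lemma principal_nat_inj:
  assumes "principal_ideal (of_nat a :: 'L) = principal_ideal (of_nat b)" "a > 0" "b > 0"
  shows "a = b"
  using principal_nat_dvd[of a b] principal_nat_dvd[of b a] assms self_mem_principal
  by (metis dvd_antisym)

text \<open>Write \<open>(q) = P C\<close>. Ideal norms multiply, so the generator of the norm of
  \<open>P\<close> divides \<open>q ^ p\<close> and is a power of \<open>q\<close>; the exponent is
  positive because the norm of \<open>P\<close> is contained in \<open>P\<close>.\<close>

lemma Nid_prime:
  assumes P: "prime_id P" and q: "Factorial_Ring.prime q" "of_nat q \<in> P"
  obtains f where "f \<ge> 1" "Nid P = principal_ideal (of_nat (q ^ f))"
proof -
  note PD = prime_idD[OF P]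
  have q0: "(of_nat q :: 'L) \<noteq> 0" "q > 0" using q(1) by (auto simp: prime_gt_0_nat)
  have "principal_ideal (of_nat q) \<subseteq> P" by (rule principal_subset[OF PD(4) q(2)])
  then obtain C where C: "C \<in> \<F>" "C \<subseteq> \<O>" "principal_ideal (of_nat q) = iprod P C"
    using ideal_dvd[OF principal_fractional[OF q0(1)] PD(1)] by blast
  obtain n where n: "n > 0" "Nid P = principal_ideal (of_nat n)" using ideal_norm[OF PD(1,2)] by blast
  obtain m where m: "m > 0" "Nid C = principal_ideal (of_nat m)" using ideal_norm[OF C(1,2)] by blast
  note inv = principal_nat_invariant[of q]
  have "principal_ideal (of_nat (q ^ p)) = Nid (principal_ideal (of_nat q))"
    using Nid_invariant[OF principal_fractional[OF q0(1)] inv] principal_pow[OF q0(1)] by simp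
  also have "\<dots> = principal_ideal (of_nat (n * m))"
    unfolding C(3) Nid_iprod[OF PD(1) C(1)] n(2) m(2) principal_mult by simp
  finally have "q ^ p = n * m" using q0(2) n(1) m(1) by (intro principal_nat_inj) simp_all
  then have "n dvd q ^ p" by simp
  then obtain f where f: "n = q ^ f" using divides_primepow_nat[OF q(1)] by blast
  have "f \<noteq> 0"
  proof
    assume "f = 0"
    then have "Nid P = \<O>" using n(2) f by (simp add: principal_ideal_1)
    moreover have "Nid P \<subseteq> P"
    proof -
      have frac: "conj i ` P \<in> \<F>" for i by (rule conj_image_fractional[OF PD(1)])
      have "1 * b \<in> P" if b: "b \<in> Nid P" for b
      proof (rule finprod_subset[where A = "{..<p}" and I = "\<lambda>i. conj i ` P"])
        fix x :: "nat \<Rightarrow> 'L" assume x: "\<And>i. i \<in> {..<p} \<Longrightarrow> x i \<in> conj i ` P"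
        have "{..<p} = insert 0 {1..<p}" using p_gt_2 by auto
        then have eq: "prod x {..<p} = prod x {1..<p} * x 0" by (simp add: mult.commute)
        have "algebraic_int (x i)" if "i < p" for i using x[of i] that PD(2) by auto
        then have "algebraic_int (prod x {1..<p})" by (intro algebraic_int_prod) simp
        moreover have "x 0 \<in> P" using x[of 0] p_gt_2 by simp
        ultimately show "1 * prod x {..<p} \<in> P" unfolding eq using submodule\<^sub>O_mult[OF PD(4)] by simp
      qed (simp_all add: frac PD b)
      then show ?thesis by auto
    qed
    ultimately show False using prime_not_above[OF P] by simp
  qed
  with n(2) f show thesis using that[of f] by simp
qed

lemma ipow_prime_inj:
  assumes P: "prime_id P" and eq: "ipow P a = ipow P b"
  shows "a = b"
proof -
  note PD = prime_idD[OF P]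
  have *: False if "a < b" "ipow P a = ipow P b" for a b
  proof -
    have "ipow P b = iprod (ipow P a) (ipow P (b - a))"
      using IG.nat_pow_mult[of P a "b - a"] PD(1) that(1) by simp
    then have "iprod (ipow P a) \<O> \<subseteq> iprod (ipow P a) (ipow P (b - a))"
      using that(2) by (simp add: iprod_\<O>_right ipow_fractional PD(1))
    then have "\<O> \<subseteq> ipow P (b - a)"
      by (intro iprod_cancel[OF ipow_fractional[OF PD(1)] fractional_ideals_\<O> ipow_fractional[OF PD(1)]])
    also have "ipow P (b - a) = iprod (ipow P (b - a - 1)) P"
      using that(1) by (metis IG.nat_pow_Suc Suc_diff_1 ideal_group_simps(2) zero_less_diff)
    also have "\<dots> \<subseteq> P"
    proof -
      have "ipow P k \<subseteq> \<O>" for k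
        using PD(1,2) by (induction k) (auto dest: iprod_integral[OF ipow_fractional])
      then show ?thesis
        using iprod_subset_left[OF PD(1)] by (simp only: iprod_commute[of _ P])
    qed
    finally show False using prime_not_above[OF P] by simp
  qed
  then show ?thesis using eq by (metis nat_neq_iff)
qed

text \<open>\<open>P ^ p\<close> is the norm \<open>(q ^ f)\<close>, so a prime containing
  \<open>q\<close> contains \<open>P\<close> and equals it. Splitting off \<open>P\<close>
  repeatedly shows that every integral ideal containing \<open>q\<close> is a power of
  \<open>P\<close>; in particular \<open>(q) = P ^ e\<close> with \<open>e * f = p\<close>, and
  \<open>e\<close> is 1 or \<open>p\<close>.\<close>

lemma invariant_prime:
  assumes P: "prime_id P" "\<sigma> ` P = P" and q: "Factorial_Ring.prime q" "of_nat q \<in> P"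
  shows "P = principal_ideal (of_nat q) \<or> ipow P p = principal_ideal (of_nat q)"
proof -
  note PD = prime_idD[OF P(1)]
  have q0: "(of_nat q :: 'L) \<noteq> 0" using q(1) by (auto simp: prime_gt_0_nat)
  obtain f where f: "f \<ge> 1" "Nid P = principal_ideal (of_nat (q ^ f))"
    using Nid_prime[OF P(1) q] by blast
  then have Pp: "ipow P p = principal_ideal (of_nat q ^ f)"
    using Nid_invariant[OF PD(1) P(2)] by simp
  have pow: "\<exists>j. I = ipow P j" if "I \<in> \<F>" "I \<subseteq> \<O>" "of_nat q \<in> I" for I
    using that
  proof (induction rule: ideal_induct)
    case (step I)
    show ?case
    proof (cases "1 \<in> I")
      case True
      then show ?thesis using integral_1_mem[OF step(1,2)] by (intro exI[of _ 0]) simp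
    next
      case False
      then obtain Q where Q: "prime_id Q" "I \<subseteq> Q" using exists_prime_above[OF step(1,2)] by blast
      have "of_nat q \<in> Q" using Q(2) step.prems by blast
      moreover obtain f' where "f = Suc f'" using f(1) by (cases f) auto
      ultimately have "of_nat q ^ f \<in> Q"
        using submodule\<^sub>O_mult[OF prime_idD(4)[OF Q(1)], of "of_nat q ^ f'" "of_nat q"]
        by (simp add: algebraic_int_power mult.commute)
      then have "ipow P p \<subseteq> Q" unfolding Pp by (rule principal_subset[OF prime_idD(4)[OF Q(1)]])
      then have "P \<subseteq> Q" by (rule prime_ipow[OF Q(1) PD(1,2)])
      then have "P = Q" by (rule prime_maximal[OF P(1) Q(1)])
      then obtain K where K: "K \<in> \<F>" "K \<subseteq> \<O>" "I = iprod P K"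
        using ideal_dvd[OF step(1) PD(1)] Q(2) by blast
      have "I \<subseteq> K" unfolding K(3) iprod_commute[of P] by (rule iprod_subset_left[OF K(1) PD(2)])
      moreover have "I \<noteq> K"
      proof
        assume "I = K"
        then have "\<O> \<subseteq> P" using iprod_absorb[OF K(1) PD(1)] K(3) by simp
        then show False using prime_not_above[OF P(1)] by simp
      qed
      ultimately obtain j where "K = ipow P j" using step.IH[OF K(1,2)] step.prems by blast
      then have "I = ipow P (Suc j)" using K(3) by (simp add: iprod_commute)
      then show ?thesis by blast
    qed
  qed
  obtain e where e: "principal_ideal (of_nat q) = ipow P e"
    using pow[OF principal_fractional[OF q0] principal_integral] by auto
  have "ipow P p = ipow P (e * f)"
    unfolding Pp principal_pow[OF q0, symmetric] e using PD(1) by (simp add: IG.nat_pow_pow)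
  then have "p = e * f" by (rule ipow_prime_inj[OF P(1)])
  then have "e = 1 \<or> e = p" using prime_p by (metis dvd_triv_left prime_nat_iff)
  then show ?thesis
  proof
    assume "e = 1"
    then have "ipow P e = P" using PD(1) by (simp add: iprod_\<O>_left)
    then show ?thesis using e by simp
  qed (use e in simp)
qed

text \<open>The stabilizer of \<open>P\<close> in a group of prime order is trivial or
  everything.\<close>

lemma noninvariant_prime_distinct:
  assumes "\<sigma> ` P \<noteq> P" "i < p" "j < p" "conj i ` P = conj j ` P"
  shows "i = j"
proof -
  have stab: False if k: "0 < k" "k < p" "conj k ` P = P" for k
  proof -
    have "Rings.coprime k p"
      using k(1,2) prime_p by (metis coprime_commute nat_dvd_not_less prime_imp_coprime_nat)
    then obtain m l where m: "k * m = p * l + 1" using bezout_nat[of k p] k(1) by auto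
    have "conj (k * m) ` P = P" for m
      by (induction m) (simp, simp only: mult_Suc_right funpow_add image_comp[symmetric] k(3))
    from this[of m] have "conj (p * l + 1) ` P = P" unfolding m .
    moreover have "conj (p * l + 1) x = \<sigma> x" for x
      using conj_period_mult[of l "\<sigma> x"] by (simp add: funpow_add conj_\<sigma>)
    ultimately have "\<sigma> ` P = P" by simp
    then show False using assms(1) by simp
  qed
  have *: False if "i < j" "j < p" "conj i ` P = conj j ` P" for i j
  proof -
    have "conj j ` P = conj i ` conj (j - i) ` P"
      using that(1) by (simp add: image_image conj_conj)
    then have "conj (j - i) ` P = P" using that(3) by (simp only: conj_image_eq_iff)
    then show False using stab[of "j - i"] that(1) less_imp_diff_less[OF that(2)] by simp
  qed
  from *[of i j] *[of j i] assms show ?thesis by (metis nat_neq_iff)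
qed

text \<open>The second conjunct is carried along to run the induction: the product of the primes
  treated so far is not contained in the next prime, so the cofactor of \<open>J\<close> must
  be.\<close>

lemma subset_finprod_primes:
  assumes "finite A" "\<And>i. i \<in> A \<Longrightarrow> prime_id (P i)" "inj_on P A"
    and J: "J \<in> \<F>" "J \<subseteq> \<O>" "\<And>i. i \<in> A \<Longrightarrow> J \<subseteq> P i"
  shows "J \<subseteq> ifinprod P A \<and> (\<forall>Q. prime_id Q \<longrightarrow> ifinprod P A \<subseteq> Q \<longrightarrow> Q \<in> P ` A)"
  using assms(1-3) J(3)
proof (induction A rule: finite_induct)
  case empty
  then show ?case using J(2) prime_idD(3) by fastforce
next
  case (insert a A)
  let ?B = "ifinprod P A"
  have IH: "J \<subseteq> ?B" "\<And>Q. prime_id Q \<Longrightarrow> ?B \<subseteq> Q \<Longrightarrow> Q \<in> P ` A"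
    using insert.IH insert.prems by (auto simp: inj_on_def)
  have a: "prime_id (P a)" "J \<subseteq> P a" using insert.prems by auto
  have B: "?B \<in> \<F>" using insert.prems by (intro finprod_fractional prime_idD(1)) auto
  have BO: "?B \<subseteq> \<O>"
  proof -
    have "1 * b \<in> (\<O> :: 'L set)" if b: "b \<in> ?B" for b
    proof (rule finprod_subset[where A = A and I = P])
      fix x :: "_ \<Rightarrow> 'L" assume x: "\<And>i. i \<in> A \<Longrightarrow> x i \<in> P i"
      have "algebraic_int (x i)" if "i \<in> A" for i
        using x[OF that] prime_idD(2)[OF insert.prems(1), of i] that by auto
      then have "algebraic_int (prod x A)" by (rule algebraic_int_prod)
      then show "1 * prod x A \<in> \<O>" by simp
    qed (use insert prime_idD(1) b submodule\<^sub>O_\<O> in auto)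
    then show ?thesis by auto
  qed
  have eq: "ifinprod P (insert a A) = iprod (P a) ?B"
    using insert prime_idD(1) by (simp add: IG.finprod_insert Pi_def)
  obtain K where K: "K \<in> \<F>" "K \<subseteq> \<O>" "J = iprod ?B K" using ideal_dvd[OF J(1) B IH(1)] by blast
  have "\<not> ?B \<subseteq> P a" using IH(2)[OF a(1)] insert.prems(2) insert.hyps by (auto simp: inj_on_def)
  then have "K \<subseteq> P a" using prime_iprod[OF a(1) BO K(2)] a(2) K(3) by blast
  then have "J \<subseteq> iprod ?B (P a)" unfolding K(3) by (intro iprod_mono) auto
  moreover have "Q \<in> P ` insert a A" if Q: "prime_id Q" "iprod (P a) ?B \<subseteq> Q" for Q
  proof -
    have "P a \<subseteq> Q \<or> ?B \<subseteq> Q" by (rule prime_iprod[OF Q(1) prime_idD(2)[OF a(1)] BO Q(2)])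
    then show ?thesis using IH(2)[OF Q(1)] prime_maximal[OF a(1) Q(1)] by auto
  qed
  ultimately show ?case unfolding eq iprod_commute[of "P a"] by blast
qed

text \<open>An invariant ideal inside \<open>P\<close> lies in all conjugates of \<open>P\<close>;
  these are \<open>p\<close> distinct primes when \<open>\<sigma>\<close> moves \<open>P\<close>, so
  the ideal lies in their product.\<close>

lemma noninvariant_prime:
  assumes "prime_id P" "\<sigma> ` P \<noteq> P" "J \<in> \<F>" "J \<subseteq> \<O>" "\<sigma> ` J = J" "J \<subseteq> P"
  shows "J \<subseteq> Nid P"
proof -
  have "conj i ` J = J" for i by (rule conj_image_invariant[OF assms(5)])
  then have "J \<subseteq> conj i ` P" for i using assms(6) by (metis image_mono)
  then have "J \<subseteq> Nid P \<and> (\<forall>Q. prime_id Q \<longrightarrow> Nid P \<subseteq> Q \<longrightarrow> Q \<in> (\<lambda>i. conj i ` P) ` {..<p})"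
    by (intro subset_finprod_primes prime_conj assms inj_onI)
       (auto intro: noninvariant_prime_distinct[OF assms(2)])
  then show ?thesis by blast
qed


section \<open>Ramified primes and invariant ideals\<close>

lemma ipow_integral: "I \<in> \<F> \<Longrightarrow> I \<subseteq> \<O> \<Longrightarrow> ipow I k \<subseteq> \<O>"
  by (induction k) (simp_all add: iprod_integral ipow_fractional)

lemma ipow_Suc_subset: "I \<in> \<F> \<Longrightarrow> I \<subseteq> \<O> \<Longrightarrow> ipow I (Suc k) \<subseteq> I"
  using iprod_subset_left[of I "ipow I k"] ipow_integral[of I k] by (simp add: iprod_commute[of _ I])

lemma finprod_integral:
  assumes "finite A" "\<And>i. i \<in> A \<Longrightarrow> I i \<in> \<F>" "\<And>i. i \<in> A \<Longrightarrow> I i \<subseteq> \<O>"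
  shows "ifinprod I A \<subseteq> \<O>"
  using assms
  by (induction A rule: finite_induct) (simp_all add: IG.finprod_insert Pi_def iprod_integral)

text \<open>In prime degree a ramified prime is totally ramified, and this form exhibits the prime
  \<open>P_q\<close> of the overview, chosen as \<open>rp q\<close>. Agreement with the original
  notion is \<open>ramified_primes_eq\<close>.\<close>

definition ram :: "nat set" where
  "ram = {q. Factorial_Ring.prime q \<and> (\<exists>P. prime_id P \<and> ipow P p = principal_ideal (of_nat q))}"

definition rp :: "nat \<Rightarrow> 'L set" where
  "rp q = (SOME P. prime_id P \<and> ipow P p = principal_ideal (of_nat q))"

lemma rp:
  assumes "q \<in> ram"
  shows rp_prime: "prime_id (rp q)" and rp_pow: "ipow (rp q) p = principal_ideal (of_nat q)"
    and ram_prime: "Factorial_Ring.prime q" and mem_rp: "of_nat q \<in> rp q"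
    and rp_fractional: "rp q \<in> \<F>"
proof -
  have ex: "\<exists>P. prime_id P \<and> ipow P p = principal_ideal (of_nat q)"
    using assms by (simp add: ram_def)
  show P: "prime_id (rp q)" and pow: "ipow (rp q) p = principal_ideal (of_nat q)"
    using someI_ex[OF ex] by (simp_all add: rp_def)
  show "Factorial_Ring.prime q" using assms by (simp add: ram_def)
  show frac: "rp q \<in> \<F>" by (rule prime_idD(1)[OF P])
  have "p = Suc (p - 1)" using p_gt_2 by simp
  then have "ipow (rp q) p \<subseteq> rp q"
    using ipow_Suc_subset[OF frac prime_idD(2)[OF P], of "p - 1"] by metis
  then show "of_nat q \<in> rp q" using self_mem_principal unfolding pow by blast
qed

lemma rp_unique:
  assumes "q \<in> ram" "prime_id P" "of_nat q \<in> P"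
  shows "rp q = P"
proof -
  note R = prime_idD[OF rp_prime[OF assms(1)]]
  have "ipow (rp q) p \<subseteq> P"
    unfolding rp_pow[OF assms(1)] by (rule principal_subset[OF prime_idD(4)[OF assms(2)] assms(3)])
  then have "rp q \<subseteq> P" by (rule prime_ipow[OF assms(2) R(1,2)])
  then show ?thesis by (rule prime_maximal[OF rp_prime[OF assms(1)] assms(2)])
qed

lemma rp_invariant:
  assumes "q \<in> ram"
  shows "\<sigma> ` rp q = rp q"
proof (rule sym, rule rp_unique[OF assms])
  show "prime_id (\<sigma> ` rp q)" using prime_conj[OF rp_prime[OF assms], of 1] by simp
  have "\<sigma> (of_nat q) = of_nat q" using conj_of_nat[of 1 q] by simp
  then show "of_nat q \<in> \<sigma> ` rp q" using mem_rp[OF assms] by (metis imageI)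
qed

text \<open>If \<open>P\<close> were moved by \<open>\<sigma>\<close>, then \<open>(q)\<close> would
  be contained in the norm \<open>(q ^ f)\<close> of \<open>P\<close>, so \<open>f = 1\<close> and
  \<open>(q)\<close> would be the product of the \<open>p\<close> distinct conjugates. Cancelling
  \<open>P\<close> puts the product of the other conjugates inside \<open>P\<close>, so one of them
  is \<open>P\<close>, a contradiction. Thus \<open>P\<close> is invariant, and the case
  \<open>P = (q)\<close> is excluded by the second factor \<open>P\<close>.\<close>

lemma square_dvd_imp_ram:
  assumes P: "prime_id P" and q: "Factorial_Ring.prime q"
    and K: "K \<in> \<F>" "K \<subseteq> \<O>" "principal_ideal (of_nat q) = iprod P (iprod P K)"
  shows "q \<in> ram"
proof -
  note PD = prime_idD[OF P]
  have q0: "(of_nat q :: 'L) \<noteq> 0" "q > 0" using q(1) by (auto simp: prime_gt_0_nat)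
  have PK: "iprod P K \<in> \<F>" "iprod P K \<subseteq> P"
    using iprod_fractional[OF PD(1) K(1)] iprod_subset_left[OF PD(1) K(2)] by auto
  have sub: "principal_ideal (of_nat q) \<subseteq> P"
    unfolding K(3) using PK(2) PD(2) by (intro iprod_subset_left PD(1)) blast
  then have qP: "of_nat q \<in> P" using self_mem_principal by blast
  have int: "principal_ideal (of_nat q) \<subseteq> (\<O> :: 'L set)" by (rule principal_integral) simp
  note inv = principal_nat_invariant[of q]
  note qfrac = principal_fractional[OF q0(1)]
  have "\<sigma> ` P = P"
  proof (rule ccontr)
    assume ninv: "\<sigma> ` P \<noteq> P"
    obtain f where f: "f \<ge> 1" "Nid P = principal_ideal (of_nat (q ^ f))"
      by (rule Nid_prime[OF P q qP])
    have qN: "principal_ideal (of_nat q) \<subseteq> Nid P"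
      by (rule noninvariant_prime[OF P ninv qfrac int inv sub])
    then have "of_nat q \<in> principal_ideal (of_nat (q ^ f) :: 'L)"
      unfolding f(2) using self_mem_principal by blast
    then have "q ^ f dvd q" using q0(2) by (intro principal_nat_dvd) simp_all
    then have "q ^ f \<le> q ^ 1" using q0(2) by (simp add: dvd_imp_le)
    then have "f = 1" using f(1) prime_gt_1_nat[OF q(1)] by (simp only: power_increasing_iff)
    define C where "C = ifinprod (\<lambda>i. conj i ` P) {1..<p}"
    have frac: "conj i ` P \<in> \<F>" for i by (rule conj_image_fractional[OF PD(1)])
    have C: "C \<in> \<F>" unfolding C_def by (rule finprod_fractional[OF frac])
    have "{..<p} = insert 0 {1..<p}" using p_gt_2 by auto
    then have "Nid P = iprod P C"
      unfolding C_def using frac PD(1) by (simp add: IG.finprod_insert Pi_def)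
    then have "iprod P C \<subseteq> iprod P (iprod P K)" using f(2) \<open>f = 1\<close> K(3) by simp
    then have "C \<subseteq> iprod P K" by (rule iprod_cancel[OF PD(1) C PK(1)])
    then have CP: "C \<subseteq> P" using PK(2) by blast
    have conjJ: "conj i ` principal_ideal (of_nat q) = principal_ideal (of_nat q)" for i
      by (rule conj_image_invariant[OF inv])
    have "P \<in> (\<lambda>i. conj i ` P) ` {1..<p}"
    proof -
      have "principal_ideal (of_nat q) \<subseteq> ifinprod (\<lambda>i. conj i ` P) {1..<p} \<and>
        (\<forall>Q. prime_id Q \<longrightarrow> ifinprod (\<lambda>i. conj i ` P) {1..<p} \<subseteq> Q \<longrightarrow> Q \<in> (\<lambda>i. conj i ` P) ` {1..<p})"
      proof (rule subset_finprod_primes)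
        show "inj_on (\<lambda>i. conj i ` P) {1..<p}"
          by (intro inj_onI) (auto intro: noninvariant_prime_distinct[OF ninv])
        show "principal_ideal (of_nat q) \<subseteq> conj i ` P" for i
          using image_mono[OF sub, of "conj i"] unfolding conjJ .
      qed (use prime_conj[OF P] qfrac int in auto)
      then show ?thesis using P CP unfolding C_def by blast
    qed
    then obtain i where i: "i \<in> {1..<p}" "P = conj i ` P" by blast
    have "0 = i" using i p_gt_2 by (intro noninvariant_prime_distinct[OF ninv]) simp_all
    then show False using i(1) by simp
  qed
  from invariant_prime[OF P this q qP] show ?thesis
  proof
    assume "P = principal_ideal (of_nat q)"
    then have "iprod P \<O> \<subseteq> iprod P (iprod P K)" using K(3) PD(1) by (simp add: iprod_\<O>_right)
    then have "\<O> \<subseteq> iprod P K" by (rule iprod_cancel[OF PD(1) fractional_ideals_\<O> PK(1)])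
    then show ?thesis using PK(2) prime_not_above[OF P] by blast
  qed (use P q in \<open>auto simp: ram_def\<close>)
qed

text \<open>One exponent above 1 in any factorization already gives a divisor \<open>P ^ 2\<close>
  of \<open>(q)\<close>; conversely \<open>{rp q}\<close> with exponent \<open>p\<close> is a
  factorization of the required kind.\<close>

lemma ramified_primes_eq: "ramified_primes TYPE('L) = ram"
proof (intro equalityI subsetI)
  fix q assume "q \<in> ramified_primes TYPE('L)"
  then obtain S :: "'L set set" and e :: "'L set \<Rightarrow> nat" where q: "Factorial_Ring.prime q"
    and S: "finite S" "\<And>P. P \<in> S \<Longrightarrow> primeideal P ring_of_integers \<and> P \<noteq> {0} \<and> e P \<ge> 1"
    and eq: "principal_ideal (of_nat q) = ifinprod (\<lambda>P. ipow P (e P)) S"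
    and ex: "\<exists>P\<in>S. e P > 1"
    unfolding ramified_primes_def by blast
  from ex obtain P where P: "P \<in> S" "e P > 1" by blast
  have prime: "prime_id Q" if "Q \<in> S" for Q using S(2)[OF that] primeideal_iff by blast
  note PD = prime_idD[OF prime[OF P(1)]]
  define R where "R = ifinprod (\<lambda>P. ipow P (e P)) (S - {P})"
  have frac: "ipow Q (e Q) \<in> \<F>" if "Q \<in> S" for Q
    using prime_idD(1)[OF prime[OF that]] by (rule ipow_fractional)
  have R: "R \<in> \<F>" unfolding R_def using frac by (intro finprod_fractional) simp
  have R': "R \<subseteq> \<O>"
    unfolding R_def
  proof (rule finprod_integral)
    show "ipow Q (e Q) \<subseteq> \<O>" if "Q \<in> S - {P}" for Q
      using that by (intro ipow_integral prime_idD(1,2)[OF prime]) auto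
  qed (use S(1) frac in simp_all)
  have "S = insert P (S - {P})" using P(1) by auto
  then have "ifinprod (\<lambda>P. ipow P (e P)) S = ifinprod (\<lambda>P. ipow P (e P)) (insert P (S - {P}))"
    by simp
  also have "\<dots> = iprod (ipow P (e P)) R"
    unfolding R_def using S(1) frac P(1) by (subst IG.finprod_insert) (auto simp: Pi_def)
  also have "e P = Suc (Suc (e P - 2))" using P(2) by simp
  then have "ipow P (e P) = iprod P (iprod P (ipow P (e P - 2)))"
    by (metis IG.nat_pow_Suc ideal_group_simps(2) iprod_commute)
  finally have eq': "principal_ideal (of_nat q) = iprod P (iprod P (iprod (ipow P (e P - 2)) R))"
    unfolding eq by (simp add: iprod_assoc)
  show "q \<in> ram"
    by (rule square_dvd_imp_ram[OF prime[OF P(1)] q _ _ eq'])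
       (intro iprod_fractional iprod_integral ipow_fractional ipow_integral R R' PD)+
next
  fix q assume q: "q \<in> ram"
  note R = rp[OF q]
  have "primeideal (rp q) ring_of_integers" "rp q \<noteq> {0}"
    using primeideal_iff[of "rp q"] R(1) by auto
  moreover have "ifinprod (\<lambda>P. ipow P p) {rp q} = ipow (rp q) p"
    using R(5) by (subst IG.finprod_insert) (simp_all add: ipow_fractional iprod_\<O>_right)
  ultimately show "q \<in> ramified_primes TYPE('L)"
    unfolding ramified_primes_def using R p_gt_2
    by (intro CollectI conjI exI[of _ "{rp q}"] exI[of _ "\<lambda>_. p"]) auto
qed

text \<open>If \<open>P\<^sup>p = (q)\<close>, then traces of elements of \<open>P\<close> lie in \<open>P \<inter> \<int> = q\<int>\<close>, so \<open>\<delta> P \<subseteq> P\<^sup>p\<close> by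
  \<open>trace_expansion\<close>; hence \<open>\<delta> \<in> P\<close> and \<open>q\<close> divides the norm of \<open>\<delta>\<close>.\<close>

lemma finite_ram: "finite ram"
proof -
  obtain d where d: "Nm \<delta> = of_int d" using Nm_Ints[OF algebraic_int_\<delta>] by (auto elim!: Ints_cases)
  have d0: "d \<noteq> 0" using d \<delta>_nonzero by (metis Nm_eq_0_iff of_int_0)
  have "int q dvd d" if q: "q \<in> ram" for q
  proof -
    define P where "P = rp q"
    have P: "prime_id P" "ipow P p = principal_ideal (of_nat q)" "Factorial_Ring.prime q" "of_nat q \<in> P"
      "\<sigma> ` P = P"
      unfolding P_def using rp[OF q] rp_invariant[OF q] by auto
    note PD = prime_idD[OF P(1)]
    have conjP: "conj i x \<in> P" if "x \<in> P" for i x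
      using conj_image_invariant[OF P(5), of i] that by blast
    have "y * \<delta> \<in> principal_ideal (of_nat q)" if y: "y \<in> P" for y
    proof -
      have "\<exists>z. Tr (y * dual k) = of_nat q * of_int z" for k
      proof -
        have mem: "dual k * y \<in> P" by (intro submodule\<^sub>O_mult[OF PD(4)] algebraic_int_dual y)
        then have "Tr (y * dual k) \<in> P"
          unfolding Tr_def mult.commute[of y] by (intro submodule\<^sub>O_sum[OF PD(4)] conjP)
        moreover obtain z where z: "Tr (y * dual k) = of_int z"
          using Tr_Ints[of "y * dual k"] subsetD[OF PD(2) mem]
          by (auto simp: mult.commute elim!: Ints_cases)
        ultimately have "int q dvd z" using prime_int_mem[OF P(1,3,4)] by simp
        then obtain w where "z = int q * w" by (rule dvdE)
        then show ?thesis unfolding z by (intro exI[of _ w]) simp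
      qed
      then obtain z where z: "\<And>k. Tr (y * dual k) = of_nat q * of_int (z k)" by metis
      have "y * \<delta> = of_nat q * (\<Sum>k<p. of_int (z k) * \<theta> ^ k)"
        unfolding trace_expansion z by (simp only: sum_distrib_left mult.assoc)
      then show ?thesis
        unfolding principal_ideal_def
        using algebraic_int_combination[of z] by (intro image_eqI) simp_all
    qed
    then have "iprod (principal_ideal \<delta>) P \<subseteq> ipow P p"
      unfolding P(2) iprod_principal[OF PD(4)] by (auto simp: mult.commute)
    moreover have "p = Suc (Suc (p - 2))" using p_gt_2 by simp
    then have "ipow P p = iprod P (ipow P (Suc (p - 2)))"
      by (metis IG.nat_pow_Suc ideal_group_simps(2) iprod_commute)
    ultimately have "iprod P (principal_ideal \<delta>) \<subseteq> iprod P (ipow P (Suc (p - 2)))"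
      by (simp only: iprod_commute)
    then have "principal_ideal \<delta> \<subseteq> ipow P (Suc (p - 2))"
      by (rule iprod_cancel[OF PD(1) principal_fractional[OF \<delta>_nonzero] ipow_fractional[OF PD(1)]])
    also have "\<dots> \<subseteq> P" by (rule ipow_Suc_subset[OF PD(1,2)])
    finally have "\<delta> \<in> P" using self_mem_principal by blast
    moreover obtain w where w: "algebraic_int w" "Nm \<delta> = \<delta> * w"
      using Nm_cofactor[OF algebraic_int_\<delta>] by blast
    ultimately have "Nm \<delta> \<in> P"
      unfolding w(2) mult.commute[of \<delta>] by (intro submodule\<^sub>O_mult[OF PD(4)])
    then show ?thesis unfolding d by (rule prime_int_mem[OF P(1,3,4)])
  qed
  then have "ram \<subseteq> {..nat \<bar>d\<bar>}"
  proof (intro subsetI)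
    fix q assume "q \<in> ram"
    then have "\<bar>int q\<bar> \<le> \<bar>d\<bar>" using dvd_imp_le_int[OF d0] \<open>\<And>q. q \<in> ram \<Longrightarrow> int q dvd d\<close> by blast
    then show "q \<in> {..nat \<bar>d\<bar>}" by simp
  qed
  then show ?thesis by (rule finite_subset) simp
qed

text \<open>Exponent vectors are plain functions, so that they add and subtract pointwise;
  \<open>Jf_cong\<close> compares them on \<open>ram\<close>.\<close>

definition Jf :: "(nat \<Rightarrow> int) \<Rightarrow> 'L set" where
  "Jf a = ifinprod (\<lambda>q. izpow (rp q) (a q)) ram"

lemma Jf_fractional: "Jf a \<in> \<F>"
  unfolding Jf_def by (intro finprod_fractional izpow_fractional rp_fractional)

lemma Jf_add: "Jf (\<lambda>q. a q + b q) = iprod (Jf a) (Jf b)"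
proof -
  have "ifinprod (\<lambda>q. iprod (izpow (rp q) (a q)) (izpow (rp q) (b q))) ram = iprod (Jf a) (Jf b)"
    unfolding Jf_def
    using IG.finprod_multf[of "\<lambda>q. izpow (rp q) (a q)" ram "\<lambda>q. izpow (rp q) (b q)"]
    by (simp add: izpow_fractional rp_fractional Pi_def)
  moreover have "ifinprod (\<lambda>q. iprod (izpow (rp q) (a q)) (izpow (rp q) (b q))) ram = Jf (\<lambda>q. a q + b q)"
    unfolding Jf_def
  proof (rule IG.finprod_cong')
    fix q assume "q \<in> ram"
    then show "iprod (izpow (rp q) (a q)) (izpow (rp q) (b q)) = izpow (rp q) (a q + b q)"
      using G.int_pow_mult[of "rp q" "a q" "b q"] rp_fractional by simp
  qed (simp_all add: izpow_fractional rp_fractional Pi_def)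
  ultimately show ?thesis by simp
qed

lemma Jf_0: "Jf (\<lambda>_. 0) = \<O>"
  unfolding Jf_def int_pow_0 by (rule trans[OF IG.finprod_one_eqI]) simp_all

lemma Jf_cong: "(\<And>q. q \<in> ram \<Longrightarrow> a q = b q) \<Longrightarrow> Jf a = Jf b"
  unfolding Jf_def by (rule IG.finprod_cong') (simp_all add: izpow_fractional rp_fractional Pi_def)

lemma Jf_pow: "ipow (Jf a) n = Jf (\<lambda>q. int n * a q)"
proof (induction n)
  case (Suc n)
  then have "ipow (Jf a) (Suc n) = iprod (Jf (\<lambda>q. int n * a q)) (Jf a)" by simp
  also have "\<dots> = Jf (\<lambda>q. int (Suc n) * a q)" unfolding Jf_add[symmetric] by (simp add: algebra_simps)
  finally show ?case .
qed (simp add: Jf_0)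

lemma Jf_single:
  assumes "q \<in> ram"
  shows "Jf (\<lambda>r. if r = q then 1 else 0) = rp q"
proof -
  have "Jf (\<lambda>r. if r = q then 1 else 0) = ifinprod (\<lambda>r. if q = r then rp r else \<one>\<^bsub>ideal_group\<^esub>) ram"
    unfolding Jf_def
    by (rule IG.finprod_cong')
       (use rp_fractional in \<open>auto simp: Pi_def fractional_ideals_\<O> G.int_pow_1\<close>)
  also have "\<dots> = rp q"
    by (rule IG.finprod_singleton) (use assms finite_ram rp_fractional in \<open>auto simp: Pi_def\<close>)
  finally show ?thesis .
qed

definition ram_prod :: "(nat \<Rightarrow> int) \<Rightarrow> 'L" where
  "ram_prod c = (\<Prod>q\<in>ram. of_nat q powi c q)"

lemma ram_powi_nonzero: "q \<in> ram \<Longrightarrow> (of_nat q :: 'L) powi k \<noteq> 0"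
proof (rule power_int_not_zero)
  assume "q \<in> ram"
  then have "q \<noteq> 0" using prime_gt_0_nat[OF ram_prime] by blast
  then show "(of_nat q :: 'L) \<noteq> 0 \<or> k = 0" by simp
qed

lemma ram_prod_nonzero: "ram_prod c \<noteq> 0"
  unfolding ram_prod_def prod_zero_iff[OF finite_ram] using ram_powi_nonzero by blast

lemma ram_prod_Rats: "ram_prod c \<in> \<rat>"
proof -
  have "prod f A \<in> \<rat>" if "\<And>q. q \<in> A \<Longrightarrow> f q \<in> \<rat>" for f :: "nat \<Rightarrow> 'L" and A
    using that by (induction A rule: infinite_finite_induct) auto
  moreover have "(of_nat q :: 'L) powi k \<in> \<rat>" for q k
    by (simp add: power_int_def)
  ultimately show ?thesis by (simp add: ram_prod_def)
qed

lemma Jf_mult_p: "Jf (\<lambda>q. int p * c q) = principal_ideal (ram_prod c)"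
proof -
  have "Jf (\<lambda>q. int p * c q) = ifinprod (\<lambda>q. principal_ideal (of_nat q powi c q)) ram"
    unfolding Jf_def
  proof (rule IG.finprod_cong')
    fix q assume q: "q \<in> ram"
    have "izpow (rp q) (int p * c q) = izpow (izpow (rp q) (int p)) (c q)"
      using G.int_pow_pow[of "rp q" "int p" "c q"] rp_fractional[OF q] by simp
    also have "izpow (rp q) (int p) = principal_ideal (of_nat q)"
      by (simp add: int_pow_int rp_pow[OF q])
    also have "izpow (principal_ideal (of_nat q)) (c q) = principal_ideal (of_nat q powi c q)"
      by (rule principal_izpow) (use prime_gt_0_nat[OF ram_prime[OF q]] in simp)
    finally show "izpow (rp q) (int p * c q) = principal_ideal (of_nat q powi c q)" .
  next
    show "(\<lambda>q. principal_ideal ((of_nat q :: 'L) powi c q)) \<in> ram \<rightarrow> carrier ideal_group"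
      unfolding ideal_group_simps by (intro Pi_I principal_fractional ram_powi_nonzero)
  qed simp
  also have "\<dots> = principal_ideal (ram_prod c)"
    unfolding ram_prod_def by (rule principal_finprod[OF finite_ram ram_powi_nonzero])
  finally show ?thesis .
qed

lemma Jf_invariant: "\<sigma> ` Jf a = Jf a"
proof -
  have pow: "\<sigma> ` izpow (rp q) k = izpow (rp q) k" if q: "q \<in> ram" for q k
  proof (cases k rule: int_cases2)
    case (nonneg n)
    then show ?thesis
      using conj_image_ipow[OF rp_fractional[OF q], of 1 n] rp_invariant[OF q] by (simp add: int_pow_int)
  next
    case (nonpos n)
    define I where "I = ipow (rp q) n"
    have I: "I \<in> \<F>" "\<sigma> ` I = I"
      unfolding I_def using conj_image_ipow[OF rp_fractional[OF q], of 1 n] rp_invariant[OF q]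
      by (simp_all add: ipow_fractional rp_fractional q)
    have "\<sigma> ` iprod (iinv I) I = iprod (\<sigma> ` iinv I) (\<sigma> ` I)"
      using conj_image_iprod[of 1] by simp
    moreover have "\<sigma> ` (\<O> :: 'L set) = \<O>"
      using conj_image_principal[of 1 1] by (simp add: principal_ideal_1)
    ultimately have "iprod (\<sigma> ` iinv I) I = \<O>" using I by (simp add: iprod_iinv)
    moreover have "\<sigma> ` iinv I \<in> \<F>"
      using conj_image_fractional[OF iinv_fractional[OF I(1)], of 1] by simp
    ultimately have "iinv I = \<sigma> ` iinv I" using I(1) by (intro G.inv_equality) simp_all
    then show ?thesis using nonpos rp_fractional[OF q] by (simp add: G.int_pow_neg_int I_def)
  qed
  have "\<sigma> ` ifinprod (\<lambda>q. izpow (rp q) (a q)) A = ifinprod (\<lambda>q. izpow (rp q) (a q)) A"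
    if "finite A" "A \<subseteq> ram" for A
    using that
  proof (induction A rule: finite_induct)
    case empty
    show ?case using conj_image_principal[of 1 1] by (simp add: principal_ideal_1)
  next
    case (insert q A)
    have "ifinprod (\<lambda>q. izpow (rp q) (a q)) (insert q A)
      = iprod (izpow (rp q) (a q)) (ifinprod (\<lambda>q. izpow (rp q) (a q)) A)"
      using insert.hyps insert.prems
      by (subst IG.finprod_insert) (auto simp: Pi_def intro!: izpow_fractional rp_fractional)
    then show ?case
      using insert conj_image_iprod[of 1] pow by simp
  qed
  then show ?thesis unfolding Jf_def using finite_ram by simp
qed

text \<open>Upward induction along invariant divisors. Above \<open>J\<close> lies a prime
  \<open>P\<close>; the invariant ideal split off is \<open>(q)\<close> if \<open>P = (q)\<close>,
  the prime itself if \<open>P ^ p = (q)\<close>, and the norm \<open>(q ^ f)\<close> of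
  \<open>P\<close> if \<open>P\<close> is not invariant. The quotient is invariant by cancellation
  and strictly larger than \<open>J\<close>.\<close>

lemma invariant_integral_ideal:
  assumes "J \<in> \<F>" "J \<subseteq> \<O>" "\<sigma> ` J = J"
  shows "\<exists>n>0. \<exists>a. J = iprod (principal_ideal (of_nat n)) (Jf a)"
  using assms
proof (induction rule: ideal_induct)
  case (step J)
  show ?case
  proof (cases "1 \<in> J")
    case True
    then have "J = iprod (principal_ideal (of_nat 1)) (Jf (\<lambda>_. 0))"
      using integral_1_mem[OF step(1,2)] by (simp add: principal_ideal_1 Jf_0 iprod_\<O>_left fractional_ideals_\<O>)
    then show ?thesis by blast
  next
    case False
    then obtain P where P: "prime_id P" "J \<subseteq> P" using exists_prime_above[OF step(1,2)] by blast
    note PD = prime_idD[OF P(1)]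
    obtain q where q: "Factorial_Ring.prime q" "of_nat q \<in> P" by (rule prime_contains_prime[OF P(1)])
    have q0: "(of_nat q :: 'L) \<noteq> 0" "q > 0" using q(1) by (auto simp: prime_gt_0_nat)
    \<comment> \<open>In every case \<open>J\<close> is divisible by an invariant ideal of the required form.\<close>
    have key: ?thesis if B: "B \<in> \<F>" "B \<subseteq> P" "\<sigma> ` B = B" "J \<subseteq> B"
      "B = iprod (principal_ideal (of_nat m)) (Jf b)" "m > 0" for B m b
    proof -
      have BO: "B \<subseteq> \<O>" using B(2) PD(2) by blast
      obtain K where K: "K \<in> \<F>" "K \<subseteq> \<O>" "J = iprod B K" by (rule ideal_dvd[OF step(1) B(1,4)])
      have "iprod B (\<sigma> ` K) = iprod B K"
        using conj_image_iprod[of 1 B K] step.prems B(3) K(3) by simp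
      moreover have "\<sigma> ` K \<in> \<F>" using conj_image_fractional[OF K(1), of 1] by simp
      ultimately have inv: "\<sigma> ` K = K"
        using iprod_cancel[OF B(1) _ K(1)] iprod_cancel[OF B(1) K(1)] by (metis subset_antisym subset_refl)
      have "J \<subseteq> K" unfolding K(3) iprod_commute[of B] by (rule iprod_subset_left[OF K(1) BO])
      moreover have "J \<noteq> K"
      proof
        assume "J = K"
        then have "\<O> \<subseteq> B" using iprod_absorb[OF K(1) B(1)] K(3) by simp
        then show False using prime_not_above[OF P(1)] B(2) by blast
      qed
      ultimately have "J \<subset> K" by blast
      from step.IH[OF K(1,2) this inv] obtain n a where na: "n > 0" "K = iprod (principal_ideal (of_nat n)) (Jf a)"
        by blast
      have "J = iprod (iprod (principal_ideal (of_nat m)) (principal_ideal (of_nat n))) (iprod (Jf b) (Jf a))"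
        unfolding K(3) B(5) na(2) by (metis iprod_assoc iprod_commute)
      also have "\<dots> = iprod (principal_ideal (of_nat (m * n))) (Jf (\<lambda>q. b q + a q))"
        by (simp add: principal_mult Jf_add)
      finally show ?thesis using B(6) na(1) by (metis nat_0_less_mult_iff)
    qed
    have principal: "principal_ideal (of_nat m) = iprod (principal_ideal (of_nat m)) (Jf (\<lambda>_. 0))"
      if "m > 0" for m
      using that by (simp add: Jf_0 iprod_\<O>_right principal_fractional)
    show ?thesis
    proof (cases "\<sigma> ` P = P")
      case True
      from invariant_prime[OF P(1) True q] show ?thesis
      proof
        assume "P = principal_ideal (of_nat q)"
        then show ?thesis using key[OF PD(1) subset_refl True P(2)] principal[OF q0(2)] q0(2) by metis
      next
        assume "ipow P p = principal_ideal (of_nat q)"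
        then have ram: "q \<in> ram" using P(1) q(1) by (auto simp: ram_def)
        have "P = iprod (principal_ideal (of_nat 1)) (Jf (\<lambda>r. if r = q then 1 else 0))"
          unfolding Jf_single[OF ram] rp_unique[OF ram P(1) q(2)]
          by (simp add: principal_ideal_1 iprod_\<O>_left PD(1))
        from key[OF PD(1) subset_refl True P(2) this] show ?thesis by simp
      qed
    next
      case False
      obtain f where f: "f \<ge> 1" "Nid P = principal_ideal (of_nat (q ^ f))"
        by (rule Nid_prime[OF P(1) q])
      have "J \<subseteq> principal_ideal (of_nat (q ^ f))"
        using noninvariant_prime[OF P(1) False step(1,2) step.prems P(2)] unfolding f(2) .
      moreover have "principal_ideal (of_nat (q ^ f)) \<subseteq> P"
      proof (rule principal_subset[OF PD(4)])
        obtain f' where "f = Suc f'" using f(1) by (cases f) auto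
        then show "of_nat (q ^ f) \<in> P"
          using submodule\<^sub>O_mult[OF PD(4), of "of_nat (q ^ f')" "of_nat q"] q(2)
          by (simp add: mult.commute algebraic_int_power)
      qed
      moreover have "(of_nat (q ^ f) :: 'L) \<noteq> 0" "q ^ f > 0" using q0 by simp_all
      ultimately show ?thesis
        using key[OF principal_fractional _ principal_nat_invariant _ principal] by blast
    qed
  qed
qed

lemma invariant_ideal:
  assumes "J \<in> \<F>" "\<sigma> ` J = J"
  obtains r a where "r \<in> \<rat>" "r \<noteq> 0" "J = iprod (principal_ideal r) (Jf a)"
proof -
  obtain d where d: "algebraic_int d" "d \<noteq> 0" "(*) d ` J \<subseteq> \<O>"
    using assms(1) by (auto simp: fractional_ideals_iff)
  obtain e where e: "algebraic_int e" "Nm d = d * e" using Nm_cofactor[OF d(1)] by blast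
  \<comment> \<open>Multiplying by the norm of \<open>d\<close> instead of \<open>d\<close> itself
    keeps the ideal invariant, because the norm is rational.\<close>
  define N where "N = Nm d"
  have N: "N \<noteq> 0" "N \<in> \<rat>" using d(2) Nm_Rats by (simp_all add: N_def)
  have \<sigma>N: "\<sigma> N = N" using conj_Rats[OF N(2), of 1] by simp
  define I where "I = (*) N ` J"
  have "I \<in> \<F>" unfolding I_def by (rule mult_image_fractional[OF assms(1) N(1)])
  moreover have "I \<subseteq> \<O>"
  proof
    fix x assume "x \<in> I"
    then obtain y where y: "y \<in> J" "x = e * (d * y)"
      unfolding I_def N_def e(2) by (auto simp: mult_ac)
    then have "algebraic_int (d * y)" using d(3) by auto
    then show "x \<in> \<O>" using y(2) e(1) by (simp add: algebraic_int_mult)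
  qed
  moreover have "\<sigma> ` I = I"
    using conj_image_mult[of 1 N J] assms(2) \<sigma>N by (simp add: I_def)
  ultimately obtain n a where na: "n > 0" "I = iprod (principal_ideal (of_nat n)) (Jf a)"
    using invariant_integral_ideal by blast
  note subJ = fractional_ideal_submodule[OF assms(1)]
  have "J = (*) (inverse N) ` I" using N(1) by (simp add: I_def image_image mult.assoc[symmetric])
  also have "\<dots> = iprod (principal_ideal (inverse N)) I"
    using \<open>I \<in> \<F>\<close> by (intro iprod_principal[symmetric] fractional_ideal_submodule)
  also have "\<dots> = iprod (principal_ideal (inverse N * of_nat n)) (Jf a)"
    unfolding na(2) by (simp add: iprod_assoc[symmetric] principal_mult)
  finally show thesis using that[of "inverse N * of_nat n" a] N na(1) by simp
qed

lemma principal_rational_eq: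
  assumes "principal_ideal x = principal_ideal y" "x \<in> \<rat>" "y \<in> \<rat>" "x \<noteq> (0 :: 'L)" "y \<noteq> 0"
  shows "x = y \<or> x = - y"
proof -
  have "algebraic_int (x / y)" "algebraic_int (y / x)"
    using assms self_mem_principal[of x] self_mem_principal[of y] mem_principal_ideal by metis+
  then obtain k l where kl: "x / y = of_int k" "y / x = of_int l"
    using rational_algebraic_int_is_int assms(2,3) by (metis Ints_cases Rats_divide)
  have "(of_int (k * l) :: 'L) = (x / y) * (y / x)" by (simp add: kl)
  also have "\<dots> = of_int 1" using assms(4,5) by simp
  finally have "k * l = 1" by (simp only: of_int_eq_iff)
  then have "k = 1 \<or> k = - 1" by (metis zmult_eq_1_iff)
  then show ?thesis using kl(1) assms(5) by (auto simp: field_simps)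
qed

text \<open>Removing multiples of \<open>p\<close> leaves exponents \<open>b q < p\<close> and a
  rational generator \<open>x\<close>. Then \<open>(x ^ p)\<close> is generated by the product of
  the \<open>q ^ b q\<close>, so \<open>x\<close> is an integer and \<open>b q\<close>, the
  multiplicity of \<open>q\<close> in a \<open>p\<close>-th power, is divisible by \<open>p\<close>,
  hence 0.\<close>

lemma Jf_rational_principal:
  assumes "r \<in> \<rat>" "r \<noteq> 0" "Jf a = principal_ideal r" "q \<in> ram"
  shows "int p dvd a q"
proof -
  define b where "b q = nat (a q mod int p)" for q
  define c where "c q = a q div int p" for q
  have p0: "int p > 0" using p_gt_2 by simp
  have ab: "a q = int p * c q + int (b q)" for q using p0 by (simp add: b_def c_def)
  have bp: "b q < p" for q using pos_mod_bound[OF p0, of "a q"] pos_mod_sign[OF p0, of "a q"] by (simp add: b_def nat_less_iff)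
  define t where "t = ram_prod c"
  have t: "t \<noteq> 0" "t \<in> \<rat>" unfolding t_def by (rule ram_prod_nonzero, rule ram_prod_Rats)
  have "principal_ideal r = iprod (principal_ideal t) (Jf (\<lambda>q. int (b q)))"
    unfolding assms(3)[symmetric] t_def Jf_mult_p[symmetric] Jf_add[symmetric] by (simp only: ab[symmetric])
  then have "iprod (principal_ideal (inverse t)) (principal_ideal r)
    = iprod (principal_ideal (inverse t)) (iprod (principal_ideal t) (Jf (\<lambda>q. int (b q))))" by simp
  also have "\<dots> = Jf (\<lambda>q. int (b q))"
    using t(1) by (simp add: iprod_assoc[symmetric] principal_mult principal_ideal_1 iprod_\<O>_left Jf_fractional)
  finally have J: "Jf (\<lambda>q. int (b q)) = principal_ideal (inverse t * r)" by (simp only: principal_mult)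
  define x where "x = inverse t * r"
  have x: "x \<in> \<rat>" "x \<noteq> 0" using t assms(1,2) by (simp_all add: x_def)
  define m where "m = (\<Prod>q\<in>ram. q ^ b q)"
  have m0: "m > 0" using finite_ram ram_prime by (auto simp: m_def prime_gt_0_nat)
  have "principal_ideal (x ^ p) = ipow (Jf (\<lambda>q. int (b q))) p"
    unfolding J x_def[symmetric] by (rule principal_pow[OF x(2), symmetric])
  also have "\<dots> = principal_ideal (ram_prod (\<lambda>q. int (b q)))" unfolding Jf_pow by (rule Jf_mult_p)
  also have "ram_prod (\<lambda>q. int (b q)) = of_nat m" by (simp add: ram_prod_def m_def)
  finally have eq: "principal_ideal (x ^ p) = principal_ideal (of_nat m)" .
  then have xm: "x ^ p = of_nat m \<or> x ^ p = - of_nat m"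
    using x m0 by (intro principal_rational_eq) auto
  have ai: "algebraic_int (x ^ p)" using xm by auto
  \<comment> \<open>\<open>x\<close> is integral as a root of \<open>X ^ p - x ^ p\<close>; the sum
    writes this relation with a single nonzero coefficient, at \<open>j = 0\<close>.\<close>
  have "x ^ p = (\<Sum>j<p. (if j = 0 then x ^ p else 0) * x ^ j)"
    using p_gt_2 by (simp add: sum.delta if_distrib[of "\<lambda>z. z * _"] cong: if_cong)
  then have "algebraic_int x" by (rule algebraic_int_monic_relation) (use ai in simp)
  then obtain z where z: "x = of_int z"
    using rational_algebraic_int_is_int x(1) by (metis Ints_cases)
  have "(of_int (z ^ p) :: 'L) = of_int (int m) \<or> (of_int (z ^ p) :: 'L) = of_int (- int m)"
    using xm by (simp add: z)
  then have "z ^ p = int m \<or> z ^ p = - int m" by (simp only: of_int_eq_iff)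
  then have "\<bar>z ^ p\<bar> = int m" by auto
  then have "int (nat \<bar>z\<bar> ^ p) = int m" by (simp add: power_abs)
  then have zm: "nat \<bar>z\<bar> ^ p = m" by (simp only: of_nat_eq_iff)
  have qp: "Factorial_Ring.prime q" by (rule ram_prime[OF assms(4)])
  have "multiplicity q m = b q"
    unfolding m_def using assms(4) finite_ram qp ram_prime by (subst multiplicity_prod_prime_powers) auto
  moreover have "nat \<bar>z\<bar> \<noteq> 0" using m0 zm p_gt_2 by (metis gr_implies_not_zero zero_power less_trans zero_less_numeral)
  then have "multiplicity q (nat \<bar>z\<bar> ^ p) = p * multiplicity q (nat \<bar>z\<bar>)"
    using qp by (intro prime_elem_multiplicity_power_distrib) auto
  ultimately have "p * multiplicity q (nat \<bar>z\<bar>) = b q" using zm by simp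
  then have "b q = 0" using bp[of q] by (metis mult_0_right mult_is_0 nat_mult_le_cancel1 not_less not_gr_zero le_add1 mult_Suc_right gr0_conv_Suc)
  then show ?thesis using ab[of q] by simp
qed


section \<open>Hilbert's Theorem 90 and invariant ideal classes\<close>

text \<open>The resolvent \<open>b c\<close> satisfies \<open>u * \<sigma> (b c) = b c\<close>, and
  \<open>x\<close> is the inverse of a nonzero one. Some \<open>b (dual k)\<close> is nonzero, since
  their combination with the powers of \<open>\<theta>\<close> is \<open>\<delta>\<close>; this is
  an explicit form of the independence of characters.\<close>

lemma hilbert90:
  assumes "Nm u = 1"
  obtains x where "x \<noteq> 0" "u = T x"
proof -
  define A where "A i = (\<Prod>j<i. conj j u)" for i
  define b where "b c = (\<Sum>i<p. A i * conj i c)" for c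
  have AS: "u * \<sigma> (A i) = A (Suc i)" for i
    by (simp add: A_def \<sigma>_prod prod.lessThan_Suc_shift del: prod.lessThan_Suc)
  have "u * \<sigma> (b c) = b c" for c
  proof -
    have "u * \<sigma> (b c) = (\<Sum>i<p. A (Suc i) * conj (Suc i) c)"
      by (simp add: b_def \<sigma>_sum sum_distrib_left mult.assoc[symmetric] AS)
    also have "\<dots> + A 0 * conj 0 c = (\<Sum>i<Suc p. A i * conj i c)"
      by (simp only: sum.lessThan_Suc_shift add.commute)
    also have "\<dots> = b c + A p * conj p c" by (simp add: b_def)
    also have "A p = A 0" using assms by (simp add: A_def Nm_def)
    finally show ?thesis by (simp add: \<sigma>_period)
  qed
  moreover have "\<exists>c. b c \<noteq> 0"
  proof (rule ccontr)
    assume "\<not> ?thesis"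
    then have "0 = (\<Sum>k<p. b (dual k) * \<theta> ^ k)" by simp
    also have "\<dots> = (\<Sum>k<p. \<Sum>i<p. A i * (conj i (dual k) * \<theta> ^ k))"
      by (simp add: b_def sum_distrib_right mult.assoc)
    also have "\<dots> = (\<Sum>i<p. A i * (\<Sum>k<p. conj i (dual k) * \<theta> ^ k))"
      by (subst sum.swap) (simp add: sum_distrib_left)
    also have "\<dots> = (\<Sum>i<p. if i = 0 then \<delta> else 0)"
      by (rule sum.cong) (simp_all add: dual_orthogonal A_def del: funpow.simps)
    also have "\<dots> = \<delta>" using p_gt_2 by (simp add: sum.delta)
    finally show False using \<delta>_nonzero by simp
  qed
  ultimately obtain c where c: "b c \<noteq> 0" "u * \<sigma> (b c) = b c" by blast
  show thesis
  proof (rule that[of "inverse (b c)"])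
    show "u = T (inverse (b c))" using c by (simp add: T_def field_simps)
  qed (use c in simp)
qed

lemma principal_iprod_cancel:
  assumes "I \<in> \<F>" "J \<in> \<F>" "a \<noteq> 0" "iprod (principal_ideal a) I = iprod (principal_ideal a) J"
  shows "I = J"
  using iprod_cancel[OF principal_fractional[OF assms(3)] assms(1,2)]
    iprod_cancel[OF principal_fractional[OF assms(3)] assms(2,1)] assms(4) by blast

lemma principal_eq_\<O>: "x \<noteq> 0 \<Longrightarrow> principal_ideal x = (\<O> :: 'L set) \<Longrightarrow> algebraic_int x \<and> algebraic_int (inverse x)"
  using self_mem_principal[of x] mem_principal_ideal[of x 1] by (simp add: divide_inverse)

lemma principal_unit:
  "algebraic_int x \<Longrightarrow> algebraic_int (inverse x) \<Longrightarrow> x \<noteq> 0 \<Longrightarrow> principal_ideal x = (\<O> :: 'L set)"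
  by (rule integral_1_mem[OF principal_fractional principal_integral])
     (simp_all add: mem_principal_ideal divide_inverse)

lemma invariant_class_representative:
  assumes I: "I \<in> \<F>" and a: "a \<noteq> 0" "\<sigma> ` I = iprod (principal_ideal a) I"
  obtains b where "b \<noteq> 0" "\<sigma> ` iprod (principal_ideal b) I = iprod (principal_ideal b) I"
proof -
  \<comment> \<open>Iterating \<open>\<sigma> I = (a) I\<close> produces the partial norms of
    \<open>a\<close>; at \<open>i = p\<close> this reads \<open>I = (Nm a) I\<close>, so
    \<open>Nm a\<close> generates the unit ideal and is 1 or -1.\<close>
  have conjI: "conj i ` I = iprod (principal_ideal (\<Prod>j<i. conj j a)) I" for i
  proof (induction i)
    case 0
    then show ?case by (simp add: principal_ideal_1 iprod_\<O>_left I)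
  next
    case (Suc i)
    have "conj (Suc i) ` I = conj i ` \<sigma> ` I" by (simp add: image_image conj_\<sigma>)
    also have "\<dots> = iprod (principal_ideal (conj i a)) (conj i ` I)"
      by (simp add: a(2) conj_image_iprod conj_image_principal)
    also have "\<dots> = iprod (principal_ideal (\<Prod>j<Suc i. conj j a)) I"
      unfolding Suc.IH iprod_assoc[symmetric] principal_mult by (simp add: mult.commute)
    finally show ?case .
  qed
  have N: "Nm a \<noteq> 0" using a(1) by simp
  have "conj p ` I = I" by (simp add: \<sigma>_period image_def)
  then have "iprod I (principal_ideal (Nm a)) = iprod I \<O>"
    using conjI[of p] by (simp add: Nm_def[symmetric] iprod_\<O>_left I iprod_commute[of I])
  then have "principal_ideal (Nm a) = \<O>"
    using iprod_cancel[OF I principal_fractional[OF N] fractional_ideals_\<O>]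
      iprod_cancel[OF I fractional_ideals_\<O> principal_fractional[OF N]] by blast
  then have "principal_ideal (Nm a) = principal_ideal 1" by (simp add: principal_ideal_1)
  then have "Nm a = 1 \<or> Nm a = - 1" using N Nm_Rats by (intro principal_rational_eq) simp_all
  then obtain a' where a': "Nm a' = 1" "principal_ideal a' = principal_ideal a"
  proof
    assume "Nm a = - 1"
    moreover have "principal_ideal (- a) = principal_ideal a"
    proof -
      have "principal_ideal (- a) = iprod (principal_ideal (- 1)) (principal_ideal a)"
        by (simp add: principal_mult)
      also have "principal_ideal (- 1) = (\<O> :: 'L set)" by (rule principal_unit) simp_all
      finally show ?thesis using a(1) by (simp add: iprod_\<O>_left principal_fractional)
    qed
    ultimately show thesis using that[of "- a"] by simp
  qed (use that[of a] in simp)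
  obtain x where x: "x \<noteq> 0" "a' = T x" using hilbert90[OF a'(1)] by blast
  have "\<sigma> ` iprod (principal_ideal (inverse x)) I
      = iprod (principal_ideal (inverse (\<sigma> x))) (iprod (principal_ideal (T x)) I)"
    using conj_image_iprod[of 1] conj_image_principal[of 1 "inverse x"] by (simp add: a(2) a'(2)[symmetric] x(2))
  also have "\<dots> = iprod (principal_ideal (inverse x)) I"
    using x(1) unfolding iprod_assoc[symmetric] principal_mult by (simp add: T_def inverse_eq_divide)
  finally show thesis using that[of "inverse x"] x(1) by simp
qed

section \<open>Relations between the ramified primes\<close>

lemma Jf_diff:
  assumes "Jf a = principal_ideal x" "Jf b = principal_ideal y" "x \<noteq> 0" "y \<noteq> 0"
  shows "Jf (\<lambda>q. a q - b q) = principal_ideal (x / y)"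
proof -
  have "iprod (principal_ideal y) (Jf (\<lambda>q. a q - b q)) = Jf (\<lambda>q. b q + (a q - b q))"
    unfolding assms(2)[symmetric] Jf_add[symmetric] ..
  also have "\<dots> = iprod (principal_ideal y) (principal_ideal (x / y))"
    using assms(1,4) by (simp add: principal_mult)
  finally show ?thesis
    by (rule principal_iprod_cancel[rotated 3]) (use assms in \<open>simp_all add: Jf_fractional principal_fractional\<close>)
qed

lemma T_of_invariant_principal:
  assumes "x \<noteq> 0" "\<sigma> ` principal_ideal x = principal_ideal x"
  shows "T x \<in> U1"
proof -
  have eq: "principal_ideal (\<sigma> x) = principal_ideal x"
    using assms(2) conj_image_principal[of 1 x] by simp
  have "\<sigma> x \<in> principal_ideal x" using self_mem_principal[of "\<sigma> x"] unfolding eq .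
  then have "algebraic_int (T x)" using assms(1) by (simp add: mem_principal_ideal T_def)
  moreover have "Nm (T x) = 1" using assms(1) by (simp add: T_def)
  ultimately show ?thesis by (simp add: U1_def)
qed

text \<open>A principal ideal \<open>Jf a = (x)\<close> gives the unit \<open>T x\<close>, determined modulo \<open>T U1\<close> by \<open>Jf a\<close>;
  conversely, by Hilbert's Theorem 90, every unit of norm one arises from an invariant principal ideal.\<close>

lemma card_relations:
  assumes "finite A" "\<And>a. a \<in> A \<Longrightarrow> \<exists>x. x \<noteq> 0 \<and> Jf a = principal_ideal x"
    and incongruent: "\<And>a b. a \<in> A \<Longrightarrow> b \<in> A \<Longrightarrow> (\<And>q. q \<in> ram \<Longrightarrow> int p dvd a q - b q) \<Longrightarrow> a = b"
  shows "card A \<le> p"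
proof -
  obtain x where x: "\<And>a. a \<in> A \<Longrightarrow> x a \<noteq> 0 \<and> Jf a = principal_ideal (x a)"
    using assms(2) by metis
  have U: "T (x a) \<in> U1" if "a \<in> A" for a
    using x[OF that] Jf_invariant[of a] by (intro T_of_invariant_principal) auto
  have key: "a = b" if ab: "a \<in> A" "b \<in> A" and m: "m \<in> U1" "T (x a) = T (x b) * T m" for a b m
  proof (rule incongruent[OF ab])
    fix q assume q: "q \<in> ram"
    have nz: "x a \<noteq> 0" "x b \<noteq> 0" "m \<noteq> 0" using x ab U1_nonzero[OF m(1)] by auto
    \<comment> \<open>Here \<open>T r = 1\<close>, so \<open>r\<close> is rational. As
      \<open>m\<close> is a unit, \<open>Jf\<close> of the difference of \<open>a\<close> and
      \<open>b\<close> is generated by \<open>r\<close>, and then \<open>p\<close> divides all its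
      exponents.\<close>
    define r where "r = x a / (x b * m)"
    have "T (x b) * T m \<noteq> 0" using nz by (simp add: T_def)
    then have "T r = 1" unfolding r_def T_divide T_mult m(2) by simp
    then have r: "r \<in> \<rat>" "r \<noteq> 0" using nz by (auto intro: T_eq_1 simp: r_def)
    have "Jf (\<lambda>q. a q - b q) = principal_ideal (x a / x b)" by (rule Jf_diff) (use x ab in auto)
    also have "x a / x b = m * r" using nz by (simp add: r_def)
    also have "principal_ideal (m * r) = iprod (principal_ideal m) (principal_ideal r)"
      by (simp add: principal_mult)
    also have "principal_ideal m = \<O>"
      using m(1) U1_inverse[OF m(1)] nz(3) by (intro principal_unit) (simp_all add: U1_def)
    finally have J: "Jf (\<lambda>q. a q - b q) = principal_ideal r"
      using r(2) by (simp add: iprod_\<O>_left principal_fractional)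
    show "int p dvd a q - b q" using Jf_rational_principal[OF r J q] by simp
  qed
  have inj: "inj_on (\<lambda>a. T (x a)) A"
    by (rule inj_onI) (rule key[OF _ _ U1_1]; simp)
  have "incong T ((\<lambda>a. T (x a)) ` A)"
    unfolding incong_def
  proof (intro conjI ballI impI)
    show "(\<lambda>a. T (x a)) ` A \<subseteq> U1" using U by (rule image_subsetI)
    show "finite ((\<lambda>a. T (x a)) ` A)" using assms(1) by simp
    fix u v m assume "u \<in> (\<lambda>a. T (x a)) ` A" "v \<in> (\<lambda>a. T (x a)) ` A" "m \<in> U1" and eq: "u = v * T m"
    then obtain a b where ab: "a \<in> A" "b \<in> A" "u = T (x a)" "v = T (x b)" by blast
    then have "a = b" using key[OF ab(1,2) \<open>m \<in> U1\<close>] eq by simp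
    then show "u = v" using ab by simp
  qed
  from card_incong_T[OF this] show ?thesis by (simp add: card_image[OF inj])
qed

lemma exists_relation:
  obtains a x q where "x \<noteq> 0" "Jf a = principal_ideal x" "q \<in> ram" "\<not> int p dvd a q"
proof -
  obtain u where u: "u \<in> U1" "\<And>v. v \<in> U1 \<Longrightarrow> u \<noteq> T v" using T_not_surj by blast
  obtain y where y: "y \<noteq> 0" "u = T y" using hilbert90[of u] u(1) by (auto simp: U1_def)
  have "principal_ideal (\<sigma> y) = principal_ideal (u * y)" using y by (simp add: T_def)
  also have "\<dots> = iprod (principal_ideal u) (principal_ideal y)" by (simp add: principal_mult)
  also have "principal_ideal u = \<O>"
    using u(1) U1_inverse[OF u(1)] U1_nonzero by (intro principal_unit) (simp_all add: U1_def)
  finally have "\<sigma> ` principal_ideal y = principal_ideal y"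
    using conj_image_principal[of 1 y] y(1) by (simp add: iprod_\<O>_left principal_fractional)
  then obtain r a where r: "r \<in> \<rat>" "r \<noteq> 0" "principal_ideal y = iprod (principal_ideal r) (Jf a)"
    using invariant_ideal[OF principal_fractional[OF y(1)]] by blast
  have "iprod (principal_ideal r) (Jf a) = iprod (principal_ideal r) (principal_ideal (y / r))"
    using r by (simp add: principal_mult)
  then have Ja: "Jf a = principal_ideal (y / r)"
    by (rule principal_iprod_cancel[rotated 3]) (use r y in \<open>simp_all add: Jf_fractional principal_fractional\<close>)
  have "\<exists>q\<in>ram. \<not> int p dvd a q"
  proof (rule ccontr)
    assume "\<not> ?thesis"
    then obtain c where c: "\<And>q. q \<in> ram \<Longrightarrow> a q = int p * c q" unfolding dvd_def by metis
    define t where "t = ram_prod c"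
    have t: "t \<noteq> 0" "t \<in> \<rat>" unfolding t_def by (rule ram_prod_nonzero, rule ram_prod_Rats)
    have "principal_ideal (y / r) = principal_ideal t"
      unfolding Ja[symmetric] t_def Jf_mult_p[symmetric] by (rule Jf_cong) (rule c)
    define v where "v = y / (r * t)"
    have v0: "v \<noteq> 0" using y r t by (simp add: v_def)
    have yv: "y / r = t * v" using r t by (simp add: v_def)
    have "iprod (principal_ideal t) (principal_ideal v) = iprod (principal_ideal t) \<O>"
      using \<open>principal_ideal (y / r) = principal_ideal t\<close> t(1)
      by (simp add: principal_mult yv iprod_\<O>_right principal_fractional)
    then have "principal_ideal v = \<O>"
      by (rule principal_iprod_cancel[rotated 3]) (use t v0 in \<open>simp_all add: principal_fractional fractional_ideals_\<O>\<close>)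
    then have "v \<in> U1 \<or> - v \<in> U1" using principal_eq_\<O>[OF v0] v0 by (intro U1_unit) auto
    moreover have "T v = u"
    proof -
      have "\<sigma> r = r" "\<sigma> t = t" using conj_Rats[of _ 1] r t by auto
      then have "T r = 1" "T t = 1" using r t by (simp_all add: T_def)
      then show ?thesis by (simp add: v_def T_divide T_mult y(2))
    qed
    moreover have "T (- v) = T v" by (simp add: T_def)
    ultimately show False using u(2) by metis
  qed
  then show thesis using that[of "y / r" a] Ja y r by auto
qed

lemma mult_dvd_p: "int p dvd i * k \<Longrightarrow> \<not> int p dvd k \<Longrightarrow> int p dvd i"
  using prime_p by (metis prime_dvd_mult_iff prime_int_nat_transfer prime_nat_int_transfer)

text \<open>The multiples \<open>i * a\<close> with \<open>i < p\<close> are \<open>p\<close>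
  relations that differ modulo \<open>p\<close> already at \<open>q0\<close>. A relation
  \<open>d\<close> that vanishes modulo \<open>p\<close> at \<open>q0\<close> but not everywhere
  would be incongruent to each of them, one relation more than \<open>card_relations\<close>
  permits.\<close>

lemma relation_unique:
  assumes a: "x \<noteq> 0" "Jf a = principal_ideal x" "q0 \<in> ram" "\<not> int p dvd a q0"
    and d: "z \<noteq> 0" "Jf d = principal_ideal z" "int p dvd d q0" and q: "q \<in> ram"
  shows "int p dvd d q"
proof (rule ccontr)
  assume ndvd: "\<not> int p dvd d q"
  define m where "m i = (\<lambda>q. int i * a q)" for i
  have small: "i = j" if "i < p" "j < p" "int p dvd int i - int j" for i j
    using that by (metis int_int_eq mod_eq_dvd_iff mod_less of_nat_mod)
  have mm: "i = j" if "i < p" "j < p" "int p dvd m i q0 - m j q0" for i j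
  proof -
    have "int p dvd (int i - int j) * a q0" using that(3) by (simp add: m_def left_diff_distrib)
    then have "int p dvd int i - int j" using a(4) by (rule mult_dvd_p)
    then show ?thesis using that by (intro small)
  qed
  have md: False if "i < p" "\<And>q. q \<in> ram \<Longrightarrow> int p dvd m i q - d q" for i
  proof -
    have "int p dvd (m i q0 - d q0) + d q0" by (rule dvd_add[OF that(2)[OF a(3)] d(3)])
    then have "int p dvd m i q0" by simp
    then have "i = 0" using mm[of i 0] that(1) p_gt_2 by (simp add: m_def)
    then have "int p dvd d q" using that(2)[OF q] by (simp add: m_def)
    then show False using ndvd by simp
  qed
  have "card (insert d (m ` {..<p})) \<le> p"
  proof (rule card_relations)
    fix b assume "b \<in> insert d (m ` {..<p})"
    then consider "b = d" | i where "b = m i" by blast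
    then show "\<exists>x. x \<noteq> 0 \<and> Jf b = principal_ideal x"
    proof cases
      case 2
      have "Jf b = principal_ideal (x ^ i)"
        unfolding 2 m_def Jf_pow[symmetric] a(2) by (rule principal_pow[OF a(1)])
      then show ?thesis using a(1) by (intro exI[of _ "x ^ i"]) simp
    qed (use d in auto)
  next
    fix b c assume bc: "b \<in> insert d (m ` {..<p})" "c \<in> insert d (m ` {..<p})"
      and dvd: "\<And>q. q \<in> ram \<Longrightarrow> int p dvd b q - c q"
    have dvd': "int p dvd c q - b q" if "q \<in> ram" for q
      using dvd[OF that] by (metis dvd_minus_iff minus_diff_eq)
    from bc consider "b = d" "c = d" | i where "i < p" "b = m i" "c = d" | i where "i < p" "c = m i" "b = d"
      | i j where "i < p" "j < p" "b = m i" "c = m j" by auto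
    then show "b = c"
    proof cases
      case 2
      then show ?thesis using md[of i] dvd by blast
    next
      case 3
      then show ?thesis using md[of i] dvd' by blast
    next
      case 4
      then show ?thesis using mm[of i j] dvd[OF a(3)] by auto
    qed simp
  qed simp
  moreover have "inj_on m {..<p}" using mm by (intro inj_onI) auto
  then have "card (m ` {..<p}) = p" by (simp add: card_image)
  moreover have "d \<notin> m ` {..<p}"
  proof
    assume "d \<in> m ` {..<p}"
    then obtain i where i: "i < p" "d = m i" by auto
    from md[OF i(1)] i(2) show False by simp
  qed
  ultimately show False by simp
qed

section \<open>The class group\<close>

abbreviation H :: "'L set set" where "H \<equiv> principal_ideal ` (UNIV - {0})"

definition cls :: "'L set \<Rightarrow> 'L set set" where "cls I = H #>\<^bsub>ideal_group\<^esub> I"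

lemma subgroup_H: "subgroup H ideal_group"
proof (rule G.subgroupI)
  show "H \<subseteq> carrier ideal_group" using principal_fractional by auto
  have "principal_ideal 1 \<in> H" by (rule imageI) simp
  then show "H \<noteq> {}" by (metis empty_iff)
next
  fix I assume "I \<in> H"
  then obtain x where x: "x \<noteq> 0" "I = principal_ideal x" by auto
  have "iprod (principal_ideal (inverse x)) I = \<O>"
    using x by (simp add: principal_mult principal_ideal_1)
  then have "iinv I = principal_ideal (inverse x)"
    using x by (intro G.inv_equality) (simp_all add: principal_fractional)
  then show "iinv I \<in> H" using x(1) by simp
next
  fix I J assume "I \<in> H" "J \<in> H"
  then show "I \<otimes>\<^bsub>ideal_group\<^esub> J \<in> H" by (auto simp: principal_mult)
qed

lemma normal_H: "H \<lhd> ideal_group"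
  by (rule G.subgroup_imp_normal[OF subgroup_H])

lemma cls_eq_set: "cls I = {iprod (principal_ideal x) I | x. x \<noteq> 0}"
  by (auto simp: cls_def r_coset_def)

lemma self_mem_cls: "I \<in> \<F> \<Longrightarrow> I \<in> cls I"
  unfolding cls_eq_set by (intro CollectI exI[of _ 1]) (simp add: principal_ideal_1 iprod_\<O>_left)

lemma cls_eq_iff:
  assumes "I \<in> \<F>" "J \<in> \<F>"
  shows "cls I = cls J \<longleftrightarrow> (\<exists>x. x \<noteq> 0 \<and> I = iprod (principal_ideal x) J)"
proof
  assume "cls I = cls J"
  then have "I \<in> cls J" using self_mem_cls[OF assms(1)] by simp
  then show "\<exists>x. x \<noteq> 0 \<and> I = iprod (principal_ideal x) J" by (auto simp: cls_eq_set)
next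
  assume "\<exists>x. x \<noteq> 0 \<and> I = iprod (principal_ideal x) J"
  then have "I \<in> cls J" by (auto simp: cls_eq_set)
  then show "cls I = cls J"
    unfolding cls_def using G.repr_independence[OF _ _ subgroup_H, of I J] assms(2) by simp
qed

lemma carrier_class_group: "carrier class_group = cls ` \<F>"
  unfolding class_group_def cls_def by (simp add: carrier_FactGroup)

lemma cls_mult: "I \<in> \<F> \<Longrightarrow> J \<in> \<F> \<Longrightarrow> cls I \<otimes>\<^bsub>class_group\<^esub> cls J = cls (iprod I J)"
  unfolding class_group_def cls_def using normal.rcos_sum[OF normal_H, of I J] by simp

lemma class_action_cls: "class_action (conj i) (cls I) = cls (conj i ` I)"
proof (intro equalityI subsetI)
  fix K assume "K \<in> class_action (conj i) (cls I)"
  then obtain x where "x \<noteq> 0" "K = conj i ` iprod (principal_ideal x) I"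
    by (auto simp: class_action_def cls_eq_set)
  then show "K \<in> cls (conj i ` I)"
    unfolding cls_eq_set by (intro CollectI exI[of _ "conj i x"]) (simp add: conj_image_iprod conj_image_principal)
next
  fix K assume "K \<in> cls (conj i ` I)"
  then obtain x where x: "x \<noteq> 0" "K = iprod (principal_ideal x) (conj i ` I)" by (auto simp: cls_eq_set)
  obtain y where y: "x = conj i y" using conj_surj by blast
  have "K = conj i ` iprod (principal_ideal y) I"
    by (simp add: x(2) y conj_image_iprod conj_image_principal)
  moreover have "y \<noteq> 0" using x(1) y by auto
  ultimately show "K \<in> class_action (conj i) (cls I)"
    by (auto simp: class_action_def cls_eq_set)
qed

lemma invariant_classes:
  assumes gal: "carrier (galois_group :: ('L \<Rightarrow> 'L) monoid) = range conj"
  shows "carrier class_group_invariants = cls ` range Jf"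
proof (intro equalityI subsetI)
  fix C :: "'L set set" assume "C \<in> carrier class_group_invariants"
  then have C: "C \<in> cls ` \<F>" "\<And>i. class_action (conj i) C = C"
    using gal by (auto simp: class_group_invariants_def carrier_class_group)
  then obtain I where I: "I \<in> \<F>" "C = cls I" by blast
  have "\<sigma> ` I \<in> \<F>" using conj_image_fractional[OF I(1), of 1] by simp
  moreover have "cls (\<sigma> ` I) = cls I" using C(2)[of 1] class_action_cls[of 1 I] I(2) by simp
  ultimately obtain a where "a \<noteq> 0" "\<sigma> ` I = iprod (principal_ideal a) I"
    using cls_eq_iff[of "\<sigma> ` I" I] I(1) by blast
  then obtain b where b: "b \<noteq> 0" "\<sigma> ` iprod (principal_ideal b) I = iprod (principal_ideal b) I"
    using invariant_class_representative[OF I(1)] by blast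
  define J where "J = iprod (principal_ideal b) I"
  have J: "J \<in> \<F>" unfolding J_def by (intro iprod_fractional principal_fractional b I)
  obtain r a where r: "r \<noteq> 0" "J = iprod (principal_ideal r) (Jf a)"
    using invariant_ideal[OF J] b(2) by (metis J_def)
  have "cls J = cls I" using cls_eq_iff[OF J I(1)] b(1) J_def by blast
  moreover have "cls J = cls (Jf a)" using cls_eq_iff[OF J Jf_fractional] r by blast
  ultimately have "C = cls (Jf a)" using I(2) by simp
  then show "C \<in> cls ` range Jf" by blast
next
  fix C :: "'L set set" assume "C \<in> cls ` range Jf"
  then obtain a where C: "C = cls (Jf a)" by blast
  have "class_action \<tau> C = C" if "\<tau> \<in> carrier galois_group" for \<tau>
    using that gal conj_image_invariant[OF Jf_invariant] by (auto simp: C class_action_cls)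
  then show "C \<in> carrier class_group_invariants"
    by (simp add: class_group_invariants_def carrier_class_group C Jf_fractional)
qed

lemma cls_Jf_cong:
  assumes "\<And>q. q \<in> ram \<Longrightarrow> int p dvd a q - b q"
  shows "cls (Jf a) = cls (Jf b)"
proof -
  obtain c where c: "\<And>q. q \<in> ram \<Longrightarrow> a q - b q = int p * c q" using assms unfolding dvd_def by metis
  have "Jf a = Jf (\<lambda>q. int p * c q + b q)"
    by (rule Jf_cong) (use c in \<open>simp add: algebra_simps flip: c\<close>)
  also have "\<dots> = iprod (principal_ideal (ram_prod c)) (Jf b)" by (simp only: Jf_add Jf_mult_p)
  finally show ?thesis using cls_eq_iff[OF Jf_fractional Jf_fractional] ram_prod_nonzero by blast
qed

text \<open>Every invariant class is that of some \<open>Jf a\<close> with \<open>a\<close> taken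
  modulo \<open>p\<close>. Subtracting a multiple of the relation \<open>a0\<close> makes the
  exponent at \<open>q0\<close> vanish modulo \<open>p\<close>, and by
  \<open>relation_unique\<close> the exponents at the other primes are then determined modulo
  \<open>p\<close>; \<open>ext\<close> puts 0 at \<open>q0\<close> and \<open>e\<close> renumbers
  the rest.\<close>

theorem class_group_invariants_iso:
  assumes gal: "carrier (galois_group :: ('L \<Rightarrow> 'L) monoid) = range conj"
  shows "(class_group_invariants :: 'L set set monoid)
    \<cong> product_group {..<card ram - 1} (\<lambda>_. integer_mod_group p)"
proof -
  obtain a0 x0 q0 where a0: "x0 \<noteq> 0" "Jf a0 = principal_ideal x0" "q0 \<in> ram" "\<not> int p dvd a0 q0"
    by (rule exists_relation)
  \<comment> \<open>\<open>q0 \<in> ram\<close>, so the subtraction is not truncated.\<close>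
  define n where "n = card ram - 1"
  have "card (ram - {q0}) = n" using finite_ram a0(3) by (simp add: n_def)
  then obtain e where e: "bij_betw e (ram - {q0}) {..<n}"
    using finite_ram by (metis atLeast0LessThan ex_bij_betw_finite_nat finite_Diff)
  let ?P = "product_group {..<n} (\<lambda>_. integer_mod_group p)"
  have p0: "p > 0" using p_gt_2 by simp
  have carP: "carrier ?P = {..<n} \<rightarrow>\<^sub>E {0..<int p}"
    using p0 by (simp add: carrier_integer_mod_group)
  define ext :: "(nat \<Rightarrow> int) \<Rightarrow> nat \<Rightarrow> int" where "ext b q = (if q = q0 then 0 else b (e q))" for b q
  define h where "h b = cls (Jf (ext b))" for b
  have en: "e q < n" if "q \<in> ram" "q \<noteq> q0" for q using e that by (auto simp: bij_betw_def)
  have "h \<in> iso ?P class_group_invariants"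
  proof (rule isoI)
    show "h \<in> hom ?P class_group_invariants"
    proof (rule homI)
      show "h b \<in> carrier class_group_invariants" for b
        by (simp add: invariant_classes[OF gal] h_def)
      fix b c assume "b \<in> carrier ?P" "c \<in> carrier ?P"
      have "h (b \<otimes>\<^bsub>?P\<^esub> c) = cls (Jf (\<lambda>q. ext b q + ext c q))"
        unfolding h_def
      proof (rule cls_Jf_cong)
        fix q assume q: "q \<in> ram"
        show "int p dvd ext (b \<otimes>\<^bsub>?P\<^esub> c) q - (ext b q + ext c q)"
          using en[OF q] by (simp add: ext_def flip: mod_eq_dvd_iff)
      qed
      also have "\<dots> = h b \<otimes>\<^bsub>class_group_invariants\<^esub> h c"
        by (simp add: h_def Jf_add class_group_invariants_def cls_mult Jf_fractional)
      finally show "h (b \<otimes>\<^bsub>?P\<^esub> c) = h b \<otimes>\<^bsub>class_group_invariants\<^esub> h c" .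
    qed
    show "bij_betw h (carrier ?P) (carrier class_group_invariants)"
    proof (rule bij_betw_imageI)
      show "inj_on h (carrier ?P)"
      proof (rule inj_onI)
        fix b c assume bc: "b \<in> carrier ?P" "c \<in> carrier ?P" "h b = h c"
        then obtain x where x: "x \<noteq> 0" "Jf (ext b) = iprod (principal_ideal x) (Jf (ext c))"
          unfolding h_def using cls_eq_iff[OF Jf_fractional Jf_fractional] by blast
        have "iprod (Jf (ext c)) (Jf (\<lambda>q. ext b q - ext c q)) = iprod (Jf (ext c)) (principal_ideal x)"
          using x(2) by (simp add: Jf_add[symmetric] iprod_commute[of "Jf (ext c)"])
        then have J: "Jf (\<lambda>q. ext b q - ext c q) = principal_ideal x"
          using iprod_cancel[OF Jf_fractional[of "ext c"]] Jf_fractional principal_fractional[OF x(1)]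
          by (metis subset_antisym subset_refl)
        have dvd: "int p dvd ext b q - ext c q" if "q \<in> ram" for q
          by (rule relation_unique[OF a0 x(1) J _ that]) (simp add: ext_def)
        show "b = c"
        proof (rule PiE_ext[of _ "{..<n}" "\<lambda>_. {0..<int p}"])
          show "b \<in> {..<n} \<rightarrow>\<^sub>E {0..<int p}" "c \<in> {..<n} \<rightarrow>\<^sub>E {0..<int p}" using bc carP by auto
          fix i assume i: "i \<in> {..<n}"
          then obtain q where q: "q \<in> ram" "q \<noteq> q0" "i = e q" using e by (auto simp: bij_betw_def)
          have "int p dvd b i - c i" using dvd[OF q(1)] q by (simp add: ext_def)
          then have "b i mod int p = c i mod int p" by (simp add: mod_eq_dvd_iff)
          moreover have "b i \<in> {0..<int p}" "c i \<in> {0..<int p}" using bc(1,2) i unfolding carP by (meson PiE_mem)+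
          ultimately show "b i = c i" by simp
        qed
      qed
      show "h ` carrier ?P = carrier class_group_invariants"
      proof (intro equalityI subsetI)
        fix C :: "'L set set" assume "C \<in> carrier class_group_invariants"
        then obtain a where C: "C = cls (Jf a)" by (auto simp: invariant_classes[OF gal])
        have "Rings.coprime (int p) (a0 q0)" using a0(4) prime_p by (intro prime_imp_coprime) simp_all
        then obtain u v where uv: "u * int p + v * a0 q0 = 1" using bezout_int[of "int p" "a0 q0"] by auto
        \<comment> \<open>\<open>v\<close> inverts \<open>a0 q0\<close> modulo \<open>p\<close>, so
          \<open>k\<close> is the multiple of \<open>a0\<close> that cancels the exponent of
          \<open>a\<close> at \<open>q0\<close> modulo \<open>p\<close>.\<close>
        define k where "k = nat ((v * a q0) mod int p)"
        have k: "int k = (v * a q0) mod int p" using p0 by (simp add: k_def)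
        define a1 where "a1 q = a q - int k * a0 q" for q
        have "Jf (\<lambda>q. int k * a0 q) = principal_ideal (x0 ^ k)"
          unfolding Jf_pow[symmetric] a0(2) by (rule principal_pow[OF a0(1)])
        then have "Jf a = iprod (principal_ideal (x0 ^ k)) (Jf a1)"
          by (simp add: Jf_add[symmetric] a1_def flip: \<open>Jf (\<lambda>q. int k * a0 q) = _\<close>)
        then have C1: "C = cls (Jf a1)"
          unfolding C using cls_eq_iff[OF Jf_fractional Jf_fractional, of a a1] power_not_zero[OF a0(1), of k] by blast
        have "int p dvd v * a q0 - int k" by (simp add: k flip: mod_eq_dvd_iff)
        then obtain w where "v * a q0 - int k = int p * w" by (rule dvdE)
        then have kw: "int k = v * a q0 - int p * w" by simp
        have "a1 q0 = a q0 * (1 - v * a0 q0) + int p * (w * a0 q0)"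
          unfolding a1_def kw by (simp add: algebra_simps)
        also have "1 - v * a0 q0 = u * int p" using uv by simp
        finally have dvd0: "int p dvd a1 q0" by simp
        define b where "b = (\<lambda>i\<in>{..<n}. a1 (inv_into (ram - {q0}) e i) mod int p)"
        have "b \<in> carrier ?P" unfolding carP b_def using p0 by auto
        moreover have "C = h b"
          unfolding C1 h_def
        proof (rule cls_Jf_cong)
          fix q assume q: "q \<in> ram"
          show "int p dvd a1 q - ext b q"
          proof (cases "q = q0")
            case False
            have "inv_into (ram - {q0}) e (e q) = q"
              using e q False by (intro inv_into_f_f) (auto simp: bij_betw_def)
            then show ?thesis using en[OF q False] False by (simp add: ext_def b_def flip: mod_eq_dvd_iff)
          qed (use dvd0 in \<open>simp add: ext_def\<close>)
        qed
        ultimately show "C \<in> h ` carrier ?P" by blast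
      qed (auto simp: invariant_classes[OF gal] h_def)
    qed
  qed
  moreover have "group ?P" by simp
  ultimately show ?thesis
    using group.iso_set_sym unfolding is_iso_def n_def by blast
qed

end

section \<open>Generators of the Galois group\<close>

lemma galois_group_carrier:
  "\<tau> \<in> carrier (galois_group :: ('L::field_char_0 \<Rightarrow> 'L) monoid) \<longleftrightarrow>
     bij \<tau> \<and> (\<forall>x y. \<tau> (x + y) = \<tau> x + \<tau> y) \<and> (\<forall>x y. \<tau> (x * y) = \<tau> x * \<tau> y) \<and> \<tau> 1 = 1 \<and>
     (\<forall>r. \<tau> (of_rat r) = of_rat r)"
  by (auto simp: galois_group_def ring_iso_def Ring.ring_hom_def ring_of_type_algebra_def)

text \<open>The generator is the preimage of 1. The isomorphism lets identities between
  automorphisms be checked on residues modulo \<open>p\<close>, and natural powers already give the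
  whole group.\<close>

lemma galois_group_generator:
  assumes "p > 1" "(galois_group :: ('L::field_char_0 \<Rightarrow> 'L) monoid) \<cong> integer_mod_group p"
  obtains \<sigma> where "\<sigma> \<in> carrier (galois_group :: ('L \<Rightarrow> 'L) monoid)" "\<sigma> ^^ p = id" "\<sigma> \<noteq> id"
    "carrier (galois_group :: ('L \<Rightarrow> 'L) monoid) = range (\<lambda>i. \<sigma> ^^ i)"
proof -
  let ?G = "galois_group :: ('L \<Rightarrow> 'L) monoid"
  obtain h where h: "h \<in> iso ?G (integer_mod_group p)" using assms(2) by (auto simp: is_iso_def)
  have bij: "bij_betw h (carrier ?G) {0..<int p}"
    using h assms(1) by (simp add: iso_def carrier_integer_mod_group)
  have comp: "h (f \<circ> g) = (h f + h g) mod int p" if "f \<in> carrier ?G" "g \<in> carrier ?G" for f g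
    using h that by (auto simp: iso_def hom_def galois_group_def)
  have closed: "f \<circ> g \<in> carrier ?G" if "f \<in> carrier ?G" "g \<in> carrier ?G" for f g
    using that by (auto simp: galois_group_carrier intro: bij_comp)
  have id: "id \<in> carrier ?G" by (simp add: galois_group_carrier)
  have range: "h f \<in> {0..<int p}" if "f \<in> carrier ?G" for f using bij that by (auto simp: bij_betw_def)
  have "1 \<in> {0..<int p}" using assms(1) by simp
  then obtain \<sigma> where \<sigma>: "\<sigma> \<in> carrier ?G" "h \<sigma> = 1" using bij by (metis bij_betwE bij_betw_imp_surj_on imageE)
  have h0: "h id = 0"
  proof -
    have "h id = (h id + h id) mod int p" using comp[OF id id] by simp
    then have "int p dvd h id" by (metis add_diff_cancel_right' dvd_minus_mod minus_mod_eq_mult_div dvd_triv_left mod_eq_dvd_iff range[OF id] mod_pos_pos_trivial atLeastLessThan_iff)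
    then show ?thesis using range[OF id] by (metis atLeastLessThan_iff dvd_imp_mod_0 mod_pos_pos_trivial)
  qed
  have pow: "\<sigma> ^^ i \<in> carrier ?G \<and> h (\<sigma> ^^ i) = int i mod int p" for i
  proof (induction i)
    case 0
    then show ?case using id h0 by (simp add: id_def)
  next
    case (Suc i)
    then show ?case
      unfolding funpow.simps(2)
      using closed[OF \<sigma>(1), of "\<sigma> ^^ i"] comp[OF \<sigma>(1), of "\<sigma> ^^ i"] \<sigma>(2)
      by (simp add: mod_simps o_def)
  qed
  have inj: "f = g" if "f \<in> carrier ?G" "g \<in> carrier ?G" "h f = h g" for f g
    using bij that by (auto simp: bij_betw_def dest: inj_onD)
  show thesis
  proof (rule that[OF \<sigma>(1)])
    show "\<sigma> ^^ p = id" using pow[of p] id h0 by (intro inj) auto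
    show "\<sigma> \<noteq> id" using \<sigma>(2) h0 by auto
    show "carrier ?G = range (\<lambda>i. \<sigma> ^^ i)"
    proof (intro equalityI subsetI)
      fix f assume f: "f \<in> carrier ?G"
      have "f = \<sigma> ^^ nat (h f)"
        using f pow[of "nat (h f)"] range[OF f] by (intro inj) auto
      then show "f \<in> range (\<lambda>i. \<sigma> ^^ i)" by blast
    qed (use pow in auto)
  qed
qed

theorem theorem1p5:
  fixes p s :: nat
  assumes "Factorial_Ring.prime p" and "p \<noteq> 2"
    and "galois_over_rat TYPE('L::field_char_0)"
    and "rat_degree TYPE('L) = p"
    and "(galois_group :: ('L \<Rightarrow> 'L) monoid) \<cong> integer_mod_group p"
    and "s = card (ramified_primes TYPE('L))"
  shows "(class_group_invariants :: 'L set set monoid)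
           \<cong> product_group {..<s - 1} (\<lambda>_. integer_mod_group p)"
proof -
  obtain \<sigma> :: "'L \<Rightarrow> 'L" where \<sigma>: "\<sigma> \<in> carrier galois_group" "\<sigma> ^^ p = id" "\<sigma> \<noteq> id"
    and gal: "carrier (galois_group :: ('L \<Rightarrow> 'L) monoid) = range (\<lambda>i. \<sigma> ^^ i)"
    using galois_group_generator[OF prime_gt_1_nat[OF assms(1)] assms(5)] by metis
  have fixed: "x \<in> \<rat>" if "\<sigma> x = x" for x
  proof -
    have "(\<sigma> ^^ i) x = x" for i by (induction i) (simp_all add: that)
    then have "\<forall>\<tau>\<in>carrier galois_group. \<tau> x = x" unfolding gal by blast
    then show ?thesis using assms(3) by (auto simp: galois_over_rat_def)
  qed
  interpret cyclic_field \<sigma> p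
  proof
    show "odd p" using assms(1,2) by (metis prime_odd_nat prime_ge_2_nat le_neq_implies_less)
    show "(\<sigma> ^^ p) x = x" for x using \<sigma>(2) by simp
    show "\<exists>x. \<sigma> x \<noteq> x" using \<sigma>(3) by (auto simp: fun_eq_iff)
    show "algebraic x" for x :: 'L using assms(3) by (simp add: galois_over_rat_def)
  qed (use \<sigma>(1) assms(1) fixed in \<open>auto simp: galois_group_carrier\<close>)
  show ?thesis
    using class_group_invariants_iso[OF gal] assms(6) by (simp add: ramified_primes_eq)
qed

end
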